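(* Let $(A,\lhd,\rhd,\succ,\diamond)$ be a pre-PGD-algebra, let $(P=\mathbf k[\partial]\otimes_{\mathbf k}A,\circ_\lambda,\succ_\lambda)$ be the corresponding pre-Poisson conformal algebra, i.e. $a\circ_\lambda b=\partial(b\lhd a)+\lambda(a\rhd b+b\lhd a)+a\diamond b$ and $a\succ_\lambda b=a\succ b$ for $a,b\in A$, and let $(P,[\cdot_\lambda\cdot],\cdot_\lambda\cdot)$ be its associated Poisson conformal algebra, i.e. $[a_\lambda b]=a\circ_\lambda b-b\circ_{-\lambda-\partial}a$ and $a_\lambda b=a\succ_\lambda b+b\succ_{-\lambda-\partial}a$. Let $\{e_1,\ldots,e_n\}$ be a basis of $A$ and $\{e_1^\ast,\ldots,e_n^\ast\}$ the dual basis of $A^\ast$. Then $$r=\sum_{i=1}^n(e_i\otimes e_i^\ast-e_i^\ast\otimes e_i)$$ is a skew-symmetric solution of the Poisson conformal Yang-Baxter equation (PCYBE) in the Poisson conformal algebra $\hat P=P\ltimes_{\mathfrak L_\circ^\ast,-\mathfrak L_\succ^\ast}P^{\ast c}$. Therefore there is a Poisson conformal bialgebra structure on the Poisson conformal algebra $\hat P$ given by $$\delta(a)=(\mathfrak{ad}_{\hat P}(a)_\lambda\otimes I+I\otimes\mathfrak{ad}_{\hat P}(a)_\lambda)r\big|_{\lambda=-\partial^{\otimes^2}},\qquad\Delta(a)=(I\otimes\mathfrak L_{\hat P}(a)_\lambda-\mathfrak L_{\hat P}(a)_\lambda\otimes I)r\big|_{\lambda=-\partial^{\otimes^2}},\qquad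 a\in\hat P.$$
   Context: Let $\mathbf k$ be a field of characteristic $0$; vector spaces are finite-dimensional, $\otimes$ is over $\mathbf k$, binary operations are bilinear, $I$ is the identity, $\tau(u\otimes v)=v\otimes u$; skew-symmetric means $\tau r=-r$. All $\lambda$-products on $P=\mathbf k[\partial]\otimes A$ are extended from $A$ by sesquilinearity: $(\partial a)\ast_\lambda b=-\lambda a\ast_\lambda b$, $a\ast_\lambda(\partial b)=(\partial+\lambda)a\ast_\lambda b$. If $b\ast_\nu a=\sum_k\nu^kc_k$, then $b\ast_{-\lambda-\partial}a=\sum_k(-\lambda-\partial)^kc_k$. Zinbiel algebra $(A,\succ)$: $a\succ(b\succ c)=(b\succ a+a\succ b)\succ c$. Left-symmetric algebra $(A,\diamond)$: $(a\diamond b)\diamond c-a\diamond(b\diamond c)=(b\diamond a)\diamond c-b\diamond(a\diamond c)$. Pre-Novikov algebra $(A,\lhd,\rhd)$: $a\rhd(b\rhd c)=(a\rhd b+a\lhd b)\rhd c+b\rhd(a\rhd c)-(b\rhd a+b\lhd a)\rhd c$; $a\rhd(b\lhd c)=(a\rhd b)\lhd c+b\lhd(a\lhd c+a\rhd c)-(b\lhd a)\lhd c$; $(a\lhd b+a\rhd b)\rhd c=(a\rhd c)\lhd b$; $(a\lhd b)\lhd c=(a\lhd c)\lhd b$. Pre-GD-algebra $(A,\lhd,\rhd,\diamond)$: $(A,\lhd,\rhd)$ pre-Novikov, $(A,\diamond)$ left-symmetric, and $c\lhd(a\diamond b-b\diamond a)-a\diamond(c\lhd b)-(b\diamond c)\lhd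 a=-b\diamond(c\lhd a)-(a\diamond c)\lhd b$; $(a\diamond b-b\diamond a)\rhd c+(a\lhd b+a\rhd b)\diamond c=a\rhd(b\diamond c)-b\diamond(a\rhd c)+(a\diamond c)\lhd b$. Pre-Poisson algebra $(A,\diamond,\succ)$: $(A,\diamond)$ left-symmetric, $(A,\succ)$ Zinbiel, and $(a\diamond b-b\diamond a)\succ c=a\diamond(b\succ c)-b\succ(a\diamond c)$; $(a\succ b+b\succ a)\diamond c=a\succ(b\diamond c)+b\succ(a\diamond c)$. Pre-differential Novikov-Poisson algebra $(A,\lhd,\rhd,\succ)$: $(A,\lhd,\rhd)$ pre-Novikov, $(A,\succ)$ Zinbiel, and $(a\succ b+b\succ a)\rhd c=a\succ(b\rhd c)$; $(a\succ c)\lhd b=a\succ(c\lhd b)=(a\lhd b+a\rhd b)\succ c$; $a\rhd(b\succ c)=(a\lhd b+a\rhd b)\succ c+b\succ(a\rhd c)$; $c\lhd(a\succ b+b\succ a)=b\succ(c\lhd a)+a\succ(c\lhd b)$. Pre-PGD-algebra $(A,\lhd,\rhd,\succ,\diamond)$: $(A,\lhd,\rhd,\succ)$ is a pre-differential Novikov-Poisson algebra, $(A,\lhd,\rhd,\diamond)$ a pre-GD-algebra and $(A,\diamond,\succ)$ a pre-Poisson algebra. A Poisson conformal algebra $(Q,[\cdot_\lambda\cdot],\cdot_\lambda\cdot)$ is a $\mathbf k[\partial]$-module with $\mathbf k$-bilinear sesquilinear maps $Q\times Q\to Q[\lambda]$ such that $[a_\lambda b]=-[b_{-\lambda-\partial}a]$,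 $[a_\lambda[b_\mu c]]=[[a_\lambda b]_{\lambda+\mu}c]+[b_\mu[a_\lambda c]]$, $(a_\lambda b)_{\lambda+\mu}c=a_\lambda(b_\mu c)$, $a_\lambda b=b_{-\lambda-\partial}a$, $[a_\lambda(b_\mu c)]=[a_\lambda b]_{\lambda+\mu}c+b_\mu[a_\lambda c]$. Write $\mathfrak{ad}_Q(a)_\lambda b=[a_\lambda b]$, $\mathfrak L_Q(a)_\lambda b=a_\lambda b$. $P^{\ast c}$ is the set of $\mathbf k$-linear maps $f_\lambda:P\to\mathbf k[\lambda]$ with $f_\lambda(\partial u)=\lambda f_\lambda(u)$, a $\mathbf k[\partial]$-module via $(\partial f)_\lambda=-\lambda f_\lambda$; $P^{\ast c}=\mathbf k[\partial]\otimes A^\ast$ with $(e_i^\ast)_\lambda(e_j)=\delta_{ij}$. For $\mathfrak L_\circ(a)_\lambda b=a\circ_\lambda b$, $\mathfrak L_\succ(a)_\lambda b=a\succ_\lambda b$, define $(\mathfrak L_\circ^\ast(a)_\lambda f)_\mu u=-f_{\mu-\lambda}(a\circ_\lambda u)$, $(\mathfrak L_\succ^\ast(a)_\lambda f)_\mu u=-f_{\mu-\lambda}(a\succ_\lambda u)$. The semi-direct product $\hat P$ is the Poisson conformal algebra on $P\oplus P^{\ast c}$ with $[(a+f)_\lambda(b+g)]=[a_\lambda b]+\mathfrak L_\circ^\ast(a)_\lambda g-\mathfrak L_\circ^\ast(b)_{-\lambda-\partial}f$ and $(a+f)_\lambda(b+g)=a_\lambda b-\mathfrak L_\succ^\ast(a)_\lambda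 g-\mathfrak L_\succ^\ast(b)_{-\lambda-\partial}f$. Put $\partial^{\otimes^2}=\partial\otimes I+I\otimes\partial$, $\partial^{\otimes^3}=\partial\otimes I\otimes I+I\otimes\partial\otimes I+I\otimes I\otimes\partial$. Substituting an operator for a parameter means letting the resulting polynomial act on the tensor coefficients: if $T_\nu u=\sum_k\nu^kw_k$ then $(T_{-\lambda-\partial^{\otimes^2}}\otimes I)(u\otimes v)=\sum_k(-\lambda-\partial^{\otimes^2})^k(w_k\otimes v)$, etc. For $r=\sum_ir_i\otimes l_i\in Q\otimes Q$: $[[r,r]]=\sum_{i,j}\big([{r_i}_\mu r_j]\otimes l_i\otimes l_j|_{\mu=I\otimes\partial\otimes I}-r_i\otimes[{r_j}_\mu l_i]\otimes l_j|_{\mu=I\otimes I\otimes\partial}-r_i\otimes r_j\otimes[{l_j}_\mu l_i]|_{\mu=I\otimes\partial\otimes I}\big)$, $r\bullet r=\sum_{i,j}\big(r_i\otimes r_j\otimes{l_i}_\mu l_j|_{\mu=\partial\otimes I\otimes I}-r_i\otimes{r_j}_\mu l_i\otimes l_j|_{\mu=-\partial^{\otimes^2}\otimes I}+{r_i}_\mu r_j\otimes l_i\otimes l_j|_{\mu=I\otimes\partial\otimes I}\big)$. $r$ is a solution of the PCYBE in $Q$ if both lie in $\partial^{\otimes^3}(Q\otimes Q\otimes Q)$. For $\mathbf k[\partial]$-module homomorphisms $\delta,\Delta:Q\to Q\otimes Q$ ($\partial$ acting on $Q\otimes Q$ by $\partial^{\otimes^2}$), $(Q,\delta,\Delta)$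 is a Poisson conformal coalgebra if $(I\otimes\Delta)\Delta=(\Delta\otimes I)\Delta$, $\Delta=\tau\Delta$, $\delta=-\tau\delta$, $(I\otimes\delta)\delta-(\tau\otimes I)(I\otimes\delta)\delta=(\delta\otimes I)\delta$, $(I\otimes\Delta)\delta=(\delta\otimes I)\Delta+(\tau\otimes I)(I\otimes\delta)\Delta$. $(Q,[\cdot_\lambda\cdot],\cdot_\lambda\cdot,\delta,\Delta)$ is a Poisson conformal bialgebra if it is a Poisson conformal algebra and coalgebra and for all $a,b\in Q$: (i) $\delta([a_\lambda b])=(\mathfrak{ad}_Q(a)_\lambda\otimes I+I\otimes\mathfrak{ad}_Q(a)_\lambda)\delta(b)-(\mathfrak{ad}_Q(b)_{-\lambda-\partial^{\otimes^2}}\otimes I+I\otimes\mathfrak{ad}_Q(b)_{-\lambda-\partial^{\otimes^2}})\delta(a)$; (ii) $\Delta(a_\lambda b)=(I\otimes\mathfrak L_Q(a)_\lambda)\Delta(b)+(\mathfrak L_Q(b)_{-\lambda-\partial^{\otimes^2}}\otimes I)\Delta(a)$; (iii) $\delta(a_\lambda b)=(\mathfrak L_Q(a)_\lambda\otimes I)\delta(b)+(\mathfrak L_Q(b)_{-\lambda-\partial^{\otimes^2}}\otimes I)\delta(a)+(I\otimes\mathfrak{ad}_Q(a)_\lambda)\Delta(b)+(I\otimes\mathfrak{ad}_Q(b)_{-\lambda-\partial^{\otimes^2}})\Delta(a)$; (iv) $\Delta([a_\lambda b])=(\mathfrak{ad}_Q(a)_\lambda\otimes I+I\otimes\mathfrak{ad}_Q(a)_\lambda)\Delta(b)-(I\otimes\mathfrak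 L_Q(b)_{-\lambda-\partial^{\otimes^2}})\delta(a)+(\mathfrak L_Q(b)_{-\lambda-\partial^{\otimes^2}}\otimes I)\delta(a)$. *)

theory Defs
  imports
    "HOL-Computational_Algebra.Polynomial"
    "HOL-Library.Function_Algebras"
    "HOL-Library.Product_Plus"
begin

section \<open>Algebras on a vector space\<close>

text \<open>A bilinear operation on the vector space with underlying type \<open>'a\<close> and scalar
  multiplication \<open>s\<close>.\<close>

definition bilinear_op :: "('k::field \<Rightarrow> 'a::ab_group_add \<Rightarrow> 'a) \<Rightarrow> ('a \<Rightarrow> 'a \<Rightarrow> 'a) \<Rightarrow> bool" where
  "bilinear_op s m \<longleftrightarrow>
     (\<forall>a. Vector_Spaces.linear s s (\<lambda>b. m a b)) \<and> (\<forall>b. Vector_Spaces.linear s s (\<lambda>a. m a b))"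

definition zinbiel :: "('k::field \<Rightarrow> 'a::ab_group_add \<Rightarrow> 'a) \<Rightarrow> ('a \<Rightarrow> 'a \<Rightarrow> 'a) \<Rightarrow> bool" where
  "zinbiel s z \<longleftrightarrow> bilinear_op s z \<and>
     (\<forall>a b c. z a (z b c) = z (z b a + z a b) c)"

definition left_symmetric :: "('k::field \<Rightarrow> 'a::ab_group_add \<Rightarrow> 'a) \<Rightarrow> ('a \<Rightarrow> 'a \<Rightarrow> 'a) \<Rightarrow> bool" where
  "left_symmetric s d \<longleftrightarrow> bilinear_op s d \<and>
     (\<forall>a b c. d (d a b) c - d a (d b c) = d (d b a) c - d b (d a c))"

text \<open>Below \<open>l\<close>, \<open>r\<close>, \<open>z\<close>, \<open>d\<close> stand for \<open>\<lhd>\<close>, \<open>\<rhd>\<close>, \<open>\<succ>\<close>, \<open>\<diamond>\<close>, all written in prefix form: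
  \<open>l a b\<close> is \<open>a \<lhd> b\<close>.\<close>

definition pre_novikov ::
  "('k::field \<Rightarrow> 'a::ab_group_add \<Rightarrow> 'a) \<Rightarrow> ('a \<Rightarrow> 'a \<Rightarrow> 'a) \<Rightarrow> ('a \<Rightarrow> 'a \<Rightarrow> 'a) \<Rightarrow> bool" where
  "pre_novikov s l r \<longleftrightarrow> bilinear_op s l \<and> bilinear_op s r \<and>
     (\<forall>a b c. r a (r b c) = r (r a b + l a b) c + r b (r a c) - r (r b a + l b a) c) \<and>
     (\<forall>a b c. r a (l b c) = l (r a b) c + l b (l a c + r a c) - l (l b a) c) \<and>
     (\<forall>a b c. r (l a b + r a b) c = l (r a c) b) \<and>
     (\<forall>a b c. l (l a b) c = l (l a c) b)"

definition pre_GD ::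
  "('k::field \<Rightarrow> 'a::ab_group_add \<Rightarrow> 'a) \<Rightarrow> ('a \<Rightarrow> 'a \<Rightarrow> 'a) \<Rightarrow> ('a \<Rightarrow> 'a \<Rightarrow> 'a) \<Rightarrow>
   ('a \<Rightarrow> 'a \<Rightarrow> 'a) \<Rightarrow> bool" where
  "pre_GD s l r d \<longleftrightarrow> pre_novikov s l r \<and> left_symmetric s d \<and>
     (\<forall>a b c. l c (d a b - d b a) - d a (l c b) - l (d b c) a = - d b (l c a) - l (d a c) b) \<and>
     (\<forall>a b c. r (d a b - d b a) c + d (l a b + r a b) c = r a (d b c) - d b (r a c) + l (d a c) b)"

definition pre_poisson ::
  "('k::field \<Rightarrow> 'a::ab_group_add \<Rightarrow> 'a) \<Rightarrow> ('a \<Rightarrow> 'a \<Rightarrow> 'a) \<Rightarrow> ('a \<Rightarrow> 'a \<Rightarrow> 'a) \<Rightarrow> bool" where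
  "pre_poisson s d z \<longleftrightarrow> left_symmetric s d \<and> zinbiel s z \<and>
     (\<forall>a b c. z (d a b - d b a) c = d a (z b c) - z b (d a c)) \<and>
     (\<forall>a b c. d (z a b + z b a) c = z a (d b c) + z b (d a c))"

definition pre_diff_novikov_poisson ::
  "('k::field \<Rightarrow> 'a::ab_group_add \<Rightarrow> 'a) \<Rightarrow> ('a \<Rightarrow> 'a \<Rightarrow> 'a) \<Rightarrow> ('a \<Rightarrow> 'a \<Rightarrow> 'a) \<Rightarrow>
   ('a \<Rightarrow> 'a \<Rightarrow> 'a) \<Rightarrow> bool" where
  "pre_diff_novikov_poisson s l r z \<longleftrightarrow> pre_novikov s l r \<and> zinbiel s z \<and>
     (\<forall>a b c. r (z a b + z b a) c = z a (r b c)) \<and>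
     (\<forall>a b c. l (z a c) b = z a (l c b) \<and> z a (l c b) = z (l a b + r a b) c) \<and>
     (\<forall>a b c. r a (z b c) = z (l a b + r a b) c + z b (r a c)) \<and>
     (\<forall>a b c. l c (z a b + z b a) = z b (l c a) + z a (l c b))"

definition pre_PGD ::
  "('k::field \<Rightarrow> 'a::ab_group_add \<Rightarrow> 'a) \<Rightarrow> ('a \<Rightarrow> 'a \<Rightarrow> 'a) \<Rightarrow> ('a \<Rightarrow> 'a \<Rightarrow> 'a) \<Rightarrow>
   ('a \<Rightarrow> 'a \<Rightarrow> 'a) \<Rightarrow> ('a \<Rightarrow> 'a \<Rightarrow> 'a) \<Rightarrow> bool" where
  "pre_PGD s l r z d \<longleftrightarrow>
     pre_diff_novikov_poisson s l r z \<and> pre_GD s l r d \<and> pre_poisson s d z"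


section \<open>Modules over k[\<open>\<partial>\<close>] and conformal products\<close>

text \<open>A module over k[\<open>\<partial>\<close>] is a k-subspace \<open>car\<close> of an ambient k-vector space together with
  a linear endomorphism \<open>der\<close> of \<open>car\<close>, the action of \<open>\<partial>\<close>.  A \<open>\<lambda>\<close>-product takes values in
  the polynomials in \<open>\<lambda>\<close> with coefficients in the module.\<close>

record (overloaded) ('k, 'q) kd_mod =
  car :: "'q set"
  scl :: "'k \<Rightarrow> 'q \<Rightarrow> 'q"
  der :: "'q \<Rightarrow> 'q"

record (overloaded) ('k, 'q) pc_alg = "('k, 'q) kd_mod" +
  brk :: "'q \<Rightarrow> 'q \<Rightarrow> 'q poly"
  mul :: "'q \<Rightarrow> 'q \<Rightarrow> 'q poly"

definition kd_module :: "('k::field, 'q::ab_group_add, 'z) kd_mod_scheme \<Rightarrow> bool" where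
  "kd_module Q \<longleftrightarrow> vector_space (scl Q) \<and> module.subspace (scl Q) (car Q) \<and>
     (\<forall>x\<in>car Q. der Q x \<in> car Q) \<and>
     (\<forall>x\<in>car Q. \<forall>y\<in>car Q. der Q (x + y) = der Q x + der Q y) \<and>
     (\<forall>c. \<forall>x\<in>car Q. der Q (scl Q c x) = scl Q c (der Q x))"

text \<open>Substitution of an operator for the parameter: if \<open>p = \<Sum>\<^sub>k \<nu>\<^sup>k w\<^sub>k\<close>, then
  \<open>lsubst T \<iota> p = \<Sum>\<^sub>k T\<^sup>k (\<iota> w\<^sub>k)\<close>.\<close>

definition lsubst :: "('m \<Rightarrow> 'm) \<Rightarrow> ('q \<Rightarrow> 'm) \<Rightarrow> 'q::zero poly \<Rightarrow> 'm::comm_monoid_add" where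
  "lsubst T \<iota> p = (\<Sum>k\<le>degree p. (T ^^ k) (\<iota> (coeff p k)))"

text \<open>The operator \<open>-\<lambda>-\<partial>\<close> on polynomials in \<open>\<lambda>\<close>, and \<open>b *\<^bsub>-\<lambda>-\<partial>\<^esub> a\<close> obtained from \<open>b *\<^bsub>\<nu>\<^esub> a\<close>.\<close>

definition neg_lam_der :: "('q \<Rightarrow> 'q) \<Rightarrow> 'q::ab_group_add poly \<Rightarrow> 'q poly" where
  "neg_lam_der D p = - pCons 0 p - map_poly D p"

definition skew_subst :: "('q \<Rightarrow> 'q) \<Rightarrow> 'q::ab_group_add poly \<Rightarrow> 'q poly" where
  "skew_subst D p = lsubst (neg_lam_der D) (\<lambda>x. [:x:]) p"

text \<open>Q[\<open>\<lambda>,\<mu>\<close>] is rendered as \<open>'q poly poly\<close> with outer variable \<open>\<lambda>\<close> and inner variable \<open>\<mu>\<close>.\<close>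

definition lam_op :: "'q::zero poly poly \<Rightarrow> 'q poly poly" where
  "lam_op p = pCons 0 p"

definition mu_op :: "'q::zero poly poly \<Rightarrow> 'q poly poly" where
  "mu_op p = map_poly (pCons 0) p"

text \<open>\<open>nest_right f g S T a b c\<close> is \<open>f(a, g(b, c))\<close> where the outer product \<open>f\<close> has the
  parameter \<open>S\<close> and the inner product \<open>g\<close> has the parameter \<open>T\<close>; \<open>nest_left f g S T a b c\<close> is
  \<open>f(g(a, b), c)\<close> where the inner product \<open>g\<close> has the parameter \<open>S\<close> and the outer product \<open>f\<close>
  has the parameter \<open>T\<close>.\<close>

definition nest_right :: "('q \<Rightarrow> 'q \<Rightarrow> 'q poly) \<Rightarrow> ('q \<Rightarrow> 'q \<Rightarrow> 'q poly) \<Rightarrow>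
    ('q poly poly \<Rightarrow> 'q poly poly) \<Rightarrow> ('q poly poly \<Rightarrow> 'q poly poly) \<Rightarrow>
    'q \<Rightarrow> 'q \<Rightarrow> 'q \<Rightarrow> 'q::ab_group_add poly poly" where
  "nest_right f g S T a b c = lsubst T (\<lambda>x. lsubst S (\<lambda>y. [:[:y:]:]) (f a x)) (g b c)"

definition nest_left :: "('q \<Rightarrow> 'q \<Rightarrow> 'q poly) \<Rightarrow> ('q \<Rightarrow> 'q \<Rightarrow> 'q poly) \<Rightarrow>
    ('q poly poly \<Rightarrow> 'q poly poly) \<Rightarrow> ('q poly poly \<Rightarrow> 'q poly poly) \<Rightarrow>
    'q \<Rightarrow> 'q \<Rightarrow> 'q \<Rightarrow> 'q::ab_group_add poly poly" where
  "nest_left f g S T a b c = lsubst S (\<lambda>x. lsubst T (\<lambda>y. [:[:y:]:]) (f x c)) (g a b)"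

definition sesquilinear ::
  "('k::field, 'q::ab_group_add, 'z) kd_mod_scheme \<Rightarrow> ('q \<Rightarrow> 'q \<Rightarrow> 'q poly) \<Rightarrow> bool" where
  "sesquilinear Q f \<longleftrightarrow>
     (\<forall>a\<in>car Q. \<forall>b\<in>car Q. \<forall>k. coeff (f a b) k \<in> car Q) \<and>
     (\<forall>a\<in>car Q. \<forall>a'\<in>car Q. \<forall>b\<in>car Q. f (a + a') b = f a b + f a' b) \<and>
     (\<forall>a\<in>car Q. \<forall>b\<in>car Q. \<forall>b'\<in>car Q. f a (b + b') = f a b + f a b') \<and>
     (\<forall>c. \<forall>a\<in>car Q. \<forall>b\<in>car Q. f (scl Q c a) b = map_poly (scl Q c) (f a b)) \<and>
     (\<forall>c. \<forall>a\<in>car Q. \<forall>b\<in>car Q. f a (scl Q c b) = map_poly (scl Q c) (f a b)) \<and>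
     (\<forall>a\<in>car Q. \<forall>b\<in>car Q. f (der Q a) b = - pCons 0 (f a b)) \<and>
     (\<forall>a\<in>car Q. \<forall>b\<in>car Q. f a (der Q b) = map_poly (der Q) (f a b) + pCons 0 (f a b))"

definition poisson_conformal_algebra ::
  "('k::field, 'q::ab_group_add, 'z) pc_alg_scheme \<Rightarrow> bool" where
  "poisson_conformal_algebra Q \<longleftrightarrow>
     kd_module Q \<and> sesquilinear Q (brk Q) \<and> sesquilinear Q (mul Q) \<and>
     (\<forall>a\<in>car Q. \<forall>b\<in>car Q. brk Q a b = - skew_subst (der Q) (brk Q b a)) \<and>
     (\<forall>a\<in>car Q. \<forall>b\<in>car Q. \<forall>c\<in>car Q.
        nest_right (brk Q) (brk Q) lam_op mu_op a b c =
        nest_left (brk Q) (brk Q) lam_op (\<lambda>p. lam_op p + mu_op p) a b c +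
        nest_right (brk Q) (brk Q) mu_op lam_op b a c) \<and>
     (\<forall>a\<in>car Q. \<forall>b\<in>car Q. \<forall>c\<in>car Q.
        nest_left (mul Q) (mul Q) lam_op (\<lambda>p. lam_op p + mu_op p) a b c =
        nest_right (mul Q) (mul Q) lam_op mu_op a b c) \<and>
     (\<forall>a\<in>car Q. \<forall>b\<in>car Q. mul Q a b = skew_subst (der Q) (mul Q b a)) \<and>
     (\<forall>a\<in>car Q. \<forall>b\<in>car Q. \<forall>c\<in>car Q.
        nest_right (brk Q) (mul Q) lam_op mu_op a b c =
        nest_left (mul Q) (brk Q) lam_op (\<lambda>p. lam_op p + mu_op p) a b c +
        nest_right (mul Q) (brk Q) mu_op lam_op b a c)"


section \<open>Tensor products\<close>

text \<open>\<open>Q \<otimes> Q\<close> is realised inside the bilinear forms on the dual space of \<open>Q\<close>: the pure tensor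
  \<open>u \<otimes> v\<close> is \<open>(f, g) \<mapsto> f(u) g(v)\<close>, and \<open>Q \<otimes> Q\<close> consists of the finite sums of pure tensors;
  similarly for \<open>Q \<otimes> Q \<otimes> Q\<close>.  Functionals only matter through their values on \<open>car Q\<close>.
  Over a field this is the tensor product: lemmas \<open>lift2_sum\<close> and \<open>lift3_sum\<close> below are its
  universal property.\<close>

definition dual_sp :: "('k::field, 'q::ab_group_add, 'z) kd_mod_scheme \<Rightarrow> ('q \<Rightarrow> 'k) set" where
  "dual_sp Q = {f. (\<forall>x\<in>car Q. \<forall>y\<in>car Q. f (x + y) = f x + f y) \<and>
                   (\<forall>c. \<forall>x\<in>car Q. f (scl Q c x) = c * f x)}"

type_synonym ('k, 'q) tensor2 = "('q \<Rightarrow> 'k) \<Rightarrow> ('q \<Rightarrow> 'k) \<Rightarrow> 'k"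
type_synonym ('k, 'q) tensor3 = "('q \<Rightarrow> 'k) \<Rightarrow> ('q \<Rightarrow> 'k) \<Rightarrow> ('q \<Rightarrow> 'k) \<Rightarrow> 'k"

definition tens2 ::
  "('k::field, 'q::ab_group_add, 'z) kd_mod_scheme \<Rightarrow> 'q \<Rightarrow> 'q \<Rightarrow> ('k, 'q) tensor2" where
  "tens2 Q u v = (\<lambda>f g. if f \<in> dual_sp Q \<and> g \<in> dual_sp Q then f u * g v else 0)"

definition tens3 ::
  "('k::field, 'q::ab_group_add, 'z) kd_mod_scheme \<Rightarrow> 'q \<Rightarrow> 'q \<Rightarrow> 'q \<Rightarrow> ('k, 'q) tensor3" where
  "tens3 Q u v w = (\<lambda>f g h. if f \<in> dual_sp Q \<and> g \<in> dual_sp Q \<and> h \<in> dual_sp Q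
                            then f u * g v * h w else 0)"

definition sum2 :: "('q \<Rightarrow> 'q \<Rightarrow> 'm) \<Rightarrow> ('q \<times> 'q) list \<Rightarrow> 'm::comm_monoid_add" where
  "sum2 \<beta> xs = (\<Sum>(u, v)\<leftarrow>xs. \<beta> u v)"

definition sum3 :: "('q \<Rightarrow> 'q \<Rightarrow> 'q \<Rightarrow> 'm) \<Rightarrow> ('q \<times> 'q \<times> 'q) list \<Rightarrow> 'm::comm_monoid_add" where
  "sum3 \<beta> xs = (\<Sum>(u, v, w)\<leftarrow>xs. \<beta> u v w)"

definition Tens2 ::
  "('k::field, 'q::ab_group_add, 'z) kd_mod_scheme \<Rightarrow> ('k, 'q) tensor2 set" where
  "Tens2 Q = {sum2 (tens2 Q) xs |xs. set xs \<subseteq> car Q \<times> car Q}"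

definition Tens3 ::
  "('k::field, 'q::ab_group_add, 'z) kd_mod_scheme \<Rightarrow> ('k, 'q) tensor3 set" where
  "Tens3 Q = {sum3 (tens3 Q) xs |xs. set xs \<subseteq> car Q \<times> car Q \<times> car Q}"

text \<open>The additive map on \<open>Q \<otimes> Q\<close> induced by \<open>u \<otimes> v \<mapsto> \<beta> u v\<close> for bilinear \<open>\<beta>\<close>, evaluated on an
  arbitrary representation as a sum of pure tensors.\<close>

definition lift2 :: "('k::field, 'q::ab_group_add, 'z) kd_mod_scheme \<Rightarrow> ('q \<Rightarrow> 'q \<Rightarrow> 'm) \<Rightarrow>
    ('k, 'q) tensor2 \<Rightarrow> 'm::comm_monoid_add" where
  "lift2 Q \<beta> X = sum2 \<beta> (SOME xs. set xs \<subseteq> car Q \<times> car Q \<and> sum2 (tens2 Q) xs = X)"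

definition lift3 :: "('k::field, 'q::ab_group_add, 'z) kd_mod_scheme \<Rightarrow> ('q \<Rightarrow> 'q \<Rightarrow> 'q \<Rightarrow> 'm) \<Rightarrow>
    ('k, 'q) tensor3 \<Rightarrow> 'm::comm_monoid_add" where
  "lift3 Q \<beta> X = sum3 \<beta> (SOME xs. set xs \<subseteq> car Q \<times> car Q \<times> car Q \<and> sum3 (tens3 Q) xs = X)"

definition balanced2 ::
  "('k::field, 'q::ab_group_add, 'z) kd_mod_scheme \<Rightarrow> ('q \<Rightarrow> 'q \<Rightarrow> 'm::ab_group_add) \<Rightarrow> bool" where
  "balanced2 Q \<beta> \<longleftrightarrow>
     (\<forall>u\<in>car Q. \<forall>u'\<in>car Q. \<forall>v\<in>car Q. \<beta> (u + u') v = \<beta> u v + \<beta> u' v) \<and>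
     (\<forall>u\<in>car Q. \<forall>v\<in>car Q. \<forall>v'\<in>car Q. \<beta> u (v + v') = \<beta> u v + \<beta> u v') \<and>
     (\<forall>c. \<forall>u\<in>car Q. \<forall>v\<in>car Q. \<beta> (scl Q c u) v = \<beta> u (scl Q c v))"

definition balanced3 ::
  "('k::field, 'q::ab_group_add, 'z) kd_mod_scheme \<Rightarrow> ('q \<Rightarrow> 'q \<Rightarrow> 'q \<Rightarrow> 'm::ab_group_add) \<Rightarrow> bool" where
  "balanced3 Q \<beta> \<longleftrightarrow>
     (\<forall>u\<in>car Q. balanced2 Q (\<beta> u)) \<and> (\<forall>w\<in>car Q. balanced2 Q (\<lambda>u v. \<beta> u v w))"

lemma kd_module_scaleD:
  assumes "kd_module Q"
  shows "vector_space (scl Q)" "module.subspace (scl Q) (car Q)" "0 \<in> car Q"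
    "\<And>x y. x \<in> car Q \<Longrightarrow> y \<in> car Q \<Longrightarrow> x + y \<in> car Q"
    "\<And>c x. x \<in> car Q \<Longrightarrow> scl Q c x \<in> car Q"
proof -
  show *: "vector_space (scl Q)" "module.subspace (scl Q) (car Q)"
    using assms by (auto simp: kd_module_def)
  interpret vector_space "scl Q" by fact
  show "0 \<in> car Q" "\<And>x y. x \<in> car Q \<Longrightarrow> y \<in> car Q \<Longrightarrow> x + y \<in> car Q"
    "\<And>c x. x \<in> car Q \<Longrightarrow> scl Q c x \<in> car Q"
    using *(2) by (auto simp: subspace_def)
qed

lemma finite_coordinates:
  assumes Q: "kd_module Q" and U: "finite U" "U \<subseteq> car Q"
  obtains B c where "finite B" "B \<subseteq> car Q" "\<forall>b\<in>B. c b \<in> dual_sp Q"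
    "\<forall>u\<in>U. u = (\<Sum>b\<in>B. scl Q (c b u) b)"
proof -
  interpret vector_space "scl Q" by (rule kd_module_scaleD[OF Q])
  obtain B where B: "B \<subseteq> U" "independent B" "U \<subseteq> span B"
    using maximal_independent_subset by blast
  define E where "E = extend_basis B"
  have E: "independent E" "B \<subseteq> E" "span E = UNIV"
    using B by (auto simp: E_def independent_extend_basis extend_basis_superset span_extend_basis)
  define c where "c b u = representation E u b" for b u
  show thesis
  proof (rule that[of B c])
    show fin: "finite B" and "B \<subseteq> car Q"
      using B U finite_subset by auto
    show "\<forall>b\<in>B. c b \<in> dual_sp Q"
      using E by (auto simp: dual_sp_def c_def representation_add representation_scale)
    show "\<forall>u\<in>U. u = (\<Sum>b\<in>B. scl Q (c b u) b)"
    proof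
      fix u assume "u \<in> U"
      have "representation E u = representation B u"
        using representation_extend[of E u B] E B \<open>u \<in> U\<close> by auto
      then show "u = (\<Sum>b\<in>B. scl Q (c b u) b)"
        using sum_representation_eq[of B u B] B \<open>u \<in> U\<close> fin by (auto simp: c_def)
    qed
  qed
qed

lemma nonzero_functional:
  assumes Q: "kd_module Q" and w: "w \<noteq> 0"
  obtains g where "g \<in> dual_sp Q" "g w \<noteq> 0"
proof -
  interpret vector_space "scl Q" by (rule kd_module_scaleD[OF Q])
  have ind: "independent {w}" using w by simp
  define E where "E = extend_basis {w}"
  have E: "independent E" "{w} \<subseteq> E" "span E = UNIV"
    unfolding E_def by (rule independent_extend_basis[OF ind] extend_basis_superset[OF ind]
        span_extend_basis[OF ind])+
  show thesis
  proof (rule that[of "\<lambda>x. representation E x w"])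
    show "(\<lambda>x. representation E x w) \<in> dual_sp Q"
      using E by (auto simp: dual_sp_def representation_add representation_scale)
    show "representation E w w \<noteq> 0"
      using E by (simp add: representation_basis)
  qed
qed

lemma additive_sum_on:
  assumes "kd_module Q" "\<And>x y. x \<in> car Q \<Longrightarrow> y \<in> car Q \<Longrightarrow> f (x + y) = f x + f y"
    and "\<And>i. i \<in> I \<Longrightarrow> g i \<in> car Q"
  shows "f (\<Sum>i\<in>I. g i) = (\<Sum>i\<in>I. f (g i) :: 'm::ab_group_add)" (is ?A)
    and "(\<Sum>i\<in>I. g i) \<in> car Q" (is ?B)
proof -
  note K = kd_module_scaleD[OF assms(1)]
  have f0: "f 0 = 0" using assms(2)[OF K(3) K(3)] by simp
  have "?A \<and> ?B" using assms(3)
  proof (induction I rule: infinite_finite_induct)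
    case (insert i I)
    then show ?case using assms(2) K by auto
  qed (use f0 K in auto)
  then show ?A ?B by auto
qed

lemma sum2_conv: "sum2 \<beta> xs = (\<Sum>i<length xs. \<beta> (fst (xs ! i)) (snd (xs ! i)))"
  by (simp add: sum2_def case_prod_unfold sum_list_sum_nth lessThan_atLeast0)

lemma sum3_conv:
  "sum3 \<beta> xs = (\<Sum>i<length xs. \<beta> (fst (xs ! i)) (fst (snd (xs ! i))) (snd (snd (xs ! i))))"
  by (simp add: sum3_def case_prod_unfold sum_list_sum_nth lessThan_atLeast0)

lemma bilinear_zero:
  assumes Q: "kd_module Q" and \<beta>: "balanced2 Q \<beta>" and I: "finite I"
    and u: "\<And>i. i \<in> I \<Longrightarrow> u i \<in> car Q" and v: "\<And>i. i \<in> I \<Longrightarrow> v i \<in> car Q"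
    and 0: "\<And>f g. f \<in> dual_sp Q \<Longrightarrow> g \<in> dual_sp Q \<Longrightarrow> (\<Sum>i\<in>I. f (u i) * g (v i)) = 0"
  shows "(\<Sum>i\<in>I. \<beta> (u i) (v i)) = 0"
proof -
  note K = kd_module_scaleD[OF Q]
  have b1: "\<beta> (x + x') y = \<beta> x y + \<beta> x' y" if "x \<in> car Q" "x' \<in> car Q" "y \<in> car Q" for x x' y
    using \<beta> that unfolding balanced2_def by blast
  have b2: "\<beta> x (y + y') = \<beta> x y + \<beta> x y'" if "x \<in> car Q" "y \<in> car Q" "y' \<in> car Q" for x y y'
    using \<beta> that unfolding balanced2_def by blast
  have b3: "\<beta> (scl Q c x) y = \<beta> x (scl Q c y)" if "x \<in> car Q" "y \<in> car Q" for c x y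
    using \<beta> that unfolding balanced2_def by blast
  have U: "finite (u ` I)" "u ` I \<subseteq> car Q" using I u by auto
  obtain B c where B: "finite B" "B \<subseteq> car Q"
    and cd: "\<forall>b\<in>B. c b \<in> dual_sp Q"
    and rep: "\<forall>x\<in>u ` I. x = (\<Sum>b\<in>B. scl Q (c b x) b)"
    by (rule finite_coordinates[OF Q U])
  have c: "c b \<in> dual_sp Q" if "b \<in> B" for b using cd that by blast
  have rep': "(\<Sum>b\<in>B. scl Q (c b (u i)) b) = u i" if "i \<in> I" for i
    using rep that by (metis imageI)
  have Bm: "b \<in> car Q" if "b \<in> B" for b using B that by blast
  define w where "w b = (\<Sum>i\<in>I. scl Q (c b (u i)) (v i))" for b
  have w0: "w b = 0" if b: "b \<in> B" for b
  proof (rule ccontr)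
    assume "w b \<noteq> 0"
    then obtain g where g: "g \<in> dual_sp Q" "g (w b) \<noteq> 0"
      using nonzero_functional[OF Q] by blast
    have "g (w b) = (\<Sum>i\<in>I. g (scl Q (c b (u i)) (v i)))"
      unfolding w_def using g(1) v
      by (intro additive_sum_on(1)[OF Q]) (simp_all add: dual_sp_def K(5))
    also have "\<dots> = (\<Sum>i\<in>I. c b (u i) * g (v i))"
      using g(1) v by (intro sum.cong) (auto simp: dual_sp_def)
    also have "\<dots> = 0" using 0[OF c[OF b] g(1)] .
    finally show False using g by simp
  qed
  have "\<beta> (u i) (v i) = (\<Sum>b\<in>B. \<beta> b (scl Q (c b (u i)) (v i)))" if i: "i \<in> I" for i
  proof -
    have "\<beta> (u i) (v i) = \<beta> (\<Sum>b\<in>B. scl Q (c b (u i)) b) (v i)"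
      by (simp only: rep'[OF i])
    also have "\<dots> = (\<Sum>b\<in>B. \<beta> (scl Q (c b (u i)) b) (v i))"
      by (intro additive_sum_on(1)[OF Q, where f = "\<lambda>x. \<beta> x (v i)"])
        (simp_all add: b1 v[OF i] Bm K(5))
    also have "\<dots> = (\<Sum>b\<in>B. \<beta> b (scl Q (c b (u i)) (v i)))"
      by (intro sum.cong refl) (simp add: b3 v[OF i] Bm)
    finally show ?thesis .
  qed
  then have "(\<Sum>i\<in>I. \<beta> (u i) (v i)) = (\<Sum>i\<in>I. \<Sum>b\<in>B. \<beta> b (scl Q (c b (u i)) (v i)))"
    by (intro sum.cong) auto
  also have "\<dots> = (\<Sum>b\<in>B. \<Sum>i\<in>I. \<beta> b (scl Q (c b (u i)) (v i)))"
    by (rule sum.swap)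
  also have "\<dots> = (\<Sum>b\<in>B. \<beta> b (w b))"
  proof (rule sum.cong)
    fix b assume b: "b \<in> B"
    show "(\<Sum>i\<in>I. \<beta> b (scl Q (c b (u i)) (v i))) = \<beta> b (w b)"
      unfolding w_def
      by (intro additive_sum_on(1)[OF Q, where f = "\<beta> b", symmetric])
        (simp_all add: b2 Bm[OF b] v K(5))
  qed simp
  also have "\<dots> = 0"
  proof (rule sum.neutral, rule ballI)
    fix b assume b: "b \<in> B"
    have "\<beta> b 0 = 0" using b2[OF Bm[OF b] K(3) K(3)] by simp
    then show "\<beta> b (w b) = 0" using w0[OF b] by simp
  qed
  finally show ?thesis .
qed

lemma trilinear_zero:
  assumes Q: "kd_module Q" and \<beta>: "balanced3 Q \<beta>" and I: "finite I"
    and u: "\<And>i. i \<in> I \<Longrightarrow> u i \<in> car Q" and v: "\<And>i. i \<in> I \<Longrightarrow> v i \<in> car Q"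
    and w: "\<And>i. i \<in> I \<Longrightarrow> w i \<in> car Q"
    and 0: "\<And>f g h. f \<in> dual_sp Q \<Longrightarrow> g \<in> dual_sp Q \<Longrightarrow> h \<in> dual_sp Q \<Longrightarrow>
              (\<Sum>i\<in>I. f (u i) * g (v i) * h (w i)) = 0"
  shows "(\<Sum>i\<in>I. \<beta> (u i) (v i) (w i)) = 0"
proof -
  note K = kd_module_scaleD[OF Q]
  have b1: "\<beta> (x + x') y z = \<beta> x y z + \<beta> x' y z"
    if "x \<in> car Q" "x' \<in> car Q" "y \<in> car Q" "z \<in> car Q" for x x' y z
  proof -
    have "balanced2 Q (\<lambda>u v. \<beta> u v z)" using \<beta> that(4) unfolding balanced3_def by blast
    then show ?thesis using that(1-3) unfolding balanced2_def by blast
  qed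
  have b3: "\<beta> (scl Q c x) y z = \<beta> x (scl Q c y) z" if "x \<in> car Q" "y \<in> car Q" "z \<in> car Q" for c x y z
  proof -
    have "balanced2 Q (\<lambda>u v. \<beta> u v z)" using \<beta> that(3) unfolding balanced3_def by blast
    then show ?thesis using that(1,2) unfolding balanced2_def by blast
  qed
  have U: "finite (u ` I)" "u ` I \<subseteq> car Q" using I u by auto
  obtain B c where B: "finite B" "B \<subseteq> car Q"
    and cd: "\<forall>b\<in>B. c b \<in> dual_sp Q"
    and rep: "\<forall>x\<in>u ` I. x = (\<Sum>b\<in>B. scl Q (c b x) b)"
    by (rule finite_coordinates[OF Q U])
  have c: "c b \<in> dual_sp Q" if "b \<in> B" for b using cd that by blast
  have rep': "(\<Sum>b\<in>B. scl Q (c b (u i)) b) = u i" if "i \<in> I" for i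
    using rep that by (metis imageI)
  have Bm: "b \<in> car Q" if "b \<in> B" for b using B that by blast
  have "\<beta> (u i) (v i) (w i) = (\<Sum>b\<in>B. \<beta> b (scl Q (c b (u i)) (v i)) (w i))" if i: "i \<in> I" for i
  proof -
    have "\<beta> (u i) (v i) (w i) = \<beta> (\<Sum>b\<in>B. scl Q (c b (u i)) b) (v i) (w i)"
      by (simp only: rep'[OF i])
    also have "\<dots> = (\<Sum>b\<in>B. \<beta> (scl Q (c b (u i)) b) (v i) (w i))"
      by (intro additive_sum_on(1)[OF Q, where f = "\<lambda>x. \<beta> x (v i) (w i)"])
        (simp_all add: b1 v[OF i] w[OF i] Bm K(5))
    also have "\<dots> = (\<Sum>b\<in>B. \<beta> b (scl Q (c b (u i)) (v i)) (w i))"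
      by (intro sum.cong refl) (simp add: b3 v[OF i] w[OF i] Bm)
    finally show ?thesis .
  qed
  then have "(\<Sum>i\<in>I. \<beta> (u i) (v i) (w i)) =
      (\<Sum>i\<in>I. \<Sum>b\<in>B. \<beta> b (scl Q (c b (u i)) (v i)) (w i))"
    by (intro sum.cong) auto
  also have "\<dots> = (\<Sum>b\<in>B. \<Sum>i\<in>I. \<beta> b (scl Q (c b (u i)) (v i)) (w i))"
    by (rule sum.swap)
  also have "\<dots> = 0"
  proof (rule sum.neutral, rule ballI)
    fix b assume b: "b \<in> B"
    show "(\<Sum>i\<in>I. \<beta> b (scl Q (c b (u i)) (v i)) (w i)) = 0"
    proof (rule bilinear_zero[OF Q _ I])
      show "balanced2 Q (\<beta> b)" using \<beta> Bm[OF b] unfolding balanced3_def by blast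
      show "scl Q (c b (u i)) (v i) \<in> car Q" "w i \<in> car Q" if "i \<in> I" for i
        using that by (simp_all add: v w K(5))
      fix f g assume fg: "f \<in> dual_sp Q" "g \<in> dual_sp Q"
      have "(\<Sum>i\<in>I. f (scl Q (c b (u i)) (v i)) * g (w i)) = (\<Sum>i\<in>I. c b (u i) * f (v i) * g (w i))"
        using fg v by (intro sum.cong refl) (simp add: dual_sp_def)
      also have "\<dots> = 0" using 0[OF c[OF b] fg] .
      finally show "(\<Sum>i\<in>I. f (scl Q (c b (u i)) (v i)) * g (w i)) = 0" .
    qed
  qed
  finally show ?thesis .
qed

lemma sum_fun2: "(\<Sum>i\<in>I. F i) f g = (\<Sum>i\<in>I. F i f g :: 'm::comm_monoid_add)"
  by (induction I rule: infinite_finite_induct) (auto simp: zero_fun_def)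

lemma sum_fun3: "(\<Sum>i\<in>I. F i) f g h = (\<Sum>i\<in>I. F i f g h :: 'm::comm_monoid_add)"
  by (induction I rule: infinite_finite_induct) (auto simp: zero_fun_def)

lemma sum2_eq:
  assumes Q: "kd_module Q" and \<beta>: "balanced2 Q \<beta>"
    and xs: "set xs \<subseteq> car Q \<times> car Q" and ys: "set ys \<subseteq> car Q \<times> car Q"
    and eq: "sum2 (tens2 Q) xs = sum2 (tens2 Q) ys"
  shows "sum2 \<beta> xs = sum2 \<beta> ys"
proof -
  note K = kd_module_scaleD[OF Q]
  have neg1: "x + scl Q (-1) x = 0" for x
  proof -
    interpret vector_space "scl Q" by (rule K)
    show ?thesis by simp
  qed
  have mem: "fst (zs ! i) \<in> car Q" "snd (zs ! i) \<in> car Q"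
    if "set zs \<subseteq> car Q \<times> car Q" "i < length zs" for zs i
    using nth_mem[OF that(2)] that(1) by auto
  let ?I = "Inl ` {..<length xs} \<union> Inr ` {..<length ys}"
  define u where "u = case_sum (\<lambda>i. fst (xs ! i)) (\<lambda>i. scl Q (-1) (fst (ys ! i)))"
  define v where "v = case_sum (\<lambda>i. snd (xs ! i)) (\<lambda>i. snd (ys ! i))"
  have split: "(\<Sum>i\<in>?I. F i) = (\<Sum>i<length xs. F (Inl i)) + (\<Sum>i<length ys. F (Inr i))"
    for F :: "nat + nat \<Rightarrow> 'x::comm_monoid_add"
    by (subst sum.union_disjoint) (auto simp: sum.reindex)
  have neg: "\<beta> (scl Q (-1) x) y = - \<beta> x y" if "x \<in> car Q" "y \<in> car Q" for x y
  proof -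
    have b1: "\<beta> (x + x') y = \<beta> x y + \<beta> x' y" if "x \<in> car Q" "x' \<in> car Q" for x x'
      using \<beta> that \<open>y \<in> car Q\<close> unfolding balanced2_def by blast
    have "\<beta> 0 y = 0" using b1[OF K(3) K(3)] by simp
    then show ?thesis
      using b1[OF that(1) K(5)[OF that(1), of "-1"]] neg1 by (simp add: add_eq_0_iff)
  qed
  have "(\<Sum>i\<in>?I. \<beta> (u i) (v i)) = 0"
  proof (rule bilinear_zero[OF Q \<beta>])
    show "u i \<in> car Q" "v i \<in> car Q" if "i \<in> ?I" for i
      using that mem[OF xs] mem[OF ys] K by (auto simp: u_def v_def)
    fix f g assume fg: "f \<in> dual_sp Q" "g \<in> dual_sp Q"
    have "f (scl Q (-1) x) = - f x" if "x \<in> car Q" for x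
    proof -
      have "f (scl Q (-1) x) = -1 * f x" using fg that unfolding dual_sp_def by blast
      then show ?thesis by simp
    qed
    then have "(\<Sum>i\<in>?I. f (u i) * g (v i)) = sum2 (tens2 Q) xs f g - sum2 (tens2 Q) ys f g"
      using fg mem[OF ys]
      by (simp only: split) (simp add: u_def v_def sum2_conv sum_fun2 tens2_def sum_negf)
    then show "(\<Sum>i\<in>?I. f (u i) * g (v i)) = 0" using eq by simp
  qed simp
  then show ?thesis
    using neg mem[OF ys] by (simp only: split) (simp add: u_def v_def sum2_conv sum_negf)
qed

lemma sum3_eq:
  assumes Q: "kd_module Q" and \<beta>: "balanced3 Q \<beta>"
    and xs: "set xs \<subseteq> car Q \<times> car Q \<times> car Q" and ys: "set ys \<subseteq> car Q \<times> car Q \<times> car Q"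
    and eq: "sum3 (tens3 Q) xs = sum3 (tens3 Q) ys"
  shows "sum3 \<beta> xs = sum3 \<beta> ys"
proof -
  note K = kd_module_scaleD[OF Q]
  have neg1: "x + scl Q (-1) x = 0" for x
  proof -
    interpret vector_space "scl Q" by (rule K)
    show ?thesis by simp
  qed
  have mem: "fst (zs ! i) \<in> car Q" "fst (snd (zs ! i)) \<in> car Q" "snd (snd (zs ! i)) \<in> car Q"
    if "set zs \<subseteq> car Q \<times> car Q \<times> car Q" "i < length zs" for zs i
    using nth_mem[OF that(2)] that(1) by auto
  let ?I = "Inl ` {..<length xs} \<union> Inr ` {..<length ys}"
  define u where "u = case_sum (\<lambda>i. fst (xs ! i)) (\<lambda>i. scl Q (-1) (fst (ys ! i)))"
  define v where "v = case_sum (\<lambda>i. fst (snd (xs ! i))) (\<lambda>i. fst (snd (ys ! i)))"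
  define w where "w = case_sum (\<lambda>i. snd (snd (xs ! i))) (\<lambda>i. snd (snd (ys ! i)))"
  have split: "(\<Sum>i\<in>?I. F i) = (\<Sum>i<length xs. F (Inl i)) + (\<Sum>i<length ys. F (Inr i))"
    for F :: "nat + nat \<Rightarrow> 'x::comm_monoid_add"
    by (subst sum.union_disjoint) (auto simp: sum.reindex)
  have neg: "\<beta> (scl Q (-1) x) y z = - \<beta> x y z" if "x \<in> car Q" "y \<in> car Q" "z \<in> car Q" for x y z
  proof -
    have b1: "\<beta> (x + x') y z = \<beta> x y z + \<beta> x' y z" if "x \<in> car Q" "x' \<in> car Q" for x x'
    proof -
      have "balanced2 Q (\<lambda>u v. \<beta> u v z)" using \<beta> \<open>z \<in> car Q\<close> unfolding balanced3_def by blast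
      then show ?thesis using that \<open>y \<in> car Q\<close> unfolding balanced2_def by blast
    qed
    have "\<beta> 0 y z = 0" using b1[OF K(3) K(3)] by simp
    then show ?thesis
      using b1[OF that(1) K(5)[OF that(1), of "-1"]] neg1 by (simp add: add_eq_0_iff)
  qed
  have "(\<Sum>i\<in>?I. \<beta> (u i) (v i) (w i)) = 0"
  proof (rule trilinear_zero[OF Q \<beta>])
    show "u i \<in> car Q" "v i \<in> car Q" "w i \<in> car Q" if "i \<in> ?I" for i
      using that mem[OF xs] mem[OF ys] K by (auto simp: u_def v_def w_def)
    fix f g h assume fg: "f \<in> dual_sp Q" "g \<in> dual_sp Q" "h \<in> dual_sp Q"
    have "f (scl Q (-1) x) = - f x" if "x \<in> car Q" for x
    proof -
      have "f (scl Q (-1) x) = -1 * f x" using fg that unfolding dual_sp_def by blast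
      then show ?thesis by simp
    qed
    then have "(\<Sum>i\<in>?I. f (u i) * g (v i) * h (w i)) =
        sum3 (tens3 Q) xs f g h - sum3 (tens3 Q) ys f g h"
      using fg mem[OF ys]
      by (simp only: split) (simp add: u_def v_def w_def sum3_conv sum_fun3 tens3_def sum_negf)
    then show "(\<Sum>i\<in>?I. f (u i) * g (v i) * h (w i)) = 0" using eq by simp
  qed simp
  then show ?thesis
    using neg mem[OF ys] by (simp only: split) (simp add: u_def v_def w_def sum3_conv sum_negf)
qed

lemma lift2_sum:
  assumes "kd_module Q" "balanced2 Q \<beta>" "set xs \<subseteq> car Q \<times> car Q"
  shows "lift2 Q \<beta> (sum2 (tens2 Q) xs) = sum2 \<beta> xs"
proof -
  let ?P = "\<lambda>ys. set ys \<subseteq> car Q \<times> car Q \<and> sum2 (tens2 Q) ys = sum2 (tens2 Q) xs"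
  have "?P (Eps ?P)" by (rule someI[of ?P xs]) (use assms in auto)
  then show ?thesis unfolding lift2_def using assms sum2_eq[of Q \<beta> "Eps ?P" xs] by auto
qed

lemma lift3_sum:
  assumes "kd_module Q" "balanced3 Q \<beta>" "set xs \<subseteq> car Q \<times> car Q \<times> car Q"
  shows "lift3 Q \<beta> (sum3 (tens3 Q) xs) = sum3 \<beta> xs"
proof -
  let ?P = "\<lambda>ys. set ys \<subseteq> car Q \<times> car Q \<times> car Q \<and> sum3 (tens3 Q) ys = sum3 (tens3 Q) xs"
  have "?P (Eps ?P)" by (rule someI[of ?P xs]) (use assms in auto)
  then show ?thesis unfolding lift3_def using assms sum3_eq[of Q \<beta> "Eps ?P" xs] by auto
qed

lemma balanced2_tens2: "balanced2 Q (tens2 Q)"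
  unfolding balanced2_def tens2_def
  by (intro conjI ballI allI ext) (simp_all add: dual_sp_def algebra_simps)

lemma balanced3_tens3: "balanced3 Q (tens3 Q)"
  unfolding balanced3_def balanced2_def tens3_def
  by (intro conjI ballI allI ext) (simp_all add: dual_sp_def algebra_simps)

text \<open>\<open>\<tau>\<close>, \<open>\<tau> \<otimes> I\<close>, \<open>\<partial>\<^bsup>\<otimes>2\<^esup>\<close>, the three factors of \<open>\<partial>\<close> on \<open>Q \<otimes> Q \<otimes> Q\<close>, and \<open>\<partial>\<^bsup>\<otimes>3\<^esup>\<close>.\<close>

definition flip2 where
  "flip2 Q X = lift2 Q (\<lambda>u v. tens2 Q v u) X"

definition flip12 where
  "flip12 Q X = lift3 Q (\<lambda>u v w. tens3 Q v u w) X"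

definition der2 where
  "der2 Q X = lift2 Q (\<lambda>u v. tens2 Q (der Q u) v + tens2 Q u (der Q v)) X"

definition der3_1 where
  "der3_1 Q X = lift3 Q (\<lambda>u v w. tens3 Q (der Q u) v w) X"

definition der3_2 where
  "der3_2 Q X = lift3 Q (\<lambda>u v w. tens3 Q u (der Q v) w) X"

definition der3_3 where
  "der3_3 Q X = lift3 Q (\<lambda>u v w. tens3 Q u v (der Q w)) X"

definition der3 where
  "der3 Q X = der3_1 Q X + der3_2 Q X + der3_3 Q X"

text \<open>For \<open>T\<^sub>\<nu> u = \<Sum>\<^sub>k \<nu>\<^sup>k w\<^sub>k\<close> these are \<open>T\<^sub>S \<otimes> I\<close> and \<open>I \<otimes> T\<^sub>S\<close> with an operator \<open>S\<close> in place of
  \<open>\<nu>\<close>; for instance \<open>u \<otimes> v \<mapsto> \<Sum>\<^sub>k S\<^sup>k (w\<^sub>k \<otimes> v)\<close>.  The operator \<open>S\<close> acts on \<open>Q \<otimes> Q\<close> (with \<open>\<iota>\<close> the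
  identity) or on \<open>(Q \<otimes> Q)[\<lambda>]\<close> (with \<open>\<iota>\<close> the inclusion of constants).\<close>

definition on_fst :: "('k::field, 'q::ab_group_add, 'z) kd_mod_scheme \<Rightarrow>
    (('k, 'q) tensor2 \<Rightarrow> 'm) \<Rightarrow> ('m \<Rightarrow> 'm) \<Rightarrow> ('q \<Rightarrow> 'q poly) \<Rightarrow> ('k, 'q) tensor2 \<Rightarrow>
    'm::comm_monoid_add" where
  "on_fst Q \<iota> S T X = lift2 Q (\<lambda>u v. lsubst S (\<lambda>w. \<iota> (tens2 Q w v)) (T u)) X"

definition on_snd :: "('k::field, 'q::ab_group_add, 'z) kd_mod_scheme \<Rightarrow>
    (('k, 'q) tensor2 \<Rightarrow> 'm) \<Rightarrow> ('m \<Rightarrow> 'm) \<Rightarrow> ('q \<Rightarrow> 'q poly) \<Rightarrow> ('k, 'q) tensor2 \<Rightarrow>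
    'm::comm_monoid_add" where
  "on_snd Q \<iota> S T X = lift2 Q (\<lambda>u v. lsubst S (\<lambda>w. \<iota> (tens2 Q u w)) (T v)) X"

text \<open>The parameter \<open>\<lambda>\<close> itself, and \<open>-\<lambda>-\<partial>\<^bsup>\<otimes>2\<^esup>\<close>, with values in \<open>(Q \<otimes> Q)[\<lambda>]\<close>.\<close>

definition fst_lam where
  "fst_lam Q T X = on_fst Q (\<lambda>Y. [:Y:]) (pCons 0) T X"

definition snd_lam where
  "snd_lam Q T X = on_snd Q (\<lambda>Y. [:Y:]) (pCons 0) T X"

definition fst_opp where
  "fst_opp Q T X = on_fst Q (\<lambda>Y. [:Y:]) (neg_lam_der (der2 Q)) T X"

definition snd_opp where
  "snd_opp Q T X = on_snd Q (\<lambda>Y. [:Y:]) (neg_lam_der (der2 Q)) T X"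


section \<open>The Poisson conformal Yang--Baxter equation\<close>

definition cybe_brk ::
  "('k::field, 'q::ab_group_add, 'z) pc_alg_scheme \<Rightarrow> ('k, 'q) tensor2 \<Rightarrow> ('k, 'q) tensor3" where
  "cybe_brk Q r = lift2 Q (\<lambda>ri li. lift2 Q (\<lambda>rj lj.
       lsubst (der3_2 Q) (\<lambda>x. tens3 Q x li lj) (brk Q ri rj)
     - lsubst (der3_3 Q) (\<lambda>x. tens3 Q ri x lj) (brk Q rj li)
     - lsubst (der3_2 Q) (\<lambda>x. tens3 Q ri rj x) (brk Q lj li)) r) r"

definition aybe_mul ::
  "('k::field, 'q::ab_group_add, 'z) pc_alg_scheme \<Rightarrow> ('k, 'q) tensor2 \<Rightarrow> ('k, 'q) tensor3" where
  "aybe_mul Q r = lift2 Q (\<lambda>ri li. lift2 Q (\<lambda>rj lj.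
       lsubst (der3_1 Q) (\<lambda>x. tens3 Q ri rj x) (mul Q li lj)
     - lsubst (\<lambda>X. - (der3_1 Q X + der3_2 Q X)) (\<lambda>x. tens3 Q ri x lj) (mul Q rj li)
     + lsubst (der3_2 Q) (\<lambda>x. tens3 Q x li lj) (mul Q ri rj)) r) r"

definition PCYBE_solution ::
  "('k::field, 'q::ab_group_add, 'z) pc_alg_scheme \<Rightarrow> ('k, 'q) tensor2 \<Rightarrow> bool" where
  "PCYBE_solution Q r \<longleftrightarrow> r \<in> Tens2 Q \<and>
     cybe_brk Q r \<in> der3 Q ` Tens3 Q \<and> aybe_mul Q r \<in> der3 Q ` Tens3 Q"

definition skew_symmetric_tensor ::
  "('k::field, 'q::ab_group_add, 'z) kd_mod_scheme \<Rightarrow> ('k, 'q) tensor2 \<Rightarrow> bool" where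
  "skew_symmetric_tensor Q r \<longleftrightarrow> r \<in> Tens2 Q \<and> flip2 Q r = - r"


section \<open>Poisson conformal coalgebras and bialgebras\<close>

definition kd_hom2 ::
  "('k::field, 'q::ab_group_add, 'z) kd_mod_scheme \<Rightarrow> ('q \<Rightarrow> ('k, 'q) tensor2) \<Rightarrow> bool" where
  "kd_hom2 Q \<delta> \<longleftrightarrow>
     (\<forall>a\<in>car Q. \<delta> a \<in> Tens2 Q) \<and>
     (\<forall>a\<in>car Q. \<forall>b\<in>car Q. \<delta> (a + b) = \<delta> a + \<delta> b) \<and>
     (\<forall>c. \<forall>a\<in>car Q. \<delta> (scl Q c a) = (\<lambda>f g. c * \<delta> a f g)) \<and>
     (\<forall>a\<in>car Q. \<delta> (der Q a) = der2 Q (\<delta> a))"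

text \<open>\<open>(\<delta> \<otimes> I) X\<close> and \<open>(I \<otimes> \<delta>) X\<close>.\<close>

definition co_fst where
  "co_fst Q \<delta> X = lift2 Q (\<lambda>u v. lift2 Q (\<lambda>x y. tens3 Q x y v) (\<delta> u)) X"

definition co_snd where
  "co_snd Q \<delta> X = lift2 Q (\<lambda>u v. lift2 Q (\<lambda>x y. tens3 Q u x y) (\<delta> v)) X"

definition poisson_conformal_coalgebra ::
  "('k::field, 'q::ab_group_add, 'z) kd_mod_scheme \<Rightarrow> ('q \<Rightarrow> ('k, 'q) tensor2) \<Rightarrow>
   ('q \<Rightarrow> ('k, 'q) tensor2) \<Rightarrow> bool" where
  "poisson_conformal_coalgebra Q \<delta> \<Delta> \<longleftrightarrow>
     kd_module Q \<and> kd_hom2 Q \<delta> \<and> kd_hom2 Q \<Delta> \<and>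
     (\<forall>a\<in>car Q.
        co_snd Q \<Delta> (\<Delta> a) = co_fst Q \<Delta> (\<Delta> a) \<and>
        \<Delta> a = flip2 Q (\<Delta> a) \<and>
        \<delta> a = - flip2 Q (\<delta> a) \<and>
        co_snd Q \<delta> (\<delta> a) - flip12 Q (co_snd Q \<delta> (\<delta> a)) = co_fst Q \<delta> (\<delta> a) \<and>
        co_snd Q \<Delta> (\<delta> a) = co_fst Q \<delta> (\<Delta> a) + flip12 Q (co_snd Q \<delta> (\<Delta> a)))"

definition poisson_conformal_bialgebra ::
  "('k::field, 'q::ab_group_add, 'z) pc_alg_scheme \<Rightarrow> ('q \<Rightarrow> ('k, 'q) tensor2) \<Rightarrow>
   ('q \<Rightarrow> ('k, 'q) tensor2) \<Rightarrow> bool" where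
  "poisson_conformal_bialgebra Q \<delta> \<Delta> \<longleftrightarrow>
     poisson_conformal_algebra Q \<and> poisson_conformal_coalgebra Q \<delta> \<Delta> \<and>
     (\<forall>a\<in>car Q. \<forall>b\<in>car Q.
        map_poly \<delta> (brk Q a b) =
          fst_lam Q (brk Q a) (\<delta> b) + snd_lam Q (brk Q a) (\<delta> b)
          - (fst_opp Q (brk Q b) (\<delta> a) + snd_opp Q (brk Q b) (\<delta> a)) \<and>
        map_poly \<Delta> (mul Q a b) =
          snd_lam Q (mul Q a) (\<Delta> b) + fst_opp Q (mul Q b) (\<Delta> a) \<and>
        map_poly \<delta> (mul Q a b) =
          fst_lam Q (mul Q a) (\<delta> b) + fst_opp Q (mul Q b) (\<delta> a)
          + snd_lam Q (brk Q a) (\<Delta> b) + snd_opp Q (brk Q b) (\<Delta> a) \<and>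
        map_poly \<Delta> (brk Q a b) =
          fst_lam Q (brk Q a) (\<Delta> b) + snd_lam Q (brk Q a) (\<Delta> b)
          - snd_opp Q (mul Q b) (\<delta> a) + fst_opp Q (mul Q b) (\<delta> a))"

text \<open>The maps \<open>\<delta>\<close> and \<open>\<Delta>\<close> determined by \<open>r\<close>, with \<open>-\<partial>\<^bsup>\<otimes>2\<^esup>\<close> substituted for \<open>\<lambda>\<close>.\<close>

definition delta_of ::
  "('k::field, 'q::ab_group_add, 'z) pc_alg_scheme \<Rightarrow> ('k, 'q) tensor2 \<Rightarrow> 'q \<Rightarrow> ('k, 'q) tensor2" where
  "delta_of Q r a =
     on_fst Q (\<lambda>Y. Y) (\<lambda>Y. - der2 Q Y) (brk Q a) r + on_snd Q (\<lambda>Y. Y) (\<lambda>Y. - der2 Q Y) (brk Q a) r"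

definition Delta_of ::
  "('k::field, 'q::ab_group_add, 'z) pc_alg_scheme \<Rightarrow> ('k, 'q) tensor2 \<Rightarrow> 'q \<Rightarrow> ('k, 'q) tensor2" where
  "Delta_of Q r a =
     on_snd Q (\<lambda>Y. Y) (\<lambda>Y. - der2 Q Y) (mul Q a) r - on_fst Q (\<lambda>Y. Y) (\<lambda>Y. - der2 Q Y) (mul Q a) r"


section \<open>The conformal algebra P and the semi-direct product\<close>

text \<open>\<open>P = k[\<partial>] \<otimes> A\<close> is the type \<open>'a poly\<close> of polynomials in \<open>\<partial>\<close> with coefficients in \<open>A\<close>, so \<open>\<partial>\<close> acts
  as \<open>pCons 0\<close>.  In \<open>P[\<lambda>]\<close>, i.e. \<open>'a poly poly\<close>, the outer variable is \<open>\<lambda>\<close> and the inner one \<open>\<partial>\<close>.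
  The extension by sesquilinearity is
  \<open>(\<partial>\<^sup>i a) *\<^bsub>\<lambda>\<^esub> (\<partial>\<^sup>j b) = (-\<lambda>)\<^sup>i (\<partial>+\<lambda>)\<^sup>j (a *\<^bsub>\<lambda>\<^esub> b)\<close>.\<close>

definition sesq_ext :: "('a \<Rightarrow> 'a \<Rightarrow> 'a poly poly) \<Rightarrow> 'a poly \<Rightarrow> 'a poly \<Rightarrow>
    'a::ab_group_add poly poly" where
  "sesq_ext m p q = (\<Sum>i\<le>degree p. \<Sum>j\<le>degree q.
     ((\<lambda>x. - pCons 0 x) ^^ i) (((\<lambda>x. map_poly (pCons 0) x + pCons 0 x) ^^ j)
       (m (coeff p i) (coeff q j))))"

text \<open>\<open>a \<circ>\<^sub>\<lambda> b = \<partial>(b \<lhd> a) + \<lambda>(a \<rhd> b + b \<lhd> a) + a \<diamond> b\<close> and \<open>a \<succ>\<^sub>\<lambda> b = a \<succ> b\<close> on \<open>A\<close>.\<close>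

definition circ_lam :: "('a \<Rightarrow> 'a \<Rightarrow> 'a) \<Rightarrow> ('a \<Rightarrow> 'a \<Rightarrow> 'a) \<Rightarrow> ('a \<Rightarrow> 'a \<Rightarrow> 'a) \<Rightarrow>
    'a poly \<Rightarrow> 'a poly \<Rightarrow> 'a::ab_group_add poly poly" where
  "circ_lam l r d = sesq_ext (\<lambda>a b. [: [:d a b, l b a:], [:r a b + l b a:] :])"

definition succ_lam :: "('a \<Rightarrow> 'a \<Rightarrow> 'a) \<Rightarrow> 'a poly \<Rightarrow> 'a poly \<Rightarrow> 'a::ab_group_add poly poly" where
  "succ_lam z = sesq_ext (\<lambda>a b. [: [:z a b:] :])"

definition brk_P :: "('a \<Rightarrow> 'a \<Rightarrow> 'a) \<Rightarrow> ('a \<Rightarrow> 'a \<Rightarrow> 'a) \<Rightarrow> ('a \<Rightarrow> 'a \<Rightarrow> 'a) \<Rightarrow>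
    'a poly \<Rightarrow> 'a poly \<Rightarrow> 'a::ab_group_add poly poly" where
  "brk_P l r d a b = circ_lam l r d a b - skew_subst (pCons 0) (circ_lam l r d b a)"

definition mul_P :: "('a \<Rightarrow> 'a \<Rightarrow> 'a) \<Rightarrow> 'a poly \<Rightarrow> 'a poly \<Rightarrow> 'a::ab_group_add poly poly" where
  "mul_P z a b = succ_lam z a b + skew_subst (pCons 0) (succ_lam z b a)"

text \<open>The conformal dual of \<open>P\<close>; the values of its elements are polynomials in the parameter.\<close>

definition conf_dual ::
  "('k::field \<Rightarrow> 'a::ab_group_add \<Rightarrow> 'a) \<Rightarrow> ('a poly \<Rightarrow> 'k poly) set" where
  "conf_dual s = {f. (\<forall>u v. f (u + v) = f u + f v) \<and>
                     (\<forall>c u. f (map_poly (s c) u) = smult c (f u)) \<and>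
                     (\<forall>u. f (pCons 0 u) = pCons 0 (f u))}"

definition der_dual :: "('a poly \<Rightarrow> 'k poly) \<Rightarrow> 'a::ab_group_add poly \<Rightarrow> 'k::field poly" where
  "der_dual f = (\<lambda>u. - pCons 0 (f u))"

text \<open>The embedding of the linear dual of \<open>A\<close> into the conformal dual of \<open>P\<close>:
  \<open>\<phi>\<^sub>\<lambda>(\<Sum>\<^sub>k \<partial>\<^sup>k a\<^sub>k) = \<Sum>\<^sub>k \<lambda>\<^sup>k \<phi>(a\<^sub>k)\<close>.\<close>

definition dual_embed :: "('a \<Rightarrow> 'k) \<Rightarrow> 'a::ab_group_add poly \<Rightarrow> 'k::field poly" where
  "dual_embed \<phi> = map_poly \<phi>"

text \<open>\<open>f\<^bsub>\<mu>-\<lambda>\<^esub>(p)\<close> for \<open>p\<close> in \<open>P[\<lambda>]\<close>, as a polynomial in \<open>\<lambda>\<close> (outer) and \<open>\<mu>\<close> (inner).\<close>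

definition dual_shift ::
  "('a poly \<Rightarrow> 'k poly) \<Rightarrow> 'a::ab_group_add poly poly \<Rightarrow> 'k::field poly poly" where
  "dual_shift f p =
     lsubst lam_op (\<lambda>w. lsubst (\<lambda>x. mu_op x - lam_op x) (\<lambda>c. [:[:c:]:]) (f w)) p"

text \<open>\<open>(L\<^sup>*(a)\<^sub>\<lambda> f)\<^sub>\<mu> u = -f\<^bsub>\<mu>-\<lambda>\<^esub>(a *\<^sub>\<lambda> u)\<close>, as a polynomial in \<open>\<lambda>\<close> with coefficients in the
  conformal dual.  For \<open>f\<close> in the conformal dual, the degree in \<open>\<lambda>\<close> is bounded independently of
  \<open>u\<close> since \<open>A\<close> is finite-dimensional and \<open>L\<^sup>*(a)\<^sub>\<lambda> f\<close> is compatible with \<open>\<partial>\<close>, so \<open>Abs_poly\<close> is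
  applied to a finitely supported sequence.\<close>

definition dual_act :: "('a poly \<Rightarrow> 'a poly \<Rightarrow> 'a poly poly) \<Rightarrow> 'a poly \<Rightarrow>
    ('a poly \<Rightarrow> 'k poly) \<Rightarrow> ('a::ab_group_add poly \<Rightarrow> 'k::field poly) poly" where
  "dual_act m a f = Abs_poly (\<lambda>j u. - coeff (dual_shift f (m a u)) j)"

definition pair_poly :: "'p::ab_group_add poly \<Rightarrow> 'f::ab_group_add poly \<Rightarrow> ('p \<times> 'f) poly" where
  "pair_poly p h = map_poly (\<lambda>x. (x, 0)) p + map_poly (\<lambda>y. (0, y)) h"

definition semidirect :: "('k::field \<Rightarrow> 'a::ab_group_add \<Rightarrow> 'a) \<Rightarrow> ('a \<Rightarrow> 'a \<Rightarrow> 'a) \<Rightarrow>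
    ('a \<Rightarrow> 'a \<Rightarrow> 'a) \<Rightarrow> ('a \<Rightarrow> 'a \<Rightarrow> 'a) \<Rightarrow> ('a \<Rightarrow> 'a \<Rightarrow> 'a) \<Rightarrow>
    ('k, 'a poly \<times> ('a poly \<Rightarrow> 'k poly)) pc_alg" where
  "semidirect s l r z d = \<lparr>
     car = UNIV \<times> conf_dual s,
     scl = (\<lambda>c (p, f). (map_poly (s c) p, \<lambda>u. smult c (f u))),
     der = (\<lambda>(p, f). (pCons 0 p, der_dual f)),
     brk = (\<lambda>(a, f) (b, g). pair_poly (brk_P l r d a b)
              (dual_act (circ_lam l r d) a g
               - skew_subst der_dual (dual_act (circ_lam l r d) b f))),
     mul = (\<lambda>(a, f) (b, g). pair_poly (mul_P z a b)
              (- dual_act (succ_lam z) a g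
               - skew_subst der_dual (dual_act (succ_lam z) b f))) \<rparr>"

definition canonical_r :: "('k::field, 'a poly \<times> ('a poly \<Rightarrow> 'k poly)) pc_alg \<Rightarrow> nat \<Rightarrow>
    (nat \<Rightarrow> 'a::ab_group_add) \<Rightarrow> (nat \<Rightarrow> 'a \<Rightarrow> 'k) \<Rightarrow>
    ('k, 'a poly \<times> ('a poly \<Rightarrow> 'k poly)) tensor2" where
  "canonical_r Q n e es = (\<Sum>i=1..n.
     tens2 Q ([:e i:], 0) (0, dual_embed (es i)) - tens2 Q (0, dual_embed (es i)) ([:e i:], 0))"

end

theory Submission
  imports Defs
begin

text \<open>The proof is a Fourier transform.  Setting \<open>\<partial>\<close> equal to a scalar \<open>x\<close> sends an element \<open>q\<close>
  of \<open>P \<oplus> P\<^sup>*\<close> to its value \<open>ev x q\<close> at momentum \<open>x\<close>, in the fibre \<open>V = A \<oplus> A\<^sup>*\<close>.  By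
  sesquilinearity the value of \<open>a *\<^sub>\<lambda> b\<close> at \<open>\<partial> = x\<close> depends only on \<open>a\<close> at momentum \<open>p = -\<lambda>\<close> and on
  \<open>b\<close> at momentum \<open>q = x + \<lambda>\<close>: a \<open>\<lambda>\<close>-product is the same thing as a family of bilinear maps
  \<open>F p q\<close> on \<open>V\<close> from momenta \<open>p\<close>, \<open>q\<close> to momentum \<open>p + q\<close>.  The axioms of a Poisson conformal algebra
  become those of an ordinary Poisson algebra graded by the additive group of the field, with bracket
  \<open>B\<close> and product \<open>M\<close>.  The functionals \<open>E x w = \<omega> w (ev x \<cdot>)\<close>, where \<open>\<omega>\<close> is the canonical symplectic
  form of \<open>A \<oplus> A\<^sup>*\<close>, are eigenvectors of the transpose of \<open>\<partial>\<close>, so that substituting an operator for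
  the parameter turns into substituting a scalar (\<open>lsubst_eigen\<close>).  As the field is infinite they
  separate the points of the module and of its tensor powers (\<open>Tens2_separate\<close>, \<open>Tens3_separate\<close>);
  hence each identity in the theorem is a scalar identity about \<open>B\<close>, \<open>M\<close> and \<open>\<omega>\<close>.

  On the tensor side, \<open>\<rho>(E x w, E y v) = \<omega> w v\<close> for the canonical \<open>\<rho>\<close>: it is the inverse of the
  symplectic form.  Because the action on \<open>A\<^sup>*\<close> is dual to the pre-Poisson products, \<open>\<omega>\<close> is a
  2-cocycle: \<open>\<omega> a (B b c)\<close> and \<open>\<omega> a (M b c)\<close> have vanishing cyclic sums when the momenta add up to
  zero (\<open>B_cocycle\<close>, \<open>M_cocycle\<close>).  These cyclic sums are exactly the values of the two tensors in the
  Yang--Baxter equation on the plane \<open>x + y + z = 0\<close> (\<open>cybe_E\<close>, \<open>aybe_E\<close>).  The bracket is affine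
  in the momenta and the product does not depend on them, so off this plane the values are a
  multiple of \<open>x + y + z\<close>, which is to say that the tensors lie in the image of \<open>\<partial>\<^bsup>\<otimes>3\<^esup>\<close>.

  The cocycle identities also show that \<open>\<delta>\<close> and \<open>\<Delta>\<close> are dual to \<open>B\<close> and \<open>M\<close> under the identification
  of \<open>V\<close> with its dual by \<open>\<omega>\<close> (\<open>\<delta>_dual\<close>, \<open>\<Delta>_dual\<close>), so the coalgebra axioms are the transposed
  algebra axioms.  The four compatibility conditions are those of any coboundary: the terms in
  which two actions hit different legs cancel because \<open>\<omega>\<close> is skew (\<open>cross\<close>), and the others are
  the Jacobi identity, associativity and the Leibniz rule.

  It remains to check that \<open>P \<oplus> P\<^sup>*\<close> has this shape.  At momenta \<open>p\<close>, \<open>q\<close> the product \<open>\<circ>\<close> is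
  \<open>q (b \<lhd> a) - p (a \<rhd> b) + a \<diamond> b\<close>, and the coefficients of the monomials in the momenta in its
  left-symmetry and its compatibility with \<open>\<succ>\<close> are the defining identities of a pre-PGD-algebra
  (\<open>C_left_symmetric\<close>, \<open>C_z_derivation\<close>, \<open>C_z_product\<close>).\<close>

section \<open>Evaluating polynomials through additive functionals\<close>

definition peval :: "('q::zero \<Rightarrow> 'k::comm_ring_1) \<Rightarrow> 'k \<Rightarrow> 'q poly \<Rightarrow> 'k" where
  "peval f t p = (\<Sum>k\<le>degree p. f (coeff p k) * t ^ k)"

lemma peval_bound:
  assumes "f 0 = 0" "degree p \<le> n"
  shows "peval f t p = (\<Sum>k\<le>n. f (coeff p k) * t ^ k)"
  unfolding peval_def using assms
  by (intro sum.mono_neutral_left) (auto simp: coeff_eq_0 not_le)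

lemma peval_cong: "(\<And>k. f (coeff p k) = g (coeff p k)) \<Longrightarrow> peval f t p = peval g t p"
  by (simp add: peval_def)

lemma peval_0 [simp]: "f 0 = 0 \<Longrightarrow> peval f t 0 = 0"
  by (simp add: peval_def)

lemma peval_const [simp]: "peval f t [:x:] = f x"
  by (simp add: peval_def)

lemma peval_add:
  assumes f: "additive f"
  shows "peval f t (p + q) = peval f t p + peval f t q"
proof -
  note f0 = additive.zero[OF f]
  let ?n = "max (degree p) (degree q)"
  have "degree (p + q) \<le> ?n" by (rule degree_add_le_max)
  then show ?thesis
    by (simp add: peval_bound[where f = f and n = ?n, OF f0] additive.add[OF f] ring_distribs sum.distrib)
qed

lemma additive_peval: "additive f \<Longrightarrow> additive (peval f t)"
  by unfold_locales (rule peval_add)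

lemmas peval_minus = additive.minus[OF additive_peval]
lemmas peval_diff = additive.diff[OF additive_peval]

lemma peval_pCons:
  assumes "f 0 = 0"
  shows "peval f t (pCons a p) = f a + t * peval f t p"
proof -
  have "peval f t (pCons a p) = (\<Sum>k\<le>Suc (degree p). f (coeff (pCons a p) k) * t ^ k)"
    by (rule peval_bound[where f = f, OF assms degree_pCons_le])
  then show ?thesis
    by (simp only: sum.atMost_Suc_shift) (simp add: peval_def sum_distrib_left mult_ac)
qed

lemma peval_map_poly:
  assumes "g 0 = 0" "f 0 = 0"
  shows "peval f t (map_poly g p) = peval (\<lambda>x. f (g x)) t p"
  using assms map_poly_degree_leq[of g p]
  by (simp add: peval_bound[of f "map_poly g p" "degree p"] coeff_map_poly) (simp add: peval_def)

lemma peval_scale: "peval (\<lambda>x. c * f x) t p = c * peval f t p"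
  by (simp add: peval_def sum_distrib_left mult_ac)

lemma peval_uminus: "peval (\<lambda>x. - f x) t p = - peval f t p"
  by (simp add: peval_def sum_negf)

lemma peval_diff_fun: "peval (\<lambda>x. f x - g x) t p = peval f t p - peval g t p"
  by (simp add: peval_def sum_subtractf ring_distribs)

lemma peval_zero_fun: "peval (\<lambda>x. 0) t p = 0"
  by (simp add: peval_def)

lemma peval_eq_poly: "f 0 = 0 \<Longrightarrow> peval f t p = poly (map_poly f p) t"
  using peval_map_poly[of f "\<lambda>x. x" t p]
  by (simp add: peval_def[of "\<lambda>x. x"] poly_altdef)

text \<open>Characteristic 0 makes the field infinite, so that the polynomial \<open>map_poly f p\<close>, having every
  scalar as a root, vanishes.\<close>

lemma peval_zero_imp:
  fixes f :: "'q::zero \<Rightarrow> 'k::field_char_0"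
  assumes "f 0 = 0" "\<And>t. peval f t p = 0"
  shows "f (coeff p k) = 0"
proof -
  have "map_poly f p = 0" using assms by (simp add: peval_eq_poly flip: poly_all_0_iff_0)
  then show ?thesis using assms by (metis coeff_map_poly coeff_0)
qed

text \<open>Substituting an operator \<open>T\<close> for the parameter becomes substitution of a scalar \<open>t\<close>
  under any functional for which \<open>T\<close> acts as \<open>t\<close>.\<close>

lemma lsubst_eigen:
  assumes \<Phi>: "additive \<Phi>"
    and T: "\<And>m. m \<in> M \<Longrightarrow> T m \<in> M" "\<And>m. m \<in> M \<Longrightarrow> \<Phi> (T m) = t * \<Phi> m"
    and \<iota>: "\<And>k. \<iota> (coeff p k) \<in> M"
  shows "\<Phi> (lsubst T \<iota> p) = peval (\<lambda>x. \<Phi> (\<iota> x)) t p"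
proof -
  have "(T ^^ k) m \<in> M \<and> \<Phi> ((T ^^ k) m) = t ^ k * \<Phi> m" if "m \<in> M" for k m
    by (induction k) (use T that in \<open>auto simp: mult.assoc\<close>)
  then show ?thesis
    using \<iota> by (simp add: lsubst_def peval_def additive.sum[OF \<Phi>] mult.commute)
qed

lemma lsubst_closed:
  assumes "0 \<in> M" "\<And>x y. x \<in> M \<Longrightarrow> y \<in> M \<Longrightarrow> x + y \<in> M" "\<And>x. x \<in> M \<Longrightarrow> T x \<in> M"
    and "\<And>k. \<iota> (coeff p k) \<in> M"
  shows "lsubst T \<iota> p \<in> M"
proof -
  have *: "(T ^^ k) x \<in> M" if "x \<in> M" for k x
    by (induction k) (use that assms in auto)
  have "(\<Sum>k\<in>I. (T ^^ k) (\<iota> (coeff p k))) \<in> M" for I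
    by (induction I rule: infinite_finite_induct) (use assms * in auto)
  then show ?thesis by (simp add: lsubst_def)
qed

text \<open>For \<open>p\<close> in \<open>Q[\<lambda>, \<mu>]\<close>, \<open>peval (peval f m) l p\<close> sets the outer variable \<open>\<lambda>\<close> to \<open>l\<close> and the inner
  variable \<open>\<mu>\<close> to \<open>m\<close>.\<close>

lemma additive_peval2: "additive f \<Longrightarrow> additive (peval (peval f t) l)"
  by (intro additive_peval)

lemma peval_neg_lam_der:
  assumes f: "additive f" and D: "D 0 = 0" "\<And>k. f (D (coeff p k)) = x * f (coeff p k)"
  shows "peval f t (neg_lam_der D p) = (- t - x) * peval f t p"
proof -
  note f0 = additive.zero[OF f]
  have "peval f t (map_poly D p) = x * peval f t p"
    by (subst peval_map_poly[where f = f and g = D, OF D(1) f0]) (simp add: D(2) flip: peval_scale cong: peval_cong)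
  then show ?thesis
    by (simp add: neg_lam_der_def peval_diff[OF f] peval_minus[OF f] peval_pCons f0 ring_distribs)
qed

lemma neg_lam_der_closed:
  assumes "D 0 = 0" "0 \<in> M" "\<And>x. x \<in> M \<Longrightarrow> D x \<in> M" "\<And>x. x \<in> M \<Longrightarrow> - x \<in> M"
    "\<And>x y. x \<in> M \<Longrightarrow> y \<in> M \<Longrightarrow> x + y \<in> M" "\<And>k. coeff p k \<in> M"
  shows "coeff (neg_lam_der D p) k \<in> M"
proof -
  have "coeff (neg_lam_der D p) k = - coeff (pCons 0 p) k + - D (coeff p k)"
    by (simp add: neg_lam_der_def coeff_map_poly assms(1) del: minus_pCons)
  also have "\<dots> \<in> M"
    by (intro assms(5) assms(4)) (use assms in \<open>auto simp: coeff_pCons split: nat.split\<close>)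
  finally show ?thesis .
qed

lemma skew_subst_closed:
  assumes M: "D 0 = 0" "0 \<in> M" "\<And>x. x \<in> M \<Longrightarrow> D x \<in> M" "\<And>x. x \<in> M \<Longrightarrow> - x \<in> M"
    "\<And>x y. x \<in> M \<Longrightarrow> y \<in> M \<Longrightarrow> x + y \<in> M" "\<And>k. coeff p k \<in> M"
  shows "coeff (skew_subst D p) k \<in> M"
proof -
  have "skew_subst D p \<in> {p. \<forall>k. coeff p k \<in> M}"
    unfolding skew_subst_def
    by (rule lsubst_closed) (use M in \<open>auto simp: coeff_pCons split: nat.split intro!: neg_lam_der_closed\<close>)
  then show ?thesis by simp
qed

text \<open>If \<open>f\<close> is an eigenvector of the transpose of \<open>D = \<partial>\<close> with eigenvalue \<open>x\<close>, the operator \<open>-\<lambda>-\<partial>\<close> acts as the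
  scalar \<open>-t-x\<close> at \<open>\<lambda> = t\<close>.  The set \<open>M\<close> confines the coefficients to the module on which \<open>\<partial>\<close> has this
  property.\<close>

lemma peval_skew_subst:
  assumes f: "additive f" and M: "D 0 = 0" "0 \<in> M" "\<And>x. x \<in> M \<Longrightarrow> D x \<in> M" "\<And>x. x \<in> M \<Longrightarrow> - x \<in> M"
    "\<And>x y. x \<in> M \<Longrightarrow> y \<in> M \<Longrightarrow> x + y \<in> M" "\<And>k. coeff p k \<in> M"
    and D: "\<And>m. m \<in> M \<Longrightarrow> f (D m) = x * f m"
  shows "peval f t (skew_subst D p) = peval f (- t - x) p"
proof -
  have "peval f t (skew_subst D p) = peval (\<lambda>y. peval f t [:y:]) (- t - x) p"
    unfolding skew_subst_def
    by (rule lsubst_eigen[where M = "{p. \<forall>k. coeff p k \<in> M}"])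
       (use M D in \<open>auto simp: coeff_pCons split: nat.split
          intro!: neg_lam_der_closed peval_neg_lam_der additive_peval f\<close>)
  then show ?thesis by simp
qed

lemma lam_op_eigen:
  "additive f \<Longrightarrow> peval (peval f m) l (lam_op p) = l * peval (peval f m) l p"
  by (simp add: lam_op_def peval_pCons additive.zero)

lemma mu_op_eigen:
  assumes "additive f"
  shows "peval (peval f m) l (mu_op p) = m * peval (peval f m) l p"
  by (simp add: mu_op_def peval_map_poly additive.zero[OF assms] peval_pCons peval_scale)

lemma peval_nest_right:
  assumes f: "additive f"
    and S: "\<And>p. peval (peval f m) l (S p) = s * peval (peval f m) l p"
    and T: "\<And>p. peval (peval f m) l (T p) = t * peval (peval f m) l p"
  shows "peval (peval f m) l (nest_right g h S T a b c) =
    peval (\<lambda>x. peval f s (g a x)) t (h b c)"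
proof -
  note ad = additive_peval2[OF f]
  have "peval (peval f m) l (lsubst S (\<lambda>y. [:[:y:]:]) (g a x)) = peval f s (g a x)" for x
    by (subst lsubst_eigen[where M = UNIV and t = s, OF ad]) (simp_all add: S)
  then show ?thesis
    unfolding nest_right_def by (subst lsubst_eigen[where M = UNIV and t = t, OF ad]) (simp_all add: T)
qed

lemma peval_nest_left:
  assumes f: "additive f"
    and S: "\<And>p. peval (peval f m) l (S p) = s * peval (peval f m) l p"
    and T: "\<And>p. peval (peval f m) l (T p) = t * peval (peval f m) l p"
  shows "peval (peval f m) l (nest_left g h S T a b c) =
    peval (\<lambda>x. peval f t (g x c)) s (h a b)"
proof -
  note ad = additive_peval2[OF f]
  have "peval (peval f m) l (lsubst T (\<lambda>y. [:[:y:]:]) (g x c)) = peval f t (g x c)" for x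
    by (subst lsubst_eigen[where M = UNIV and t = t, OF ad]) (simp_all add: T)
  then show ?thesis
    unfolding nest_left_def by (subst lsubst_eigen[where M = UNIV and t = s, OF ad]) (simp_all add: S)
qed


section \<open>Evaluating tensors\<close>

lemma sum2_Nil [simp]: "sum2 \<beta> [] = 0" and sum3_Nil [simp]: "sum3 \<gamma> [] = 0"
  by (simp_all add: sum2_def sum3_def)

lemma sum2_Cons [simp]: "sum2 \<beta> ((u, v) # xs) = \<beta> u v + sum2 \<beta> xs"
  and sum3_Cons [simp]: "sum3 \<gamma> ((u, v, w) # ys) = \<gamma> u v w + sum3 \<gamma> ys"
  by (simp_all add: sum2_def sum3_def)

lemma sum2_append: "sum2 \<beta> (xs @ ys) = sum2 \<beta> xs + sum2 \<beta> ys"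
  by (simp add: sum2_def)

lemma sum3_append: "sum3 \<beta> (xs @ ys) = sum3 \<beta> xs + sum3 \<beta> ys"
  by (simp add: sum3_def)

lemma Tens2_zero [simp]: "0 \<in> Tens2 Q" and Tens3_zero [simp]: "0 \<in> Tens3 Q"
  unfolding Tens2_def Tens3_def by (auto intro: exI[of _ "[]"])

lemma Tens2_tens2: "u \<in> car Q \<Longrightarrow> v \<in> car Q \<Longrightarrow> tens2 Q u v \<in> Tens2 Q"
  unfolding Tens2_def by (auto intro!: exI[of _ "[(u, v)]"])

lemma Tens3_tens3: "u \<in> car Q \<Longrightarrow> v \<in> car Q \<Longrightarrow> w \<in> car Q \<Longrightarrow> tens3 Q u v w \<in> Tens3 Q"
  unfolding Tens3_def by (auto intro!: exI[of _ "[(u, v, w)]"])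

lemma Tens2_add: "X \<in> Tens2 Q \<Longrightarrow> Y \<in> Tens2 Q \<Longrightarrow> X + Y \<in> Tens2 Q"
proof -
  assume "X \<in> Tens2 Q" "Y \<in> Tens2 Q"
  then obtain xs ys where "X = sum2 (tens2 Q) xs" "set xs \<subseteq> car Q \<times> car Q"
    "Y = sum2 (tens2 Q) ys" "set ys \<subseteq> car Q \<times> car Q" by (auto simp: Tens2_def)
  then show ?thesis unfolding Tens2_def by (auto intro!: exI[of _ "xs @ ys"] simp: sum2_append)
qed

lemma Tens3_add: "X \<in> Tens3 Q \<Longrightarrow> Y \<in> Tens3 Q \<Longrightarrow> X + Y \<in> Tens3 Q"
proof -
  assume "X \<in> Tens3 Q" "Y \<in> Tens3 Q"
  then obtain xs ys where "X = sum3 (tens3 Q) xs" "set xs \<subseteq> car Q \<times> car Q \<times> car Q"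
    "Y = sum3 (tens3 Q) ys" "set ys \<subseteq> car Q \<times> car Q \<times> car Q" by (auto simp: Tens3_def)
  then show ?thesis unfolding Tens3_def by (auto intro!: exI[of _ "xs @ ys"] simp: sum3_append)
qed

lemma dual_spD:
  assumes "f \<in> dual_sp Q"
  shows "x \<in> car Q \<Longrightarrow> y \<in> car Q \<Longrightarrow> f (x + y) = f x + f y"
    and "x \<in> car Q \<Longrightarrow> f (scl Q c x) = c * f x"
  using assms by (auto simp: dual_sp_def)

lemma Tens2_scale:
  assumes Q: "kd_module Q" and "X \<in> Tens2 Q"
  shows "(\<lambda>f g. c * X f g) \<in> Tens2 Q"
proof -
  obtain xs where xs: "X = sum2 (tens2 Q) xs" "set xs \<subseteq> car Q \<times> car Q"
    using assms(2) by (auto simp: Tens2_def)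
  have "(\<lambda>f g. c * sum2 (tens2 Q) xs f g) \<in> Tens2 Q" using xs(2)
  proof (induction xs)
    case Nil
    have "(\<lambda>f g. c * sum2 (tens2 Q) [] f g) = 0" by (simp add: fun_eq_iff)
    then show ?case by simp
  next
    case (Cons p xs)
    obtain u v where p: "p = (u, v)" "u \<in> car Q" "v \<in> car Q" using Cons.prems by (cases p) auto
    have "(\<lambda>f g. c * sum2 (tens2 Q) (p # xs) f g) =
        tens2 Q (scl Q c u) v + (\<lambda>f g. c * sum2 (tens2 Q) xs f g)"
      using p by (auto simp: fun_eq_iff tens2_def algebra_simps dual_spD)
    then show ?case
      using Cons p by (auto intro!: Tens2_add Tens2_tens2 kd_module_scaleD(5)[OF Q])
  qed
  then show ?thesis using xs by simp
qed

lemma Tens3_scale: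
  assumes Q: "kd_module Q" and "X \<in> Tens3 Q"
  shows "(\<lambda>f g h. c * X f g h) \<in> Tens3 Q"
proof -
  obtain xs where xs: "X = sum3 (tens3 Q) xs" "set xs \<subseteq> car Q \<times> car Q \<times> car Q"
    using assms(2) by (auto simp: Tens3_def)
  have "(\<lambda>f g h. c * sum3 (tens3 Q) xs f g h) \<in> Tens3 Q" using xs(2)
  proof (induction xs)
    case Nil
    have "(\<lambda>f g h. c * sum3 (tens3 Q) [] f g h) = 0" by (simp add: fun_eq_iff)
    then show ?case by simp
  next
    case (Cons p xs)
    obtain u v w where p: "p = (u, v, w)" "u \<in> car Q" "v \<in> car Q" "w \<in> car Q"
      using Cons.prems by (cases p) auto
    have "(\<lambda>f g h. c * sum3 (tens3 Q) (p # xs) f g h) =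
        tens3 Q (scl Q c u) v w + (\<lambda>f g h. c * sum3 (tens3 Q) xs f g h)"
      using p by (auto simp: fun_eq_iff tens3_def algebra_simps dual_spD)
    then show ?case
      using Cons p by (auto intro!: Tens3_add Tens3_tens3 kd_module_scaleD(5)[OF Q])
  qed
  then show ?thesis using xs by simp
qed

lemma Tens2_minus: "kd_module Q \<Longrightarrow> X \<in> Tens2 Q \<Longrightarrow> - X \<in> Tens2 Q"
  using Tens2_scale[of Q X "-1"] by (simp add: fun_Compl_def)

lemma Tens3_minus: "kd_module Q \<Longrightarrow> X \<in> Tens3 Q \<Longrightarrow> - X \<in> Tens3 Q"
  using Tens3_scale[of Q X "-1"] by (simp add: fun_Compl_def)

lemma Tens2_diff: "kd_module Q \<Longrightarrow> X \<in> Tens2 Q \<Longrightarrow> Y \<in> Tens2 Q \<Longrightarrow> X - Y \<in> Tens2 Q"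
  using Tens2_add[of X Q "- Y"] Tens2_minus[of Q Y] by simp

lemma Tens3_diff: "kd_module Q \<Longrightarrow> X \<in> Tens3 Q \<Longrightarrow> Y \<in> Tens3 Q \<Longrightarrow> X - Y \<in> Tens3 Q"
  using Tens3_add[of X Q "- Y"] Tens3_minus[of Q Y] by simp

text \<open>\<open>lift2\<close> evaluates \<open>\<beta>\<close> on some chosen representation of \<open>X\<close> as a sum of pure tensors.  Writing \<open>X\<close>
  on the right-hand side by the same representation and using additivity of \<open>\<Phi>\<close> and \<open>\<Psi>\<close>, the claim
  reduces to pure tensors.\<close>

lemma lift2_eval:
  assumes X: "X \<in> Tens2 Q" and "additive \<Phi>" "additive \<Psi>"
    and eq: "\<And>u v. u \<in> car Q \<Longrightarrow> v \<in> car Q \<Longrightarrow> \<Phi> (\<beta> u v) = \<Psi> (tens2 Q u v)"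
  shows "\<Phi> (lift2 Q \<beta> X) = \<Psi> X"
proof -
  let ?P = "\<lambda>xs. set xs \<subseteq> car Q \<times> car Q \<and> sum2 (tens2 Q) xs = X"
  define xs where "xs = Eps ?P"
  have xs: "?P xs" unfolding xs_def by (rule someI_ex[of ?P]) (use X in \<open>auto simp: Tens2_def\<close>)
  then have "set xs \<subseteq> car Q \<times> car Q" by simp
  then have "\<Phi> (sum2 \<beta> xs) = \<Psi> (sum2 (tens2 Q) xs)"
    by (induction xs) (auto simp: additive.zero[OF assms(2)] additive.zero[OF assms(3)]
        additive.add[OF assms(2)] additive.add[OF assms(3)] eq)
  then show ?thesis using xs by (simp add: lift2_def xs_def)
qed

lemma lift3_eval:
  assumes X: "X \<in> Tens3 Q" and "additive \<Phi>" "additive \<Psi>"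
    and eq: "\<And>u v w. u \<in> car Q \<Longrightarrow> v \<in> car Q \<Longrightarrow> w \<in> car Q \<Longrightarrow> \<Phi> (\<beta> u v w) = \<Psi> (tens3 Q u v w)"
  shows "\<Phi> (lift3 Q \<beta> X) = \<Psi> X"
proof -
  let ?P = "\<lambda>xs. set xs \<subseteq> car Q \<times> car Q \<times> car Q \<and> sum3 (tens3 Q) xs = X"
  define xs where "xs = Eps ?P"
  have xs: "?P xs" unfolding xs_def by (rule someI_ex[of ?P]) (use X in \<open>auto simp: Tens3_def\<close>)
  then have "set xs \<subseteq> car Q \<times> car Q \<times> car Q" by simp
  then have "\<Phi> (sum3 \<beta> xs) = \<Psi> (sum3 (tens3 Q) xs)"
    by (induction xs) (auto simp: additive.zero[OF assms(2)] additive.zero[OF assms(3)]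
        additive.add[OF assms(2)] additive.add[OF assms(3)] eq)
  then show ?thesis using xs by (simp add: lift3_def xs_def)
qed

lemma lift2_closed:
  assumes X: "X \<in> Tens2 Q" and M: "0 \<in> M" "\<And>x y. x \<in> M \<Longrightarrow> y \<in> M \<Longrightarrow> x + y \<in> M"
    and \<beta>: "\<And>u v. u \<in> car Q \<Longrightarrow> v \<in> car Q \<Longrightarrow> \<beta> u v \<in> M"
  shows "lift2 Q \<beta> X \<in> M"
proof -
  let ?P = "\<lambda>xs. set xs \<subseteq> car Q \<times> car Q \<and> sum2 (tens2 Q) xs = X"
  define xs where "xs = Eps ?P"
  have "?P xs" unfolding xs_def by (rule someI_ex[of ?P]) (use X in \<open>auto simp: Tens2_def\<close>)
  then have "set xs \<subseteq> car Q \<times> car Q" by simp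
  then have "sum2 \<beta> xs \<in> M" by (induction xs) (use assms in auto)
  then show ?thesis by (simp add: lift2_def xs_def)
qed

lemma lift3_closed:
  assumes X: "X \<in> Tens3 Q" and M: "0 \<in> M" "\<And>x y. x \<in> M \<Longrightarrow> y \<in> M \<Longrightarrow> x + y \<in> M"
    and \<beta>: "\<And>u v w. u \<in> car Q \<Longrightarrow> v \<in> car Q \<Longrightarrow> w \<in> car Q \<Longrightarrow> \<beta> u v w \<in> M"
  shows "lift3 Q \<beta> X \<in> M"
proof -
  let ?P = "\<lambda>xs. set xs \<subseteq> car Q \<times> car Q \<times> car Q \<and> sum3 (tens3 Q) xs = X"
  define xs where "xs = Eps ?P"
  have "?P xs" unfolding xs_def by (rule someI_ex[of ?P]) (use X in \<open>auto simp: Tens3_def\<close>)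
  then have "set xs \<subseteq> car Q \<times> car Q \<times> car Q" by simp
  then have "sum3 \<beta> xs \<in> M" by (induction xs) (use assms in auto)
  then show ?thesis by (simp add: lift3_def xs_def)
qed

lemma additive_ev2: "additive (\<lambda>X. X f g)" and additive_ev3: "additive (\<lambda>X. X f g h)"
  by unfold_locales auto

lemma additive_cmult: "additive f \<Longrightarrow> additive (\<lambda>x. (c::'k::comm_ring_1) * f x)"
  by unfold_locales (simp add: additive.add ring_distribs)

lemma additive_plus: "additive f \<Longrightarrow> additive g \<Longrightarrow> additive (\<lambda>x. f x + g x)"
  and additive_diff: "additive f \<Longrightarrow> additive g \<Longrightarrow> additive (\<lambda>x. f x - g x)"
  and additive_uminus: "additive f \<Longrightarrow> additive (\<lambda>x. - f x)"
  by (unfold_locales; simp add: additive.add)+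

lemma dual_sp_zero: "kd_module Q \<Longrightarrow> g \<in> dual_sp Q \<Longrightarrow> g 0 = 0"
  using dual_spD(1)[of g Q 0 0] kd_module_scaleD(3)[of Q]
  by (metis add_0 add_cancel_left_left)

lemma tens2_apply: "f \<in> dual_sp Q \<Longrightarrow> g \<in> dual_sp Q \<Longrightarrow> tens2 Q u v f g = f u * g v"
  and tens3_apply: "f \<in> dual_sp Q \<Longrightarrow> g \<in> dual_sp Q \<Longrightarrow> h \<in> dual_sp Q \<Longrightarrow>
    tens3 Q u v w f g h = f u * g v * h w"
  by (simp_all add: tens2_def tens3_def)

lemma Tens2_contract_fst:
  assumes Q: "kd_module Q" and X: "X \<in> Tens2 Q" and F: "F \<in> dual_sp Q"
  shows "\<exists>w\<in>car Q. \<forall>g\<in>dual_sp Q. X F g = g w"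
proof -
  note K = kd_module_scaleD[OF Q]
  obtain xs where X: "X = sum2 (tens2 Q) xs" and xs: "set xs \<subseteq> car Q \<times> car Q"
    using X by (auto simp: Tens2_def)
  show ?thesis unfolding X using xs
  proof (induction xs)
    case Nil
    show ?case using K(3) by (auto intro!: bexI[of _ 0] simp: dual_sp_zero[OF Q])
  next
    case (Cons p xs)
    obtain u v where p: "p = (u, v)" "u \<in> car Q" "v \<in> car Q" using Cons.prems by (cases p) auto
    obtain w where w: "w \<in> car Q" "\<forall>g\<in>dual_sp Q. sum2 (tens2 Q) xs F g = g w"
      using Cons by auto
    show ?case using p F w
      by (intro bexI[of _ "scl Q (F u) v + w"])
         (auto simp: tens2_apply dual_spD K(5) intro!: K(4) K(5))
  qed
qed

lemma Tens2_contract_snd: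
  assumes Q: "kd_module Q" and X: "X \<in> Tens2 Q" and F: "F \<in> dual_sp Q"
  shows "\<exists>w\<in>car Q. \<forall>g\<in>dual_sp Q. X g F = g w"
proof -
  note K = kd_module_scaleD[OF Q]
  obtain xs where X: "X = sum2 (tens2 Q) xs" and xs: "set xs \<subseteq> car Q \<times> car Q"
    using X by (auto simp: Tens2_def)
  show ?thesis unfolding X using xs
  proof (induction xs)
    case Nil
    show ?case using K(3) by (auto intro!: bexI[of _ 0] simp: dual_sp_zero[OF Q])
  next
    case (Cons p xs)
    obtain u v where p: "p = (u, v)" "u \<in> car Q" "v \<in> car Q" using Cons.prems by (cases p) auto
    obtain w where w: "w \<in> car Q" "\<forall>g\<in>dual_sp Q. sum2 (tens2 Q) xs g F = g w"
      using Cons by auto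
    show ?case using p F w
      by (intro bexI[of _ "scl Q (F v) u + w"])
         (auto simp: tens2_apply dual_spD K(5) intro!: K(4) K(5))
  qed
qed

lemma Tens3_contract_fst:
  assumes Q: "kd_module Q" and X: "X \<in> Tens3 Q" and F: "F \<in> dual_sp Q"
  shows "\<exists>Y\<in>Tens2 Q. \<forall>g\<in>dual_sp Q. \<forall>h\<in>dual_sp Q. X F g h = Y g h"
proof -
  note K = kd_module_scaleD[OF Q]
  obtain xs where X: "X = sum3 (tens3 Q) xs" and xs: "set xs \<subseteq> car Q \<times> car Q \<times> car Q"
    using X by (auto simp: Tens3_def)
  show ?thesis unfolding X using xs
  proof (induction xs)
    case Nil
    show ?case by (auto intro!: bexI[of _ 0])
  next
    case (Cons p xs)
    obtain u v w where p: "p = (u, v, w)" "u \<in> car Q" "v \<in> car Q" "w \<in> car Q"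
      using Cons.prems by (cases p) auto
    obtain Y where Y: "Y \<in> Tens2 Q"
        "\<forall>g\<in>dual_sp Q. \<forall>h\<in>dual_sp Q. sum3 (tens3 Q) xs F g h = Y g h"
      using Cons by auto
    show ?case using p F Y
      by (intro bexI[of _ "tens2 Q (scl Q (F u) v) w + Y"])
         (auto simp: tens2_apply tens3_apply dual_spD K(5) intro!: Tens2_add Tens2_tens2 K(5))
  qed
qed

lemma Tens3_contract_snd_trd:
  assumes Q: "kd_module Q" and X: "X \<in> Tens3 Q" and G: "G \<in> dual_sp Q" and H: "H \<in> dual_sp Q"
  shows "\<exists>w\<in>car Q. \<forall>f\<in>dual_sp Q. X f G H = f w"
proof -
  note K = kd_module_scaleD[OF Q]
  obtain xs where X: "X = sum3 (tens3 Q) xs" and xs: "set xs \<subseteq> car Q \<times> car Q \<times> car Q"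
    using X by (auto simp: Tens3_def)
  show ?thesis unfolding X using xs
  proof (induction xs)
    case Nil
    show ?case using K(3) by (auto intro!: bexI[of _ 0] simp: dual_sp_zero[OF Q])
  next
    case (Cons p xs)
    obtain u v w where p: "p = (u, v, w)" "u \<in> car Q" "v \<in> car Q" "w \<in> car Q"
      using Cons.prems by (cases p) auto
    obtain y where y: "y \<in> car Q" "\<forall>f\<in>dual_sp Q. sum3 (tens3 Q) xs f G H = f y"
      using Cons by auto
    show ?case using p G H y
      by (intro bexI[of _ "scl Q (G v * H w) u + y"])
         (auto simp: tens3_apply dual_spD K(5) intro!: K(4) K(5))
  qed
qed

lemma Tens2_outside:
  assumes "X \<in> Tens2 Q" "\<not> (f \<in> dual_sp Q \<and> g \<in> dual_sp Q)"
  shows "X f g = 0"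
proof -
  obtain xs where X: "X = sum2 (tens2 Q) xs" using assms(1) by (auto simp: Tens2_def)
  show ?thesis unfolding X
    by (induction xs) (use assms(2) in \<open>auto simp: tens2_def\<close>)
qed

lemma Tens3_outside:
  assumes "X \<in> Tens3 Q" "\<not> (f \<in> dual_sp Q \<and> g \<in> dual_sp Q \<and> h \<in> dual_sp Q)"
  shows "X f g h = 0"
proof -
  obtain xs where X: "X = sum3 (tens3 Q) xs" using assms(1) by (auto simp: Tens3_def)
  show ?thesis unfolding X
    by (induction xs) (use assms(2) in \<open>auto simp: tens3_def\<close>)
qed

text \<open>Contracting the first factor of \<open>X\<close> with a functional in \<open>D\<close> leaves a vector on which all of \<open>D\<close>
  vanishes, hence zero.  So the second factor may be paired with an arbitrary functional; contracting
  with that one leaves a vector killed by \<open>D\<close> again.\<close>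

lemma Tens2_separate:
  assumes Q: "kd_module Q" and D: "D \<subseteq> dual_sp Q"
    and sep: "\<And>q. q \<in> car Q \<Longrightarrow> \<forall>f\<in>D. f q = 0 \<Longrightarrow> q = 0"
    and X: "X \<in> Tens2 Q" and 0: "\<And>f g. f \<in> D \<Longrightarrow> g \<in> D \<Longrightarrow> X f g = 0"
  shows "X = 0"
proof -
  have 1: "X F g = 0" if F: "F \<in> D" and g: "g \<in> dual_sp Q" for F g
  proof -
    obtain w where w: "w \<in> car Q" "\<forall>g\<in>dual_sp Q. X F g = g w"
      using Tens2_contract_fst[OF Q X] F D by blast
    have "\<forall>f\<in>D. f w = 0" using w(2) 0[OF F] D by (metis subsetD)
    with w have "w = 0" by (intro sep)
    then show ?thesis using w g by (simp add: dual_sp_zero[OF Q])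
  qed
  have "X f g = 0" if fg: "f \<in> dual_sp Q" "g \<in> dual_sp Q" for f g
  proof -
    obtain w where w: "w \<in> car Q" "\<forall>f\<in>dual_sp Q. X f g = f w"
      using Tens2_contract_snd[OF Q X fg(2)] by blast
    have "\<forall>f\<in>D. f w = 0" using w(2) 1 fg(2) D by (metis subsetD)
    with w have "w = 0" by (intro sep)
    then show ?thesis using w fg by (simp add: dual_sp_zero[OF Q])
  qed
  then show ?thesis using Tens2_outside[OF X] by (simp add: fun_eq_iff) blast
qed

text \<open>As for two factors: contraction with a functional in \<open>D\<close> leaves a tensor of rank two, to which
  \<open>Tens2_separate\<close> applies.\<close>

lemma Tens3_separate:
  assumes Q: "kd_module Q" and D: "D \<subseteq> dual_sp Q"
    and sep: "\<And>q. q \<in> car Q \<Longrightarrow> \<forall>f\<in>D. f q = 0 \<Longrightarrow> q = 0"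
    and X: "X \<in> Tens3 Q"
    and 0: "\<And>f g h. f \<in> D \<Longrightarrow> g \<in> D \<Longrightarrow> h \<in> D \<Longrightarrow> X f g h = 0"
  shows "X = 0"
proof -
  have 1: "X F g h = 0" if F: "F \<in> D" and gh: "g \<in> dual_sp Q" "h \<in> dual_sp Q" for F g h
  proof -
    obtain Y where Y: "Y \<in> Tens2 Q" "\<forall>g\<in>dual_sp Q. \<forall>h\<in>dual_sp Q. X F g h = Y g h"
      using Tens3_contract_fst[OF Q X] F D by blast
    have "Y g h = 0" if "g \<in> D" "h \<in> D" for g h
    proof -
      have "Y g h = X F g h" using Y(2) that D by (metis subsetD)
      then show ?thesis using 0[OF F that] by simp
    qed
    then have "Y = 0" using Y by (intro Tens2_separate[OF Q D sep]) auto
    then show ?thesis using Y gh by simp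
  qed
  have "X f g h = 0" if fgh: "f \<in> dual_sp Q" "g \<in> dual_sp Q" "h \<in> dual_sp Q" for f g h
  proof -
    obtain w where w: "w \<in> car Q" "\<forall>f\<in>dual_sp Q. X f g h = f w"
      using Tens3_contract_snd_trd[OF Q X fgh(2,3)] by blast
    have "\<forall>f\<in>D. f w = 0" using w(2) 1 fgh(2,3) D by (metis subsetD)
    with w have "w = 0" by (intro sep)
    then show ?thesis using w fgh by (simp add: dual_sp_zero[OF Q])
  qed
  then show ?thesis using Tens3_outside[OF X] by (simp add: fun_eq_iff) blast
qed

section \<open>Momentum space\<close>

text \<open>\<open>ev x\<close> stands for setting \<open>\<partial>\<close> to the scalar \<open>x\<close>, with values in a fibre \<open>V\<close> that is the same for all
  momenta \<open>x\<close>.  The form \<open>\<omega>\<close> serves to turn values in the fibre into scalars, and elements \<open>w\<close> of the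
  fibre into functionals \<open>\<omega> w (ev x q)\<close> of \<open>q\<close>.\<close>

locale momentum_space =
  fixes Q :: "('k::field_char_0, 'q::ab_group_add) pc_alg"
    and V :: "'v::ab_group_add set" and ev :: "'k \<Rightarrow> 'q \<Rightarrow> 'v" and \<omega> :: "'v \<Rightarrow> 'v \<Rightarrow> 'k"
  assumes kd: "kd_module Q"
    and ev_in: "q \<in> car Q \<Longrightarrow> ev x q \<in> V"
    and additive_\<omega>_ev: "w \<in> V \<Longrightarrow> additive (\<lambda>q. \<omega> w (ev x q))"
    and \<omega>_ev_scl: "w \<in> V \<Longrightarrow> \<omega> w (ev x (scl Q c q)) = c * \<omega> w (ev x q)"
    and \<omega>_ev_der: "w \<in> V \<Longrightarrow> \<omega> w (ev x (der Q q)) = x * \<omega> w (ev x q)"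
    and separating: "q \<in> car Q \<Longrightarrow> (\<And>x w. w \<in> V \<Longrightarrow> \<omega> w (ev x q) = 0) \<Longrightarrow> q = 0"
    and \<omega>_skew: "v \<in> V \<Longrightarrow> w \<in> V \<Longrightarrow> \<omega> v w = - \<omega> w v"
begin

definition E :: "'k \<Rightarrow> 'v \<Rightarrow> 'q \<Rightarrow> 'k" where "E x w = (\<lambda>q. \<omega> w (ev x q))"

lemma E_apply: "E x w q = \<omega> w (ev x q)"
  by (simp add: E_def)

lemma additive_E: "w \<in> V \<Longrightarrow> additive (E x w)"
  by (simp add: E_def additive_\<omega>_ev)

lemmas E_add = additive.add[OF additive_E]
lemmas E_zero = additive.zero[OF additive_E]
lemmas E_diff = additive.diff[OF additive_E]

lemma E_scl: "w \<in> V \<Longrightarrow> E x w (scl Q c q) = c * E x w q"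
  and E_der: "w \<in> V \<Longrightarrow> E x w (der Q q) = x * E x w q"
  by (simp_all add: E_def \<omega>_ev_scl \<omega>_ev_der)

lemma E_dual: "w \<in> V \<Longrightarrow> E x w \<in> dual_sp Q"
  by (simp add: dual_sp_def E_add E_scl)

lemma scl_zero: "scl Q c 0 = 0"
proof -
  interpret vector_space "scl Q" by (rule kd_module_scaleD[OF kd])
  show ?thesis by simp
qed

lemma car_minus: "x \<in> car Q \<Longrightarrow> - x \<in> car Q"
proof -
  interpret vector_space "scl Q" by (rule kd_module_scaleD[OF kd])
  show "x \<in> car Q \<Longrightarrow> - x \<in> car Q" using kd_module_scaleD(5)[OF kd, of x "-1"] by simp
qed

lemma der_in: "x \<in> car Q \<Longrightarrow> der Q x \<in> car Q"
  using kd by (auto simp: kd_module_def)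

lemma der_zero: "der Q 0 = 0"
proof -
  have "der Q (0 + 0) = der Q 0 + der Q 0"
    using kd kd_module_scaleD(3)[OF kd] unfolding kd_module_def by blast
  then show ?thesis by simp
qed

lemmas car_zero = kd_module_scaleD(3)[OF kd]
lemmas car_add = kd_module_scaleD(4)[OF kd]
lemmas car_scl = kd_module_scaleD(5)[OF kd]

lemma car_diff: "x \<in> car Q \<Longrightarrow> y \<in> car Q \<Longrightarrow> x - y \<in> car Q"
  using car_add[of x "- y"] car_minus by simp

lemma car_eqI:
  assumes "p \<in> car Q" "q \<in> car Q" "\<And>x w. w \<in> V \<Longrightarrow> E x w p = E x w q"
  shows "p = q"
proof -
  have "p - q = 0"
    by (rule separating) (use assms in \<open>auto simp: car_diff E_diff simp flip: E_apply\<close>)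
  then show ?thesis by simp
qed

lemma Tens2_eqI:
  assumes "X \<in> Tens2 Q" "Y \<in> Tens2 Q"
    and "\<And>x w y v. w \<in> V \<Longrightarrow> v \<in> V \<Longrightarrow> X (E x w) (E y v) = Y (E x w) (E y v)"
  shows "X = Y"
proof -
  have "X - Y = 0"
  proof (rule Tens2_separate[OF kd, of "{E x w |x w. w \<in> V}"])
    show "{E x w |x w. w \<in> V} \<subseteq> dual_sp Q" using E_dual by auto
    show "q = 0" if "q \<in> car Q" "\<forall>f\<in>{E x w |x w. w \<in> V}. f q = 0" for q
      using that by (intro separating) (auto simp flip: E_apply)
  qed (use assms Tens2_diff[OF kd] in auto)
  then show ?thesis by simp
qed

lemma Tens3_eqI:
  assumes "X \<in> Tens3 Q" "Y \<in> Tens3 Q"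
    and "\<And>x w y v z u. w \<in> V \<Longrightarrow> v \<in> V \<Longrightarrow> u \<in> V \<Longrightarrow>
      X (E x w) (E y v) (E z u) = Y (E x w) (E y v) (E z u)"
  shows "X = Y"
proof -
  have "X - Y = 0"
  proof (rule Tens3_separate[OF kd, of "{E x w |x w. w \<in> V}"])
    show "{E x w |x w. w \<in> V} \<subseteq> dual_sp Q" using E_dual by auto
    show "q = 0" if "q \<in> car Q" "\<forall>f\<in>{E x w |x w. w \<in> V}. f q = 0" for q
      using that by (intro separating) (auto simp flip: E_apply)
  qed (use assms Tens3_diff[OF kd] in auto)
  then show ?thesis by simp
qed

lemma poly_car_eqI:
  assumes "\<And>k. coeff p k \<in> car Q" "\<And>k. coeff q k \<in> car Q"
    and "\<And>x w t. w \<in> V \<Longrightarrow> peval (E x w) t p = peval (E x w) t q"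
  shows "p = q"
proof (rule poly_eqI, rule car_eqI)
  fix k x w assume w: "w \<in> V"
  have "E x w (coeff (p - q) k) = 0"
    by (rule peval_zero_imp) (use w assms in \<open>auto simp: E_zero peval_diff[OF additive_E]\<close>)
  then show "E x w (coeff p k) = E x w (coeff q k)" using w by (simp add: E_diff)
qed (use assms in auto)

lemma poly_poly_car_eqI:
  assumes "\<And>j k. coeff (coeff p j) k \<in> car Q" "\<And>j k. coeff (coeff q j) k \<in> car Q"
    and "\<And>x w m l. w \<in> V \<Longrightarrow> peval (peval (E x w) m) l p = peval (peval (E x w) m) l q"
  shows "p = q"
proof (rule poly_eqI, rule poly_car_eqI)
  fix k x w t assume w: "w \<in> V"
  note ad = additive_peval[OF additive_E[OF w]]
  have "peval (E x w) t (coeff (p - q) k) = 0"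
    by (rule peval_zero_imp) (use w assms in \<open>auto simp: E_zero peval_diff[OF ad]\<close>)
  then show "peval (E x w) t (coeff p k) = peval (E x w) t (coeff q k)"
    using w by (simp add: peval_diff[OF additive_E])
qed (use assms in auto)

lemma poly_Tens2_eqI:
  assumes "\<And>k. coeff p k \<in> Tens2 Q" "\<And>k. coeff q k \<in> Tens2 Q"
    and "\<And>x w y v t. w \<in> V \<Longrightarrow> v \<in> V \<Longrightarrow>
      peval (\<lambda>X. X (E x w) (E y v)) t p = peval (\<lambda>X. X (E x w) (E y v)) t q"
  shows "p = q"
proof (rule poly_eqI, rule Tens2_eqI)
  fix k x w y v assume w: "w \<in> V" "v \<in> V"
  have "(\<lambda>X. X (E x w) (E y v)) (coeff (p - q) k) = 0"
    by (rule peval_zero_imp[where f = "\<lambda>X. X (E x w) (E y v)"]) (use w assms in \<open>auto simp: peval_diff[OF additive_ev2]\<close>)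
  then show "coeff p k (E x w) (E y v) = coeff q k (E x w) (E y v)" by simp
qed (use assms in auto)

text \<open>At parameter \<open>\<lambda> = t\<close> and \<open>\<partial> = x\<close> the arguments of a sesquilinear product are evaluated at the momenta
  \<open>-t\<close> and \<open>x + t\<close>.  The last two clauses provide adjoints: a functional \<open>E\<close> composed with a
  multiplication operator is then again one of the functionals \<open>E\<close>, at another momentum.\<close>

definition represents :: "('q \<Rightarrow> 'q \<Rightarrow> 'q poly) \<Rightarrow> ('k \<Rightarrow> 'k \<Rightarrow> 'v \<Rightarrow> 'v \<Rightarrow> 'v) \<Rightarrow> bool" where
  "represents f F \<longleftrightarrow>
     (\<forall>a\<in>car Q. \<forall>b\<in>car Q. (\<forall>k. coeff (f a b) k \<in> car Q) \<and>
        (\<forall>x t. \<forall>w\<in>V. peval (E x w) t (f a b) =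
           \<omega> w (F (- t) (x + t) (ev (- t) a) (ev (x + t) b)))) \<and>
     (\<forall>p q. \<forall>a\<in>V. \<forall>b\<in>V. F p q a b \<in> V) \<and>
     (\<forall>p q. \<forall>a\<in>V. \<forall>w\<in>V. \<exists>w'\<in>V. \<forall>u\<in>V. \<omega> w (F p q a u) = \<omega> w' u) \<and>
     (\<forall>p q. \<forall>a\<in>V. \<forall>w\<in>V. \<exists>w'\<in>V. \<forall>u\<in>V. \<omega> w (F p q u a) = \<omega> w' u)"

text \<open>The transposes with respect to \<open>\<omega>\<close> of the left multiplication by \<open>a\<close> and of the right one.\<close>

definition adj where
  "adj F p q a w = (SOME w'. w' \<in> V \<and> (\<forall>u\<in>V. \<omega> w (F p q a u) = \<omega> w' u))"

definition adjl where
  "adjl F p q a w = (SOME w'. w' \<in> V \<and> (\<forall>u\<in>V. \<omega> w (F p q u a) = \<omega> w' u))"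

context
  fixes f :: "'q \<Rightarrow> 'q \<Rightarrow> 'q poly" and F :: "'k \<Rightarrow> 'k \<Rightarrow> 'v \<Rightarrow> 'v \<Rightarrow> 'v"
  assumes rep: "represents f F"
begin

lemma represents_in: "a \<in> car Q \<Longrightarrow> b \<in> car Q \<Longrightarrow> coeff (f a b) k \<in> car Q"
  using rep unfolding represents_def by blast

lemma represents_peval:
  "a \<in> car Q \<Longrightarrow> b \<in> car Q \<Longrightarrow> w \<in> V \<Longrightarrow>
   peval (E x w) t (f a b) = \<omega> w (F (- t) (x + t) (ev (- t) a) (ev (x + t) b))"
  using rep unfolding represents_def by blast

lemma represents_closed: "a \<in> V \<Longrightarrow> b \<in> V \<Longrightarrow> F p q a b \<in> V"
  using rep unfolding represents_def by blast

lemma adj_in: "a \<in> V \<Longrightarrow> w \<in> V \<Longrightarrow> adj F p q a w \<in> V"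
  and \<omega>_adj: "a \<in> V \<Longrightarrow> w \<in> V \<Longrightarrow> u \<in> V \<Longrightarrow> \<omega> (adj F p q a w) u = \<omega> w (F p q a u)"
proof -
  have *: "adj F p q a w \<in> V \<and> (\<forall>u\<in>V. \<omega> w (F p q a u) = \<omega> (adj F p q a w) u)"
    if "a \<in> V" "w \<in> V"
  proof -
    have "\<exists>w'\<in>V. \<forall>u\<in>V. \<omega> w (F p q a u) = \<omega> w' u"
      using rep that unfolding represents_def by blast
    then show ?thesis unfolding adj_def by - (rule someI_ex, blast)
  qed
  show "a \<in> V \<Longrightarrow> w \<in> V \<Longrightarrow> adj F p q a w \<in> V"
    and "a \<in> V \<Longrightarrow> w \<in> V \<Longrightarrow> u \<in> V \<Longrightarrow> \<omega> (adj F p q a w) u = \<omega> w (F p q a u)"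
    using * by auto
qed

lemma adjl_in: "a \<in> V \<Longrightarrow> w \<in> V \<Longrightarrow> adjl F p q a w \<in> V"
  and \<omega>_adjl: "a \<in> V \<Longrightarrow> w \<in> V \<Longrightarrow> u \<in> V \<Longrightarrow> \<omega> (adjl F p q a w) u = \<omega> w (F p q u a)"
proof -
  have *: "adjl F p q a w \<in> V \<and> (\<forall>u\<in>V. \<omega> w (F p q u a) = \<omega> (adjl F p q a w) u)"
    if "a \<in> V" "w \<in> V"
  proof -
    have "\<exists>w'\<in>V. \<forall>u\<in>V. \<omega> w (F p q u a) = \<omega> w' u"
      using rep that unfolding represents_def by blast
    then show ?thesis unfolding adjl_def by - (rule someI_ex, blast)
  qed
  show "a \<in> V \<Longrightarrow> w \<in> V \<Longrightarrow> adjl F p q a w \<in> V"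
    and "a \<in> V \<Longrightarrow> w \<in> V \<Longrightarrow> u \<in> V \<Longrightarrow> \<omega> (adjl F p q a w) u = \<omega> w (F p q u a)"
    using * by auto
qed

lemma peval_right:
  "a \<in> car Q \<Longrightarrow> b \<in> car Q \<Longrightarrow> w \<in> V \<Longrightarrow>
   peval (E x w) t (f a b) = E (x + t) (adj F (- t) (x + t) (ev (- t) a) w) b"
  by (simp add: represents_peval E_apply \<omega>_adj ev_in)

lemma peval_left:
  "a \<in> car Q \<Longrightarrow> b \<in> car Q \<Longrightarrow> w \<in> V \<Longrightarrow>
   peval (E x w) t (f a b) = E (- t) (adjl F (- t) (x + t) (ev (x + t) b) w) a"
  by (simp add: represents_peval E_apply \<omega>_adjl ev_in)

text \<open>Additivity and compatibility with \<open>\<partial>\<close> in each argument are inherited from the functionals \<open>E\<close>, of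
  which \<open>peval (E x w) t (f a b)\<close> is one in \<open>a\<close> as well as in \<open>b\<close> (\<open>peval_left\<close>, \<open>peval_right\<close>).\<close>

lemma represents_sesquilinear: "sesquilinear Q f"
proof -
  note s = represents_in car_zero car_add car_scl der_in car_minus
  have mp: "peval (E x w) t (map_poly (scl Q c) p) = c * peval (E x w) t p"
    "peval (E x w) t (map_poly (der Q) p) = x * peval (E x w) t p"
    if "w \<in> V" for x w t c p
    using that by (simp_all add: peval_map_poly scl_zero der_zero E_zero E_scl E_der peval_scale)
  have pc: "coeff (- pCons 0 p) k \<in> car Q" "coeff (pCons 0 p) k \<in> car Q" if "\<And>k. coeff p k \<in> car Q" for p k
    using that car_minus[of 0] car_zero car_minus by (auto simp: coeff_pCons split: nat.split)
  have p0: "peval (E x w) t (pCons 0 p) = t * peval (E x w) t p" if "w \<in> V" for x w t p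
    using that by (simp add: peval_pCons E_zero)
  show ?thesis
    unfolding sesquilinear_def
  proof (intro conjI ballI allI)
    fix a a' b assume a: "a \<in> car Q" "a' \<in> car Q" "b \<in> car Q"
    show "f (a + a') b = f a b + f a' b"
    proof (rule poly_car_eqI)
      fix x w t assume "w \<in> V"
      then show "peval (E x w) t (f (a + a') b) = peval (E x w) t (f a b + f a' b)"
        using a by (simp add: peval_add[OF additive_E] peval_left s E_add adjl_in ev_in)
    qed (use a s in auto)
    show "f b (a + a') = f b a + f b a'"
    proof (rule poly_car_eqI)
      fix x w t assume "w \<in> V"
      then show "peval (E x w) t (f b (a + a')) = peval (E x w) t (f b a + f b a')"
        using a by (simp add: peval_add[OF additive_E] peval_right s E_add adj_in ev_in)
    qed (use a s in auto)
  next
    fix c a b assume a: "a \<in> car Q" "b \<in> car Q"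
    show "f (scl Q c a) b = map_poly (scl Q c) (f a b)"
    proof (rule poly_car_eqI)
      fix x w t assume "w \<in> V"
      then show "peval (E x w) t (f (scl Q c a) b) = peval (E x w) t (map_poly (scl Q c) (f a b))"
        using a by (simp add: mp peval_left s E_scl adjl_in ev_in)
    qed (use a s in \<open>auto simp: coeff_map_poly scl_zero\<close>)
    show "f a (scl Q c b) = map_poly (scl Q c) (f a b)"
    proof (rule poly_car_eqI)
      fix x w t assume "w \<in> V"
      then show "peval (E x w) t (f a (scl Q c b)) = peval (E x w) t (map_poly (scl Q c) (f a b))"
        using a by (simp add: mp peval_right s E_scl adj_in ev_in)
    qed (use a s in \<open>auto simp: coeff_map_poly scl_zero\<close>)
  next
    fix a b assume a: "a \<in> car Q" "b \<in> car Q"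
    show "f (der Q a) b = - pCons 0 (f a b)"
    proof (rule poly_car_eqI)
      fix x w t assume w: "w \<in> V"
      then show "peval (E x w) t (f (der Q a) b) = peval (E x w) t (- pCons 0 (f a b))"
        using a by (simp add: peval_minus[OF additive_E] p0 peval_left s E_der adjl_in ev_in del: minus_pCons)
    qed (use a s in \<open>auto simp del: minus_pCons intro!: car_minus pc(2)\<close>)
    show "f a (der Q b) = map_poly (der Q) (f a b) + pCons 0 (f a b)"
    proof (rule poly_car_eqI)
      fix x w t assume w: "w \<in> V"
      then show "peval (E x w) t (f a (der Q b)) =
          peval (E x w) t (map_poly (der Q) (f a b) + pCons 0 (f a b))"
        using a by (simp add: peval_add[OF additive_E] p0 mp peval_right s E_der adj_in ev_in ring_distribs)
    qed (use a s in \<open>auto simp: coeff_map_poly der_zero intro!: pc car_add\<close>)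
  qed (use s in auto)
qed

lemma peval_skew_subst_represents:
  assumes "a \<in> car Q" "b \<in> car Q" "w \<in> V"
  shows "peval (E x w) t (skew_subst (der Q) (f b a)) =
    \<omega> w (F (x + t) (- t) (ev (x + t) b) (ev (- t) a))"
proof -
  have "peval (E x w) t (skew_subst (der Q) (f b a)) = peval (E x w) (- t - x) (f b a)"
    by (rule peval_skew_subst[where M = "car Q"])
      (use assms in \<open>auto simp: additive_E der_zero car_zero der_in car_minus car_add represents_in E_der\<close>)
  then show ?thesis using assms by (simp add: represents_peval algebra_simps)
qed

lemma skew_subst_in:
  "a \<in> car Q \<Longrightarrow> b \<in> car Q \<Longrightarrow> coeff (skew_subst (der Q) (f a b)) k \<in> car Q"
  by (rule skew_subst_closed) (auto simp: der_zero car_zero der_in car_minus car_add represents_in)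

end

abbreviation car2 :: "'q poly poly set" where
  "car2 \<equiv> {p. \<forall>j k. coeff (coeff p j) k \<in> car Q}"

lemma lam_op_car2: "p \<in> car2 \<Longrightarrow> lam_op p \<in> car2"
  by (auto simp: lam_op_def coeff_pCons car_zero split: nat.split)

lemma mu_op_car2: "p \<in> car2 \<Longrightarrow> mu_op p \<in> car2"
  by (auto simp: mu_op_def coeff_map_poly coeff_pCons car_zero split: nat.split)

lemma plus_car2: "p \<in> car2 \<Longrightarrow> q \<in> car2 \<Longrightarrow> p + q \<in> car2"
  by (auto intro: car_add)

lemma const_car2: "y \<in> car Q \<Longrightarrow> [:[:y:]:] \<in> car2"
  by (auto simp: coeff_pCons car_zero split: nat.split)

lemma zero_car2: "0 \<in> car2"
  by (auto simp: car_zero)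

context
  fixes f g :: "'q \<Rightarrow> 'q \<Rightarrow> 'q poly" and F G :: "'k \<Rightarrow> 'k \<Rightarrow> 'v \<Rightarrow> 'v \<Rightarrow> 'v"
  assumes f: "represents f F" and g: "represents g G"
begin

lemma nest_right_in:
  assumes "a \<in> car Q" "b \<in> car Q" "c \<in> car Q"
    and "\<And>p. p \<in> car2 \<Longrightarrow> S p \<in> car2" "\<And>p. p \<in> car2 \<Longrightarrow> T p \<in> car2"
  shows "nest_right f g S T a b c \<in> car2"
  unfolding nest_right_def
  by (intro lsubst_closed zero_car2 plus_car2 assms const_car2 represents_in[OF f] represents_in[OF g])

lemma nest_left_in:
  assumes "a \<in> car Q" "b \<in> car Q" "c \<in> car Q"
    and "\<And>p. p \<in> car2 \<Longrightarrow> S p \<in> car2" "\<And>p. p \<in> car2 \<Longrightarrow> T p \<in> car2"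
  shows "nest_left f g S T a b c \<in> car2"
  unfolding nest_left_def
  by (intro lsubst_closed zero_car2 plus_car2 assms const_car2 represents_in[OF f] represents_in[OF g])

text \<open>The inner product is evaluated through the functional that the outer one induces on its second
  argument; momenta add up: \<open>-t\<close> and \<open>x + s + t\<close> give \<open>x + s\<close>.\<close>

lemma peval_nest_right_represents:
  assumes abc: "a \<in> car Q" "b \<in> car Q" "c \<in> car Q" and w: "w \<in> V"
    and S: "\<And>p. peval (peval (E x w) m) l (S p) = s * peval (peval (E x w) m) l p"
    and T: "\<And>p. peval (peval (E x w) m) l (T p) = t * peval (peval (E x w) m) l p"
  shows "peval (peval (E x w) m) l (nest_right f g S T a b c) =
    \<omega> w (F (- s) (x + s) (ev (- s) a) (G (- t) (x + s + t) (ev (- t) b) (ev (x + s + t) c)))"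
proof -
  have "peval (peval (E x w) m) l (nest_right f g S T a b c) =
      peval (\<lambda>y. peval (E x w) s (f a y)) t (g b c)"
    by (rule peval_nest_right[OF additive_E[OF w] S T])
  also have "\<dots> = peval (E (x + s) (adj F (- s) (x + s) (ev (- s) a) w)) t (g b c)"
    by (rule peval_cong) (use abc w in \<open>simp add: peval_right[OF f] represents_in[OF g]\<close>)
  also have "\<dots> = \<omega> w (F (- s) (x + s) (ev (- s) a) (G (- t) (x + s + t) (ev (- t) b) (ev (x + s + t) c)))"
    using abc w by (simp add: represents_peval[OF g] adj_in[OF f] \<omega>_adj[OF f] ev_in represents_closed[OF g])
  finally show ?thesis .
qed

lemma peval_nest_left_represents:
  assumes abc: "a \<in> car Q" "b \<in> car Q" "c \<in> car Q" and w: "w \<in> V"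
    and S: "\<And>p. peval (peval (E x w) m) l (S p) = s * peval (peval (E x w) m) l p"
    and T: "\<And>p. peval (peval (E x w) m) l (T p) = t * peval (peval (E x w) m) l p"
  shows "peval (peval (E x w) m) l (nest_left f g S T a b c) =
    \<omega> w (F (- t) (x + t) (G (- s) (s - t) (ev (- s) a) (ev (s - t) b)) (ev (x + t) c))"
proof -
  have "peval (peval (E x w) m) l (nest_left f g S T a b c) =
      peval (\<lambda>y. peval (E x w) t (f y c)) s (g a b)"
    by (rule peval_nest_left[OF additive_E[OF w] S T])
  also have "\<dots> = peval (E (- t) (adjl F (- t) (x + t) (ev (x + t) c) w)) s (g a b)"
    by (rule peval_cong) (use abc w in \<open>simp add: peval_left[OF f] represents_in[OF g]\<close>)
  also have "\<dots> = \<omega> w (F (- t) (x + t) (G (- s) (s - t) (ev (- s) a) (ev (s - t) b)) (ev (x + t) c))"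
    using abc w by (simp add: represents_peval[OF g] adjl_in[OF f] \<omega>_adjl[OF f] ev_in represents_closed[OF g])
  finally show ?thesis .
qed

end

end


text \<open>The axioms are those of a Poisson algebra graded by the additive group of the field, stated after
  pairing with \<open>\<omega>\<close>, since this is the form in which evaluation produces and consumes them.\<close>

locale graded_poisson = momentum_space Q V ev \<omega>
  for Q :: "('k::field_char_0, 'q::ab_group_add) pc_alg"
    and V :: "'v::ab_group_add set" and ev \<omega> +
  fixes B M :: "'k \<Rightarrow> 'k \<Rightarrow> 'v \<Rightarrow> 'v \<Rightarrow> 'v"
  assumes rB: "represents (brk Q) B" and rM: "represents (mul Q) M"
    and B_skew: "a \<in> V \<Longrightarrow> b \<in> V \<Longrightarrow> w \<in> V \<Longrightarrow> \<omega> w (B p q a b) = - \<omega> w (B q p b a)"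
    and M_comm: "a \<in> V \<Longrightarrow> b \<in> V \<Longrightarrow> w \<in> V \<Longrightarrow> \<omega> w (M p q a b) = \<omega> w (M q p b a)"
    and B_jacobi: "a \<in> V \<Longrightarrow> b \<in> V \<Longrightarrow> c \<in> V \<Longrightarrow> w \<in> V \<Longrightarrow>
      \<omega> w (B p (q + r) a (B q r b c)) =
      \<omega> w (B (p + q) r (B p q a b) c) + \<omega> w (B q (p + r) b (B p r a c))"
    and M_assoc: "a \<in> V \<Longrightarrow> b \<in> V \<Longrightarrow> c \<in> V \<Longrightarrow> w \<in> V \<Longrightarrow>
      \<omega> w (M (p + q) r (M p q a b) c) = \<omega> w (M p (q + r) a (M q r b c))"
    and BM_leibniz: "a \<in> V \<Longrightarrow> b \<in> V \<Longrightarrow> c \<in> V \<Longrightarrow> w \<in> V \<Longrightarrow>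
      \<omega> w (B p (q + r) a (M q r b c)) =
      \<omega> w (M (p + q) r (B p q a b) c) + \<omega> w (M q (p + r) b (B p r a c))"
begin

text \<open>With \<open>p = -\<lambda>\<close>, \<open>q = -\<mu>\<close> and \<open>r = x + \<lambda> + \<mu>\<close> for the momenta of \<open>a\<close>, \<open>b\<close>, \<open>c\<close>, every axiom of a Poisson
  conformal algebra evaluates to the corresponding graded axiom.\<close>

theorem poisson_conformal: "poisson_conformal_algebra Q"
proof -
  note in2 = nest_right_in[OF rB rB] nest_left_in[OF rB rB] nest_left_in[OF rM rM]
    nest_right_in[OF rM rM] nest_right_in[OF rB rM] nest_left_in[OF rM rB] nest_right_in[OF rM rB]
  note ops = lam_op_car2 mu_op_car2 plus_car2
  have sum_op: "peval (peval (E x w) m) l (lam_op p + mu_op p) = (l + m) * peval (peval (E x w) m) l p"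
    if "w \<in> V" for x w m l p
    using that additive_peval2[OF additive_E[OF that]]
    by (simp add: additive.add lam_op_eigen mu_op_eigen additive_E ring_distribs)
  have eigen: "peval (peval (E x w) m) l (lam_op p) = l * peval (peval (E x w) m) l p"
    "peval (peval (E x w) m) l (mu_op p) = m * peval (peval (E x w) m) l p"
    if "w \<in> V" for x w m l p
    using that by (simp_all add: lam_op_eigen mu_op_eigen additive_E)
  note right = peval_nest_right_represents[OF _ _ _ _ _ _ eigen(1) eigen(2)]
    peval_nest_right_represents[OF _ _ _ _ _ _ eigen(2) eigen(1)]
  note left = peval_nest_left_represents[OF _ _ _ _ _ _ eigen(1) sum_op]
  have arith: "- m + (x + l + m) = x + l" "- l + (x + l + m) = x + m" "- l + - m = - (l + m)"
     "l - (l + m) = - m" for x l m :: 'k by simp_all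
  show ?thesis
    unfolding poisson_conformal_algebra_def
  proof (intro conjI ballI)
    fix a b assume ab: "a \<in> car Q" "b \<in> car Q"
    show "brk Q a b = - skew_subst (der Q) (brk Q b a)"
      by (rule poly_car_eqI)
        (use ab in \<open>auto simp: represents_in[OF rB] skew_subst_in[OF rB] car_minus
          peval_minus[OF additive_E] peval_skew_subst_represents[OF rB] represents_peval[OF rB]
          intro!: B_skew ev_in\<close>)
    show "mul Q a b = skew_subst (der Q) (mul Q b a)"
      by (rule poly_car_eqI)
        (use ab in \<open>auto simp: represents_in[OF rM] skew_subst_in[OF rM] car_minus
          peval_skew_subst_represents[OF rM] represents_peval[OF rM]
          intro!: M_comm ev_in\<close>)
  next
    fix a b c assume abc: "a \<in> car Q" "b \<in> car Q" "c \<in> car Q"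
    have inc: "coeff (coeff p j) k \<in> car Q" if "p \<in> car2" for p j k using that by auto
    show "nest_right (brk Q) (brk Q) lam_op mu_op a b c =
        nest_left (brk Q) (brk Q) lam_op (\<lambda>p. lam_op p + mu_op p) a b c +
        nest_right (brk Q) (brk Q) mu_op lam_op b a c"
    proof (rule poly_poly_car_eqI; (intro inc plus_car2 in2 ops abc; assumption)?)
      fix x w m l assume w: "w \<in> V"
      note ad = additive_peval2[OF additive_E[OF w]]
      show "peval (peval (E x w) m) l (nest_right (brk Q) (brk Q) lam_op mu_op a b c) =
        peval (peval (E x w) m) l (nest_left (brk Q) (brk Q) lam_op (\<lambda>p. lam_op p + mu_op p) a b c +
          nest_right (brk Q) (brk Q) mu_op lam_op b a c)"
        using B_jacobi[OF ev_in[OF abc(1)] ev_in[OF abc(2)] ev_in[OF abc(3)] w,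
            of "- l" "- m" "x + l + m" "- l" "- m" "x + l + m"]
        by (simp add: additive.add[OF ad] right[OF rB rB] left[OF rB rB] abc w arith)
          (simp add: algebra_simps)
    qed
    show "nest_left (mul Q) (mul Q) lam_op (\<lambda>p. lam_op p + mu_op p) a b c =
        nest_right (mul Q) (mul Q) lam_op mu_op a b c"
    proof (rule poly_poly_car_eqI; (intro inc plus_car2 in2 ops abc; assumption)?)
      fix x w m l assume w: "w \<in> V"
      note ad = additive_peval2[OF additive_E[OF w]]
      show "peval (peval (E x w) m) l (nest_left (mul Q) (mul Q) lam_op (\<lambda>p. lam_op p + mu_op p) a b c) =
        peval (peval (E x w) m) l (nest_right (mul Q) (mul Q) lam_op mu_op a b c)"
        using M_assoc[OF ev_in[OF abc(1)] ev_in[OF abc(2)] ev_in[OF abc(3)] w,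
            of "- l" "- m" "x + l + m" "- l" "- m" "x + l + m"]
        by (simp add: additive.add[OF ad] right[OF rM rM] left[OF rM rM] abc w arith)
          (simp add: algebra_simps)
    qed
    show "nest_right (brk Q) (mul Q) lam_op mu_op a b c =
        nest_left (mul Q) (brk Q) lam_op (\<lambda>p. lam_op p + mu_op p) a b c +
        nest_right (mul Q) (brk Q) mu_op lam_op b a c"
    proof (rule poly_poly_car_eqI; (intro inc plus_car2 in2 ops abc; assumption)?)
      fix x w m l assume w: "w \<in> V"
      note ad = additive_peval2[OF additive_E[OF w]]
      show "peval (peval (E x w) m) l (nest_right (brk Q) (mul Q) lam_op mu_op a b c) =
        peval (peval (E x w) m) l (nest_left (mul Q) (brk Q) lam_op (\<lambda>p. lam_op p + mu_op p) a b c +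
          nest_right (mul Q) (brk Q) mu_op lam_op b a c)"
        using BM_leibniz[OF ev_in[OF abc(1)] ev_in[OF abc(2)] ev_in[OF abc(3)] w,
            of "- l" "- m" "x + l + m" "- l" "- m" "x + l + m"]
        by (simp add: additive.add[OF ad] right[OF rB rM] right[OF rM rB] left[OF rM rB] abc w arith)
          (simp add: algebra_simps)
    qed
  qed (use kd represents_sesquilinear[OF rB] represents_sesquilinear[OF rM] in auto)
qed

end

section \<open>Tensor operations in momentum space\<close>

context momentum_space
begin

lemma tens2_E: "w \<in> V \<Longrightarrow> v \<in> V \<Longrightarrow> tens2 Q a b (E x w) (E y v) = E x w a * E y v b"
  by (simp add: tens2_apply E_dual)

lemma tens3_E: "w \<in> V \<Longrightarrow> v \<in> V \<Longrightarrow> u \<in> V \<Longrightarrow>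
    tens3 Q a b c (E x w) (E y v) (E z u) = E x w a * E y v b * E z u c"
  by (simp add: tens3_apply E_dual)

lemma flip2_in: "X \<in> Tens2 Q \<Longrightarrow> flip2 Q X \<in> Tens2 Q"
  unfolding flip2_def by (rule lift2_closed) (auto intro: Tens2_add Tens2_tens2)

lemma flip2_E:
  assumes "X \<in> Tens2 Q" "w \<in> V" "v \<in> V"
  shows "flip2 Q X (E x w) (E y v) = X (E y v) (E x w)"
  unfolding flip2_def
  by (rule lift2_eval[where \<Phi> = "\<lambda>Y. Y (E x w) (E y v)", OF assms(1) additive_ev2 additive_ev2])
     (use assms in \<open>simp add: tens2_E\<close>)

lemma flip12_in: "X \<in> Tens3 Q \<Longrightarrow> flip12 Q X \<in> Tens3 Q"
  unfolding flip12_def by (rule lift3_closed) (auto intro: Tens3_add Tens3_tens3)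

lemma flip12_E:
  assumes "X \<in> Tens3 Q" "w \<in> V" "v \<in> V" "u \<in> V"
  shows "flip12 Q X (E x w) (E y v) (E z u) = X (E y v) (E x w) (E z u)"
  unfolding flip12_def
  by (rule lift3_eval[where \<Phi> = "\<lambda>Y. Y (E x w) (E y v) (E z u)", OF assms(1) additive_ev3 additive_ev3])
     (use assms in \<open>simp add: tens3_E\<close>)

lemma der2_in: "X \<in> Tens2 Q \<Longrightarrow> der2 Q X \<in> Tens2 Q"
  unfolding der2_def by (rule lift2_closed) (auto intro: Tens2_add Tens2_tens2 der_in)

lemma der2_E:
  assumes "X \<in> Tens2 Q" "w \<in> V" "v \<in> V"
  shows "der2 Q X (E x w) (E y v) = (x + y) * X (E x w) (E y v)"
  unfolding der2_def
  by (rule lift2_eval[where \<Phi> = "\<lambda>Y. Y (E x w) (E y v)"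
        and \<Psi> = "\<lambda>Y. (x + y) * Y (E x w) (E y v)", OF assms(1) additive_ev2 additive_cmult[OF additive_ev2]])
     (use assms in \<open>simp add: tens2_E E_der algebra_simps\<close>)

lemma der2_zero: "der2 Q 0 = 0"
  by (rule Tens2_eqI) (auto simp: der2_in der2_E)

lemma der3_in:
  "X \<in> Tens3 Q \<Longrightarrow> der3_1 Q X \<in> Tens3 Q" "X \<in> Tens3 Q \<Longrightarrow> der3_2 Q X \<in> Tens3 Q"
  "X \<in> Tens3 Q \<Longrightarrow> der3_3 Q X \<in> Tens3 Q"
  unfolding der3_1_def der3_2_def der3_3_def
  by (rule lift3_closed; auto intro: Tens3_add Tens3_tens3 der_in)+

lemma der3_E:
  assumes "X \<in> Tens3 Q" "w \<in> V" "v \<in> V" "u \<in> V"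
  shows "der3_1 Q X (E x w) (E y v) (E z u) = x * X (E x w) (E y v) (E z u)"
    "der3_2 Q X (E x w) (E y v) (E z u) = y * X (E x w) (E y v) (E z u)"
    "der3_3 Q X (E x w) (E y v) (E z u) = z * X (E x w) (E y v) (E z u)"
  unfolding der3_1_def der3_2_def der3_3_def
  by (rule lift3_eval[where \<Phi> = "\<lambda>Y. Y (E x w) (E y v) (E z u)"];
      use assms in \<open>simp add: tens3_E E_der additive_ev3 additive_cmult[OF additive_ev3]\<close>)+

lemma der3_total_in: "X \<in> Tens3 Q \<Longrightarrow> der3 Q X \<in> Tens3 Q"
  unfolding der3_def by (intro Tens3_add der3_in)

lemma der3_total_E:
  "X \<in> Tens3 Q \<Longrightarrow> w \<in> V \<Longrightarrow> v \<in> V \<Longrightarrow> u \<in> V \<Longrightarrow>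
   der3 Q X (E x w) (E y v) (E z u) = (x + y + z) * X (E x w) (E y v) (E z u)"
  by (simp add: der3_def der3_E algebra_simps)

text \<open>Under \<open>\<Phi>\<close> the operator \<open>S\<close> becomes the scalar \<open>t\<close>, and \<open>E x w\<close> composed with the action of \<open>a\<close> at
  parameter \<open>t\<close> is a functional of the same kind at momentum \<open>x + t\<close>.  All substitutions of
  operators that occur in \<open>\<delta>\<close>, \<open>\<Delta>\<close> and in the compatibility conditions are instances of this
  or of its mirror image \<open>on_snd_eval\<close>.\<close>

lemma on_fst_eval:
  assumes f: "represents f F" and a: "a \<in> car Q" and X: "X \<in> Tens2 Q" and \<Phi>: "additive \<Phi>"
    and S: "\<And>m. m \<in> M \<Longrightarrow> S m \<in> M" "\<And>m. m \<in> M \<Longrightarrow> \<Phi> (S m) = t * \<Phi> m"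
    and \<iota>: "\<And>Y. Y \<in> Tens2 Q \<Longrightarrow> \<iota> Y \<in> M" "\<And>Y. Y \<in> Tens2 Q \<Longrightarrow> \<Phi> (\<iota> Y) = Y (E x w) (E y v)"
    and wv: "w \<in> V" "v \<in> V"
  shows "\<Phi> (on_fst Q \<iota> S (f a) X) = X (E (x + t) (adj F (- t) (x + t) (ev (- t) a) w)) (E y v)"
  unfolding on_fst_def
proof (rule lift2_eval[OF X \<Phi> additive_ev2])
  fix b c assume bc: "b \<in> car Q" "c \<in> car Q"
  note in_car = represents_in[OF f a bc(1)]
  have "\<Phi> (lsubst S (\<lambda>q. \<iota> (tens2 Q q c)) (f a b)) = peval (\<lambda>q. \<Phi> (\<iota> (tens2 Q q c))) t (f a b)"
    by (rule lsubst_eigen[where M = M, OF \<Phi> S]) (auto intro!: \<iota> Tens2_tens2 in_car bc)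
  also have "\<dots> = peval (\<lambda>q. E y v c * E x w q) t (f a b)"
    by (rule peval_cong) (simp add: \<iota> Tens2_tens2 in_car bc tens2_E wv)
  also have "\<dots> = tens2 Q b c (E (x + t) (adj F (- t) (x + t) (ev (- t) a) w)) (E y v)"
    using a bc wv by (simp add: peval_scale peval_right[OF f] tens2_E adj_in[OF f] ev_in)
  finally show "\<Phi> (lsubst S (\<lambda>q. \<iota> (tens2 Q q c)) (f a b)) = \<dots>" .
qed

lemma on_snd_eval:
  assumes f: "represents f F" and a: "a \<in> car Q" and X: "X \<in> Tens2 Q" and \<Phi>: "additive \<Phi>"
    and S: "\<And>m. m \<in> M \<Longrightarrow> S m \<in> M" "\<And>m. m \<in> M \<Longrightarrow> \<Phi> (S m) = t * \<Phi> m"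
    and \<iota>: "\<And>Y. Y \<in> Tens2 Q \<Longrightarrow> \<iota> Y \<in> M" "\<And>Y. Y \<in> Tens2 Q \<Longrightarrow> \<Phi> (\<iota> Y) = Y (E x w) (E y v)"
    and wv: "w \<in> V" "v \<in> V"
  shows "\<Phi> (on_snd Q \<iota> S (f a) X) = X (E x w) (E (y + t) (adj F (- t) (y + t) (ev (- t) a) v))"
  unfolding on_snd_def
proof (rule lift2_eval[OF X \<Phi> additive_ev2])
  fix b c assume bc: "b \<in> car Q" "c \<in> car Q"
  note in_car = represents_in[OF f a bc(2)]
  have "\<Phi> (lsubst S (\<lambda>q. \<iota> (tens2 Q b q)) (f a c)) = peval (\<lambda>q. \<Phi> (\<iota> (tens2 Q b q))) t (f a c)"
    by (rule lsubst_eigen[where M = M, OF \<Phi> S]) (auto intro!: \<iota> Tens2_tens2 in_car bc)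
  also have "\<dots> = peval (\<lambda>q. E x w b * E y v q) t (f a c)"
    by (rule peval_cong) (simp add: \<iota> Tens2_tens2 in_car bc tens2_E wv)
  also have "\<dots> = tens2 Q b c (E x w) (E (y + t) (adj F (- t) (y + t) (ev (- t) a) v))"
    using a bc wv by (simp add: peval_scale peval_right[OF f] tens2_E adj_in[OF f] ev_in)
  finally show "\<Phi> (lsubst S (\<lambda>q. \<iota> (tens2 Q b q)) (f a c)) = \<dots>" .
qed

lemma on_fst_closed:
  assumes f: "represents f F" and a: "a \<in> car Q" and X: "X \<in> Tens2 Q"
    and M: "0 \<in> M" "\<And>x y. x \<in> M \<Longrightarrow> y \<in> M \<Longrightarrow> x + y \<in> M"
    and S: "\<And>m. m \<in> M \<Longrightarrow> S m \<in> M" and \<iota>: "\<And>Y. Y \<in> Tens2 Q \<Longrightarrow> \<iota> Y \<in> M"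
  shows "on_fst Q \<iota> S (f a) X \<in> M" "on_snd Q \<iota> S (f a) X \<in> M"
  unfolding on_fst_def on_snd_def
  by (intro lift2_closed[OF X] lsubst_closed M S \<iota> Tens2_tens2 represents_in[OF f] a; assumption)+

abbreviation Tens2_poly where "Tens2_poly \<equiv> {p. \<forall>k. coeff p k \<in> Tens2 Q}"

lemma Tens2_poly_ops:
  "0 \<in> Tens2_poly" "p \<in> Tens2_poly \<Longrightarrow> q \<in> Tens2_poly \<Longrightarrow> p + q \<in> Tens2_poly"
  "p \<in> Tens2_poly \<Longrightarrow> pCons 0 p \<in> Tens2_poly"
  "p \<in> Tens2_poly \<Longrightarrow> neg_lam_der (der2 Q) p \<in> Tens2_poly"
  "Y \<in> Tens2 Q \<Longrightarrow> [:Y:] \<in> Tens2_poly"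
  by (auto simp: Tens2_add coeff_pCons der2_zero der2_in Tens2_minus[OF kd]
      intro!: neg_lam_der_closed split: nat.split)

lemma lam_in:
  assumes "represents f F" "a \<in> car Q" "X \<in> Tens2 Q"
  shows "coeff (fst_lam Q (f a) X) k \<in> Tens2 Q" "coeff (snd_lam Q (f a) X) k \<in> Tens2 Q"
    "coeff (fst_opp Q (f a) X) k \<in> Tens2 Q" "coeff (snd_opp Q (f a) X) k \<in> Tens2 Q"
proof -
  have *: "coeff p k \<in> Tens2 Q" if "p \<in> Tens2_poly" for p using that by simp
  show "coeff (fst_lam Q (f a) X) k \<in> Tens2 Q" "coeff (snd_lam Q (f a) X) k \<in> Tens2 Q"
    "coeff (fst_opp Q (f a) X) k \<in> Tens2 Q" "coeff (snd_opp Q (f a) X) k \<in> Tens2 Q"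
    unfolding fst_lam_def snd_lam_def fst_opp_def snd_opp_def
    by (intro * on_fst_closed[OF assms] Tens2_poly_ops; assumption)+
qed

context
  fixes f :: "'q \<Rightarrow> 'q \<Rightarrow> 'q poly" and F :: "'k \<Rightarrow> 'k \<Rightarrow> 'v \<Rightarrow> 'v \<Rightarrow> 'v"
    and a :: 'q and X :: "('k, 'q) tensor2" and x y t :: 'k and w v :: 'v
  assumes f: "represents f F" and a: "a \<in> car Q" and X: "X \<in> Tens2 Q" and wv: "w \<in> V" "v \<in> V"
begin

lemma fst_lam_E:
  "peval (\<lambda>Y. Y (E x w) (E y v)) t (fst_lam Q (f a) X) =
   X (E (x + t) (adj F (- t) (x + t) (ev (- t) a) w)) (E y v)"
  unfolding fst_lam_def
  by (rule on_fst_eval[where M = UNIV, OF f a X additive_peval[OF additive_ev2]])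
     (use wv in \<open>auto simp: peval_pCons\<close>)

lemma snd_lam_E:
  "peval (\<lambda>Y. Y (E x w) (E y v)) t (snd_lam Q (f a) X) =
   X (E x w) (E (y + t) (adj F (- t) (y + t) (ev (- t) a) v))"
  unfolding snd_lam_def
  by (rule on_snd_eval[where M = UNIV, OF f a X additive_peval[OF additive_ev2]])
     (use wv in \<open>auto simp: peval_pCons\<close>)

lemma neg_lam_der2_E:
  assumes "p \<in> Tens2_poly"
  shows "peval (\<lambda>Y. Y (E x w) (E y v)) t (neg_lam_der (der2 Q) p) =
    (- (x + y + t)) * peval (\<lambda>Y. Y (E x w) (E y v)) t p"
proof -
  have "peval (\<lambda>Y. Y (E x w) (E y v)) t (neg_lam_der (der2 Q) p) =
      (- t - (x + y)) * peval (\<lambda>Y. Y (E x w) (E y v)) t p"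
    by (rule peval_neg_lam_der[OF additive_ev2]) (use assms wv in \<open>auto simp: der2_zero der2_E\<close>)
  then show ?thesis by (simp add: algebra_simps)
qed

lemma fst_opp_E:
  "peval (\<lambda>Y. Y (E x w) (E y v)) t (fst_opp Q (f a) X) =
   X (E (- y - t) (adj F (x + y + t) (- y - t) (ev (x + y + t) a) w)) (E y v)"
proof -
  have "peval (\<lambda>Y. Y (E x w) (E y v)) t (fst_opp Q (f a) X) =
    X (E (x + (- (x + y + t))) (adj F (- (- (x + y + t))) (x + (- (x + y + t)))
      (ev (- (- (x + y + t))) a) w)) (E y v)"
    unfolding fst_opp_def
    by (rule on_fst_eval[where M = Tens2_poly, OF f a X additive_peval[OF additive_ev2]
          Tens2_poly_ops(4) neg_lam_der2_E Tens2_poly_ops(5)]) (use wv in auto)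
  moreover have "x + - (x + y + t) = - y - t" by simp
  ultimately show ?thesis by (simp only: minus_minus)
qed

lemma snd_opp_E:
  "peval (\<lambda>Y. Y (E x w) (E y v)) t (snd_opp Q (f a) X) =
   X (E x w) (E (- x - t) (adj F (x + y + t) (- x - t) (ev (x + y + t) a) v))"
proof -
  have "peval (\<lambda>Y. Y (E x w) (E y v)) t (snd_opp Q (f a) X) =
    X (E x w) (E (y + (- (x + y + t))) (adj F (- (- (x + y + t))) (y + (- (x + y + t)))
      (ev (- (- (x + y + t))) a) v))"
    unfolding snd_opp_def
    by (rule on_snd_eval[where M = Tens2_poly, OF f a X additive_peval[OF additive_ev2]
          Tens2_poly_ops(4) neg_lam_der2_E Tens2_poly_ops(5)]) (use wv in auto)
  moreover have "y + - (x + y + t) = - x - t" by simp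
  ultimately show ?thesis by (simp only: minus_minus)
qed

lemma on_fst_der2_E:
  "on_fst Q (\<lambda>Y. Y) (\<lambda>Y. - der2 Q Y) (f a) X (E x w) (E y v) =
   X (E (- y) (adj F (x + y) (- y) (ev (x + y) a) w)) (E y v)"
  using on_fst_eval[where \<Phi> = "\<lambda>Y. Y (E x w) (E y v)" and M = "Tens2 Q" and t = "- (x + y)"
      and \<iota> = "\<lambda>Y. Y" and S = "\<lambda>Y. - der2 Q Y", OF f a X additive_ev2] wv
  by (simp add: der2_in Tens2_minus[OF kd] der2_E algebra_simps)

lemma on_snd_der2_E:
  "on_snd Q (\<lambda>Y. Y) (\<lambda>Y. - der2 Q Y) (f a) X (E x w) (E y v) =
   X (E x w) (E (- x) (adj F (x + y) (- x) (ev (x + y) a) v))"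
  using on_snd_eval[where \<Phi> = "\<lambda>Y. Y (E x w) (E y v)" and M = "Tens2 Q" and t = "- (x + y)"
      and \<iota> = "\<lambda>Y. Y" and S = "\<lambda>Y. - der2 Q Y", OF f a X additive_ev2] wv
  by (simp add: der2_in Tens2_minus[OF kd] der2_E algebra_simps)

end

lemma on_der2_in:
  assumes "represents f F" "a \<in> car Q" "X \<in> Tens2 Q"
  shows "on_fst Q (\<lambda>Y. Y) (\<lambda>Y. - der2 Q Y) (f a) X \<in> Tens2 Q"
    "on_snd Q (\<lambda>Y. Y) (\<lambda>Y. - der2 Q Y) (f a) X \<in> Tens2 Q"
  by (intro on_fst_closed[OF assms] Tens2_zero Tens2_add Tens2_minus[OF kd] der2_in; assumption)+

text \<open>Both sides are, up to sign, the pairing of the two transposed vectors \<open>adj F p s' a w\<close> and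
  \<open>adj G q s b v\<close>.  This cancels, in every compatibility condition, the terms in which \<open>a\<close> acts on one leg
  and \<open>b\<close> on the other.\<close>

lemma cross:
  assumes f: "represents f F" and g: "represents g G"
    and "a \<in> V" "b \<in> V" "w \<in> V" "v \<in> V"
  shows "\<omega> v (G q s b (adj F p s' a w)) = - \<omega> w (F p s' a (adj G q s b v))"
  using assms \<omega>_skew[of "adj G q s b v" "adj F p s' a w"]
  by (simp add: adj_in[OF f] adj_in[OF g] flip: \<omega>_adj[OF f] \<omega>_adj[OF g])

lemma co_fst_in:
  assumes "X \<in> Tens2 Q" "\<And>u. u \<in> car Q \<Longrightarrow> \<delta> u \<in> Tens2 Q"
  shows "co_fst Q \<delta> X \<in> Tens3 Q" "co_snd Q \<delta> X \<in> Tens3 Q"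
  unfolding co_fst_def co_snd_def
  by (intro lift2_closed[OF assms(1)] lift2_closed[OF assms(2)] Tens3_zero Tens3_add Tens3_tens3;
      assumption)+

text \<open>A cobracket dual to the product \<open>K\<close>, when the vectors \<open>w\<close> and \<open>v\<close> are identified with the functionals \<open>E x w\<close>
  and \<open>E y v\<close>.  Such functionals pair with momenta \<open>x\<close> and \<open>y\<close>, so as elements of the graded
  algebra \<open>w\<close> and \<open>v\<close> have momenta \<open>-x\<close> and \<open>-y\<close>.  The sign turns \<open>\<omega> (K w v)\<close> into the pairing of \<open>u\<close> with \<open>K w v\<close>.\<close>

definition cobracket_of_product ::
  "('q \<Rightarrow> ('k, 'q) tensor2) \<Rightarrow> ('k \<Rightarrow> 'k \<Rightarrow> 'v \<Rightarrow> 'v \<Rightarrow> 'v) \<Rightarrow> bool" where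
  "cobracket_of_product \<delta> K \<longleftrightarrow>
     (\<forall>u\<in>car Q. \<delta> u \<in> Tens2 Q \<and> (\<forall>x y. \<forall>w\<in>V. \<forall>v\<in>V.
        \<delta> u (E x w) (E y v) = - E (x + y) (K (- x) (- y) w v) u)) \<and>
     (\<forall>p q. \<forall>w\<in>V. \<forall>v\<in>V. K p q w v \<in> V)"

context
  fixes \<delta> :: "'q \<Rightarrow> ('k, 'q) tensor2" and K :: "'k \<Rightarrow> 'k \<Rightarrow> 'v \<Rightarrow> 'v \<Rightarrow> 'v"
  assumes \<delta>K: "cobracket_of_product \<delta> K"
begin

private lemma \<delta>: "u \<in> car Q \<Longrightarrow> \<delta> u \<in> Tens2 Q"
  and \<delta>_E: "u \<in> car Q \<Longrightarrow> w \<in> V \<Longrightarrow> v \<in> V \<Longrightarrow>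
    \<delta> u (E x w) (E y v) = - E (x + y) (K (- x) (- y) w v) u"
  and K: "w \<in> V \<Longrightarrow> v \<in> V \<Longrightarrow> K p q w v \<in> V"
  using \<delta>K by (auto simp: cobracket_of_product_def)

lemma co_fst_E:
  assumes X: "X \<in> Tens2 Q" and "w \<in> V" "v \<in> V" "u \<in> V"
  shows "co_fst Q \<delta> X (E x w) (E y v) (E z u) = - X (E (x + y) (K (- x) (- y) w v)) (E z u)"
  unfolding co_fst_def
proof (rule lift2_eval[where \<Phi> = "\<lambda>Y. Y (E x w) (E y v) (E z u)", OF X additive_ev3
      additive_uminus[OF additive_ev2]])
  fix b c assume bc: "b \<in> car Q" "c \<in> car Q"
  have "lift2 Q (\<lambda>x y. tens3 Q x y c) (\<delta> b) (E x w) (E y v) (E z u) =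
      E z u c * \<delta> b (E x w) (E y v)"
    by (rule lift2_eval[where \<Phi> = "\<lambda>Y. Y (E x w) (E y v) (E z u)"
        and \<Psi> = "\<lambda>Y. E z u c * Y (E x w) (E y v)", OF \<delta>[OF bc(1)] additive_ev3
        additive_cmult[OF additive_ev2]]) (use assms in \<open>simp add: tens3_E tens2_E\<close>)
  then show "lift2 Q (\<lambda>x y. tens3 Q x y c) (\<delta> b) (E x w) (E y v) (E z u) =
      - tens2 Q b c (E (x + y) (K (- x) (- y) w v)) (E z u)"
    using assms bc by (simp add: tens2_E \<delta>_E K)
qed

lemma co_snd_E:
  assumes X: "X \<in> Tens2 Q" and "w \<in> V" "v \<in> V" "u \<in> V"
  shows "co_snd Q \<delta> X (E x w) (E y v) (E z u) = - X (E x w) (E (y + z) (K (- y) (- z) v u))"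
  unfolding co_snd_def
proof (rule lift2_eval[where \<Phi> = "\<lambda>Y. Y (E x w) (E y v) (E z u)", OF X additive_ev3
      additive_uminus[OF additive_ev2]])
  fix b c assume bc: "b \<in> car Q" "c \<in> car Q"
  have "lift2 Q (\<lambda>x y. tens3 Q b x y) (\<delta> c) (E x w) (E y v) (E z u) =
      E x w b * \<delta> c (E y v) (E z u)"
    by (rule lift2_eval[where \<Phi> = "\<lambda>Y. Y (E x w) (E y v) (E z u)"
        and \<Psi> = "\<lambda>Y. E x w b * Y (E y v) (E z u)", OF \<delta>[OF bc(2)] additive_ev3
        additive_cmult[OF additive_ev2]]) (use assms in \<open>simp add: tens3_E tens2_E\<close>)
  then show "lift2 Q (\<lambda>x y. tens3 Q b x y) (\<delta> c) (E x w) (E y v) (E z u) =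
      - tens2 Q b c (E x w) (E (y + z) (K (- y) (- z) v u))"
    using assms bc by (simp add: tens2_E \<delta>_E K)
qed

lemma kd_hom2_of_product: "kd_hom2 Q \<delta>"
  unfolding kd_hom2_def
proof (intro conjI ballI allI)
  fix a b assume ab: "a \<in> car Q" "b \<in> car Q"
  show "\<delta> (a + b) = \<delta> a + \<delta> b"
    by (rule Tens2_eqI) (use ab in \<open>auto simp: \<delta> Tens2_add car_add \<delta>_E K E_add\<close>)
next
  fix c a assume a: "a \<in> car Q"
  show "\<delta> (scl Q c a) = (\<lambda>f g. c * \<delta> a f g)"
    by (rule Tens2_eqI) (use a in \<open>auto simp: \<delta> Tens2_scale[OF kd] car_scl \<delta>_E K E_scl\<close>)
next
  fix a assume a: "a \<in> car Q"
  show "\<delta> (der Q a) = der2 Q (\<delta> a)"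
    by (rule Tens2_eqI) (use a in \<open>auto simp: \<delta> der2_in der_in \<delta>_E K E_der der2_E\<close>)
qed (use \<delta> in auto)

end


lemma map_poly_Tens2:
  assumes "\<And>u. u \<in> car Q \<Longrightarrow> \<kappa> u \<in> Tens2 Q" and "\<And>k. coeff p k \<in> car Q"
  shows "coeff (map_poly \<kappa> p) n \<in> Tens2 Q"
proof -
  have "set (coeffs p) \<subseteq> car Q" using assms(2) by (auto simp: coeffs_def)
  then show ?thesis
    by (auto simp: map_poly_def nth_default_def intro!: assms(1))
qed

text \<open>The value of a coboundary \<open>a \<cdot> \<rho>\<close>, where \<open>\<rho>(E x w, E y v) = \<omega> w v\<close>.  The constant \<open>c\<close> distinguishes the skew
  cobracket (\<open>c = 1\<close>) from the symmetric coproduct (\<open>c = -1\<close>), so that both can be treated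
  together.\<close>

definition coboundary_form ::
  "('q \<Rightarrow> ('k, 'q) tensor2) \<Rightarrow> ('k \<Rightarrow> 'k \<Rightarrow> 'v \<Rightarrow> 'v \<Rightarrow> 'v) \<Rightarrow> 'k \<Rightarrow> bool" where
  "coboundary_form \<kappa> K c \<longleftrightarrow>
     (\<forall>a\<in>car Q. \<kappa> a \<in> Tens2 Q \<and> (\<forall>x y. \<forall>w\<in>V. \<forall>v\<in>V. \<kappa> a (E x w) (E y v) =
        c * \<omega> w (K (x + y) (- y) (ev (x + y) a) v) - \<omega> v (K (x + y) (- x) (ev (x + y) a) w)))"

context
  fixes \<kappa> :: "'q \<Rightarrow> ('k, 'q) tensor2" and f k :: "'q \<Rightarrow> 'q \<Rightarrow> 'q poly" and a b :: 'q
    and F K :: "'k \<Rightarrow> 'k \<Rightarrow> 'v \<Rightarrow> 'v \<Rightarrow> 'v" and c x y t :: 'k and w v :: 'v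
  assumes k: "represents k K" and f: "represents f F" and \<kappa>K: "coboundary_form \<kappa> K c"
    and ab: "a \<in> car Q" "b \<in> car Q" and wv: "w \<in> V" "v \<in> V"
begin

private lemma \<kappa>: "q \<in> car Q \<Longrightarrow> \<kappa> q \<in> Tens2 Q"
  and \<kappa>_E: "q \<in> car Q \<Longrightarrow> w' \<in> V \<Longrightarrow> v' \<in> V \<Longrightarrow> \<kappa> q (E x' w') (E y' v') =
    c * \<omega> w' (K (x' + y') (- y') (ev (x' + y') q) v') - \<omega> v' (K (x' + y') (- x') (ev (x' + y') q) w')"
  using \<kappa>K by (auto simp: coboundary_form_def)

text \<open>The five terms that occur in the compatibility conditions, expressed by the values \<open>a'\<close> and \<open>b'\<close> of \<open>a\<close>
  and \<open>b\<close> at the momenta \<open>-t\<close> and \<open>x + y + t\<close>.\<close>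

private abbreviation "a' \<equiv> ev (- t) a"
private abbreviation "b' \<equiv> ev (x + y + t) b"

lemma peval_map_coboundary:
  "peval (\<lambda>X. X (E x w) (E y v)) t (map_poly \<kappa> (f a b)) =
   c * \<omega> w (K (x + y) (- y) (F (- t) (x + y + t) a' b') v)
   - \<omega> v (K (x + y) (- x) (F (- t) (x + y + t) a' b') w)"
proof -
  have \<kappa>0: "\<kappa> 0 = 0"
  proof (rule Tens2_eqI)
    fix x w y v assume wv: "w \<in> V" "v \<in> V"
    then have "\<kappa> 0 (E x w) (E y v) = c * E (x + y) (adjl K (x + y) (- y) v w) 0
        - E (x + y) (adjl K (x + y) (- x) w v) 0"
      by (simp add: \<kappa>_E car_zero E_apply \<omega>_adjl[OF k] ev_in)
    then show "\<kappa> 0 (E x w) (E y v) = 0 (E x w) (E y v)"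
      using wv by (simp add: E_zero adjl_in[OF k])
  qed (auto simp: \<kappa> car_zero)
  have "peval (\<lambda>X. X (E x w) (E y v)) t (map_poly \<kappa> (f a b)) =
      peval (\<lambda>q. \<kappa> q (E x w) (E y v)) t (f a b)"
    by (rule peval_map_poly) (simp_all add: \<kappa>0)
  also have "\<dots> = peval (\<lambda>q. c * E (x + y) (adjl K (x + y) (- y) v w) q
      - E (x + y) (adjl K (x + y) (- x) w v) q) t (f a b)"
    by (rule peval_cong)
      (use ab wv in \<open>simp add: \<kappa>_E represents_in[OF f] E_apply \<omega>_adjl[OF k] ev_in\<close>)
  finally show ?thesis
    using ab wv by (simp add: peval_diff_fun peval_scale represents_peval[OF f] adjl_in[OF k]
        \<omega>_adjl[OF k] represents_closed[OF f] ev_in)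
qed

lemma fst_lam_coboundary:
  "peval (\<lambda>X. X (E x w) (E y v)) t (fst_lam Q (f a) (\<kappa> b)) =
   c * \<omega> w (F (- t) (x + t) a' (K (x + y + t) (- y) b' v))
   - \<omega> v (K (x + y + t) (- x - t) b' (adj F (- t) (x + t) a' w))"
proof -
  have eqs: "x + t + y = x + y + t" "- (x + t) = - x - t" by simp_all
  show ?thesis
    using ab wv by (simp add: eqs fst_lam_E[OF f] \<kappa> \<kappa>_E adj_in[OF f] ev_in \<omega>_adj[OF f]
        represents_closed[OF k])
qed

lemma snd_lam_coboundary:
  "peval (\<lambda>X. X (E x w) (E y v)) t (snd_lam Q (f a) (\<kappa> b)) =
   c * \<omega> w (K (x + y + t) (- y - t) b' (adj F (- t) (y + t) a' v))
   - \<omega> v (F (- t) (y + t) a' (K (x + y + t) (- x) b' w))"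
proof -
  have eqs: "x + (y + t) = x + y + t" "- (y + t) = - y - t" by simp_all
  show ?thesis
    using ab wv by (simp add: eqs snd_lam_E[OF f] \<kappa> \<kappa>_E adj_in[OF f] ev_in \<omega>_adj[OF f]
        represents_closed[OF k])
qed

lemma fst_opp_coboundary:
  "peval (\<lambda>X. X (E x w) (E y v)) t (fst_opp Q (f b) (\<kappa> a)) =
   c * \<omega> w (F (x + y + t) (- y - t) b' (K (- t) (- y) a' v))
   - \<omega> v (K (- t) (y + t) a' (adj F (x + y + t) (- y - t) b' w))"
proof -
  have eqs: "- y - t + y = - t" "- (- y - t) = y + t" "t + y = y + t" by simp_all
  show ?thesis
    using ab wv by (simp add: eqs fst_opp_E[OF f] \<kappa> \<kappa>_E adj_in[OF f] ev_in \<omega>_adj[OF f]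
        represents_closed[OF k])
qed

lemma snd_opp_coboundary:
  "peval (\<lambda>X. X (E x w) (E y v)) t (snd_opp Q (f b) (\<kappa> a)) =
   c * \<omega> w (K (- t) (x + t) a' (adj F (x + y + t) (- x - t) b' v))
   - \<omega> v (F (x + y + t) (- x - t) b' (K (- t) (- x) a' w))"
proof -
  have eqs: "x + (- x - t) = - t" "- (- x - t) = x + t" "t + x = x + t" by simp_all
  show ?thesis
    using ab wv by (simp add: eqs snd_opp_E[OF f] \<kappa> \<kappa>_E adj_in[OF f] ev_in \<omega>_adj[OF f]
        represents_closed[OF k])
qed

end

end


section \<open>Derived identities in a graded Poisson algebra\<close>

context graded_poisson
begin

text \<open>The axioms hold only after pairing with \<open>\<omega>\<close>.  To use them inside a nested product, the outer
  multiplication is moved to the other side of \<open>\<omega>\<close> by its transpose.\<close>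

lemma B_skew_left:
  assumes "a \<in> V" "b \<in> V" "c \<in> V" "w \<in> V"
  shows "\<omega> w (M s r (B p q a b) c) = - \<omega> w (M s r (B q p b a) c)"
  using B_skew[of a b "adjl M s r c w" p q] assms
  by (simp add: \<omega>_adjl[OF rM] adjl_in[OF rM] represents_closed[OF rB])

lemma B_skew_right:
  assumes "a \<in> V" "b \<in> V" "c \<in> V" "w \<in> V"
  shows "\<omega> w (M s r c (B p q a b)) = - \<omega> w (M s r c (B q p b a))"
  using B_skew[of a b "adj M s r c w" p q] assms
  by (simp add: \<omega>_adj[OF rM] adj_in[OF rM] represents_closed[OF rB])

lemma M_comm_left:
  assumes "a \<in> V" "b \<in> V" "c \<in> V" "w \<in> V"
  shows "\<omega> w (M s r (M p q a b) c) = \<omega> w (M s r (M q p b a) c)"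
  using M_comm[of a b "adjl M s r c w" p q] assms
  by (simp add: \<omega>_adjl[OF rM] adjl_in[OF rM] represents_closed[OF rM])

lemma M_assoc_swapped:
  assumes "a \<in> V" "b \<in> V" "c \<in> V" "w \<in> V"
  shows "\<omega> w (M (p + q) r (M p q a b) c) = \<omega> w (M q (p + r) b (M p r a c))"
  using M_comm_left[OF assms, of "p + q" r p q] M_assoc[of b a c w q p r] assms
  by (simp add: add.commute)

lemma leibniz_left:
  assumes "a \<in> V" "b \<in> V" "c \<in> V" "w \<in> V"
  shows "\<omega> w (B (p + q) r (M p q a b) c) =
    \<omega> w (M p (q + r) a (B q r b c)) + \<omega> w (M q (p + r) b (B p r a c))"
proof -
  have "\<omega> w (B (p + q) r (M p q a b) c) = - \<omega> w (B r (p + q) c (M p q a b))"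
    using assms by (intro B_skew) (simp_all add: represents_closed[OF rM])
  also have "\<dots> = - (\<omega> w (M (r + p) q (B r p c a) b) + \<omega> w (M p (r + q) a (B r q c b)))"
    using assms by (simp add: BM_leibniz)
  also have "\<omega> w (M (r + p) q (B r p c a) b) = \<omega> w (M q (r + p) b (B r p c a))"
    using assms by (intro M_comm) (simp_all add: represents_closed[OF rB])
  also have "\<dots> = - \<omega> w (M q (p + r) b (B p r a c))"
    using assms by (simp add: B_skew_right[of c a b w q "p + r" r p] add.commute)
  also have "\<omega> w (M p (r + q) a (B r q c b)) = - \<omega> w (M p (q + r) a (B q r b c))"
    using assms by (simp add: B_skew_right[of c b a w p "q + r" r q] add.commute)
  finally show ?thesis by simp
qed

end

section \<open>The coboundary bialgebra of a cyclic symplectic form\<close>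

text \<open>\<open>\<rho>\<close> is the inverse of \<open>\<omega>\<close>, and \<open>\<omega>\<close> is a cocycle for the bracket and for the product.\<close>

locale symplectic_poisson = graded_poisson Q V ev \<omega> B M
  for Q :: "('k::field_char_0, 'q::ab_group_add) pc_alg"
    and V :: "'v::ab_group_add set" and ev \<omega> B M +
  fixes \<rho> :: "('k, 'q) tensor2"
  assumes \<rho>_in: "\<rho> \<in> Tens2 Q"
    and \<rho>_E: "w \<in> V \<Longrightarrow> v \<in> V \<Longrightarrow> \<rho> (E x w) (E y v) = \<omega> w v"
    and B_cocycle: "a \<in> V \<Longrightarrow> b \<in> V \<Longrightarrow> c \<in> V \<Longrightarrow> p + q + r = 0 \<Longrightarrow>
      \<omega> a (B q r b c) + \<omega> b (B r p c a) + \<omega> c (B p q a b) = 0"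
    and M_cocycle: "a \<in> V \<Longrightarrow> b \<in> V \<Longrightarrow> c \<in> V \<Longrightarrow> p + q + r = 0 \<Longrightarrow>
      \<omega> a (M q r b c) + \<omega> b (M r p c a) + \<omega> c (M p q a b) = 0"
begin

abbreviation "\<delta> \<equiv> delta_of Q \<rho>"
abbreviation "\<Delta> \<equiv> Delta_of Q \<rho>"

lemma \<delta>_in: "a \<in> car Q \<Longrightarrow> \<delta> a \<in> Tens2 Q"
  unfolding delta_of_def by (intro Tens2_add on_der2_in[OF rB] \<rho>_in)

lemma \<Delta>_in: "a \<in> car Q \<Longrightarrow> \<Delta> a \<in> Tens2 Q"
  unfolding Delta_of_def by (intro Tens2_diff[OF kd] on_der2_in[OF rM] \<rho>_in)

lemmas B_in = represents_closed[OF rB] and M_in = represents_closed[OF rM]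

lemma \<delta>_coboundary:
  assumes "a \<in> car Q" "w \<in> V" "v \<in> V"
  shows "\<delta> a (E x w) (E y v) = \<omega> w (B (x + y) (- y) (ev (x + y) a) v) - \<omega> v (B (x + y) (- x) (ev (x + y) a) w)"
  using assms \<omega>_skew[of w "adj B (x + y) (- x) (ev (x + y) a) v"]
  by (simp add: delta_of_def on_fst_der2_E[OF rB] on_snd_der2_E[OF rB] \<rho>_in \<rho>_E adj_in[OF rB] ev_in
      \<omega>_adj[OF rB])

lemma \<Delta>_coboundary:
  assumes "a \<in> car Q" "w \<in> V" "v \<in> V"
  shows "\<Delta> a (E x w) (E y v) = - \<omega> w (M (x + y) (- y) (ev (x + y) a) v) - \<omega> v (M (x + y) (- x) (ev (x + y) a) w)"
  using assms \<omega>_skew[of w "adj M (x + y) (- x) (ev (x + y) a) v"]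
  by (simp add: Delta_of_def on_fst_der2_E[OF rM] on_snd_der2_E[OF rM] \<rho>_in \<rho>_E adj_in[OF rM] ev_in
      \<omega>_adj[OF rM])

text \<open>Of the three terms of the cyclic sum of \<open>a\<close>, \<open>w\<close>, \<open>v\<close>, two make up the coboundary; the third pairs \<open>a\<close> with
  the bracket of \<open>w\<close> and \<open>v\<close>.\<close>

lemma \<delta>_dual:
  assumes a: "a \<in> car Q" and w: "w \<in> V" and v: "v \<in> V"
  shows "\<delta> a (E x w) (E y v) = - E (x + y) (B (- x) (- y) w v) a"
  using B_cocycle[OF ev_in[OF a] w v, of "x + y" "- x" "- y" "x + y"]
    B_skew[OF ev_in[OF a] v w, of "x + y" "- y" "x + y"]
    \<omega>_skew[OF B_in[OF w v] ev_in[OF a], of "- x" "- y" "x + y"]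
  unfolding \<delta>_coboundary[OF a w v] E_apply by algebra

lemma \<Delta>_dual:
  assumes a: "a \<in> car Q" and w: "w \<in> V" and v: "v \<in> V"
  shows "\<Delta> a (E x w) (E y v) = - E (x + y) (M (- x) (- y) w v) a"
  using M_cocycle[OF ev_in[OF a] w v, of "x + y" "- x" "- y" "x + y"]
    M_comm[OF ev_in[OF a] v w, of "x + y" "- y" "x + y"]
    \<omega>_skew[OF M_in[OF w v] ev_in[OF a], of "- x" "- y" "x + y"]
  unfolding \<Delta>_coboundary[OF a w v] E_apply by algebra

lemma \<delta>_product: "cobracket_of_product \<delta> B" and \<Delta>_product: "cobracket_of_product \<Delta> M"
  by (simp_all add: cobracket_of_product_def \<delta>_in \<Delta>_in \<delta>_dual \<Delta>_dual B_in M_in)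

lemma \<delta>_dual':
  "a \<in> car Q \<Longrightarrow> w \<in> V \<Longrightarrow> v \<in> V \<Longrightarrow>
   \<delta> a (E x w) (E y v) = \<omega> (ev (x + y) a) (B (- x) (- y) w v)"
  using \<omega>_skew[OF B_in ev_in, of w v a "- x" "- y" "x + y"] by (simp add: \<delta>_dual E_apply)

lemma \<Delta>_dual':
  "a \<in> car Q \<Longrightarrow> w \<in> V \<Longrightarrow> v \<in> V \<Longrightarrow>
   \<Delta> a (E x w) (E y v) = \<omega> (ev (x + y) a) (M (- x) (- y) w v)"
  using \<omega>_skew[OF M_in ev_in, of w v a "- x" "- y" "x + y"] by (simp add: \<Delta>_dual E_apply)

lemmas \<delta>_co = co_fst_E[OF \<delta>_product] co_snd_E[OF \<delta>_product]
lemmas \<Delta>_co = co_fst_E[OF \<Delta>_product] co_snd_E[OF \<Delta>_product]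

text \<open>By \<open>\<delta>_dual'\<close> and \<open>\<Delta>_dual'\<close> each coalgebra axiom, evaluated at \<open>w\<close>, \<open>v\<close>, \<open>u\<close>, is the corresponding algebra axiom for
  these three vectors, paired with \<open>a\<close>.\<close>

lemma coalgebra: "poisson_conformal_coalgebra Q \<delta> \<Delta>"
  unfolding poisson_conformal_coalgebra_def
proof (intro conjI ballI)
  note in3 = co_fst_in[OF _ \<delta>_in] co_fst_in[OF _ \<Delta>_in] flip12_in Tens3_add Tens3_diff[OF kd]
  note ev = \<delta>_co \<Delta>_co \<delta>_in \<Delta>_in B_in M_in flip12_E \<delta>_dual' \<Delta>_dual' in3
  show "kd_hom2 Q \<delta>" "kd_hom2 Q \<Delta>" by (rule kd_hom2_of_product[OF \<delta>_product], rule kd_hom2_of_product[OF \<Delta>_product])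
  fix a assume a: "a \<in> car Q"
  show "\<Delta> a = flip2 Q (\<Delta> a)"
  proof (rule Tens2_eqI)
    fix x w y v assume wv: "w \<in> V" "v \<in> V"
    then show "\<Delta> a (E x w) (E y v) = flip2 Q (\<Delta> a) (E x w) (E y v)"
      using a M_comm[OF wv ev_in[OF a], of "x + y" "- x" "- y"]
      by (simp add: flip2_E \<Delta>_in \<Delta>_dual' add.commute)
  qed (use a in \<open>auto simp: \<Delta>_in flip2_in\<close>)
  show "\<delta> a = - flip2 Q (\<delta> a)"
  proof (rule Tens2_eqI)
    fix x w y v assume wv: "w \<in> V" "v \<in> V"
    then show "\<delta> a (E x w) (E y v) = (- flip2 Q (\<delta> a)) (E x w) (E y v)"
      using a B_skew[OF wv ev_in[OF a], of "x + y" "- x" "- y"]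
      by (simp add: flip2_E \<delta>_in \<delta>_dual' add.commute)
  qed (use a in \<open>auto simp: \<delta>_in flip2_in Tens2_minus[OF kd]\<close>)
  show "co_snd Q \<Delta> (\<Delta> a) = co_fst Q \<Delta> (\<Delta> a)"
  proof (rule Tens3_eqI)
    fix x w y v z u assume wvu: "w \<in> V" "v \<in> V" "u \<in> V"
    then show "co_snd Q \<Delta> (\<Delta> a) (E x w) (E y v) (E z u) = co_fst Q \<Delta> (\<Delta> a) (E x w) (E y v) (E z u)"
      using a M_assoc[OF wvu ev_in[OF a], of "x + y + z" "- x" "- y" "- z"]
      by (simp add: ev) (simp add: algebra_simps)
  qed (use a in \<open>auto simp: ev\<close>)
  show "co_snd Q \<delta> (\<delta> a) - flip12 Q (co_snd Q \<delta> (\<delta> a)) = co_fst Q \<delta> (\<delta> a)"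
  proof (rule Tens3_eqI)
    fix x w y v z u assume wvu: "w \<in> V" "v \<in> V" "u \<in> V"
    then show "(co_snd Q \<delta> (\<delta> a) - flip12 Q (co_snd Q \<delta> (\<delta> a))) (E x w) (E y v) (E z u) =
        co_fst Q \<delta> (\<delta> a) (E x w) (E y v) (E z u)"
      using a B_jacobi[OF wvu ev_in[OF a], of "x + y + z" "- x" "- y" "- z"]
      by (simp add: ev) (simp add: algebra_simps)
  qed (use a in \<open>auto simp: ev\<close>)
  show "co_snd Q \<Delta> (\<delta> a) = co_fst Q \<delta> (\<Delta> a) + flip12 Q (co_snd Q \<delta> (\<Delta> a))"
  proof (rule Tens3_eqI)
    fix x w y v z u assume wvu: "w \<in> V" "v \<in> V" "u \<in> V"
    then show "co_snd Q \<Delta> (\<delta> a) (E x w) (E y v) (E z u) =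
        (co_fst Q \<delta> (\<Delta> a) + flip12 Q (co_snd Q \<delta> (\<Delta> a))) (E x w) (E y v) (E z u)"
      using a BM_leibniz[OF wvu ev_in[OF a], of "x + y + z" "- x" "- y" "- z"]
      by (simp add: ev) (simp add: algebra_simps)
  qed (use a in \<open>auto simp: ev\<close>)
qed (rule kd)

lemma \<delta>_form: "coboundary_form \<delta> B 1" and \<Delta>_form: "coboundary_form \<Delta> M (- 1)"
  by (simp_all add: coboundary_form_def \<delta>_in \<Delta>_in \<delta>_coboundary \<Delta>_coboundary)

text \<open>Each compatibility condition is a sum of terms \<open>\<omega> w (\<dots>)\<close> and \<open>\<omega> v (\<dots>)\<close>.  Those in which \<open>a\<close> and \<open>b\<close> act on
  different legs cancel by \<open>cross\<close>; in the others both act on the same vector, and the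
  equation is an axiom of the graded Poisson algebra.\<close>

theorem bialgebra: "poisson_conformal_bialgebra Q \<delta> \<Delta>"
  unfolding poisson_conformal_bialgebra_def
proof (intro conjI ballI)
  fix a b assume ab: "a \<in> car Q" "b \<in> car Q"
  \<comment> \<open>Below \<open>-t\<close>, \<open>x + y + t\<close> are the momenta of \<open>a\<close>, \<open>b\<close>, and \<open>-x\<close>, \<open>-y\<close> those of \<open>w\<close>, \<open>v\<close>.\<close>
  note in2 = Tens2_add Tens2_diff[OF kd] lam_in[OF rB] lam_in[OF rM] \<delta>_in \<Delta>_in ab
    map_poly_Tens2 represents_in[OF rB] represents_in[OF rM]
  note pa = peval_add[OF additive_ev2] peval_diff[OF additive_ev2]
  note mapE = peval_map_coboundary and fl = fst_lam_coboundary and sl = snd_lam_coboundary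
    and fo = fst_opp_coboundary and so = snd_opp_coboundary
  have arith: "- t + (x + y + t) = x + y" "x + y + t + - t = x + y"
    "x + y + t + - y = x + t" "x + y + t + - x = y + t"
    "- t + - y = - y - t" "- t + - x = - x - t" for x y t :: 'k by simp_all
  show "map_poly \<delta> (brk Q a b) =
      fst_lam Q (brk Q a) (\<delta> b) + snd_lam Q (brk Q a) (\<delta> b)
      - (fst_opp Q (brk Q b) (\<delta> a) + snd_opp Q (brk Q b) (\<delta> a))" (is "?L = ?R")
  proof (rule poly_Tens2_eqI)
    fix x w y v t assume wv: "w \<in> V" "v \<in> V"
    note a = ev_in[OF ab(1), of "- t"] and b = ev_in[OF ab(2), of "x + y + t"]
    note E = mapE[OF rB rB \<delta>_form ab wv] fl[OF rB rB \<delta>_form ab wv] sl[OF rB rB \<delta>_form ab wv]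
      fo[OF rB rB \<delta>_form ab wv] so[OF rB rB \<delta>_form ab wv]
    show "peval (\<lambda>X. X (E x w) (E y v)) t ?L = peval (\<lambda>X. X (E x w) (E y v)) t ?R"
      unfolding pa E
      using B_jacobi[OF a b wv(2,1), of "- t" "x + y + t" "- y"]
        B_jacobi[OF a b wv(1,2), of "- t" "x + y + t" "- x"]
        cross[OF rB rB a b wv, of "x + y + t" "- x - t" "- t" "x + t"]
        cross[OF rB rB b a wv(2,1), of "- t" "y + t" "x + y + t" "- y - t"]
        cross[OF rB rB b a wv, of "- t" "y + t" "x + y + t" "- y - t"]
      unfolding arith by algebra
  qed (auto intro!: in2)
  show "map_poly \<Delta> (mul Q a b) = snd_lam Q (mul Q a) (\<Delta> b) + fst_opp Q (mul Q b) (\<Delta> a)"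
    (is "?L = ?R")
  proof (rule poly_Tens2_eqI)
    fix x w y v t assume wv: "w \<in> V" "v \<in> V"
    note a = ev_in[OF ab(1), of "- t"] and b = ev_in[OF ab(2), of "x + y + t"]
    note E = mapE[OF rM rM \<Delta>_form ab wv] sl[OF rM rM \<Delta>_form ab wv] fo[OF rM rM \<Delta>_form ab wv]
    show "peval (\<lambda>X. X (E x w) (E y v)) t ?L = peval (\<lambda>X. X (E x w) (E y v)) t ?R"
      unfolding pa E
      using M_assoc_swapped[OF a b wv(2,1), of "- t" "x + y + t" "- y"]
        M_assoc[OF a b wv(1,2), of "- t" "x + y + t" "- x"]
        cross[OF rM rM b a wv, of "- t" "y + t" "x + y + t" "- y - t"]
      unfolding arith by simp
  qed (auto intro!: in2)
  show "map_poly \<delta> (mul Q a b) =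
      fst_lam Q (mul Q a) (\<delta> b) + fst_opp Q (mul Q b) (\<delta> a)
      + snd_lam Q (brk Q a) (\<Delta> b) + snd_opp Q (brk Q b) (\<Delta> a)" (is "?L = ?R")
  proof (rule poly_Tens2_eqI)
    fix x w y v t assume wv: "w \<in> V" "v \<in> V"
    note a = ev_in[OF ab(1), of "- t"] and b = ev_in[OF ab(2), of "x + y + t"]
    note E = mapE[OF rB rM \<delta>_form ab wv] fl[OF rB rM \<delta>_form ab wv] fo[OF rB rM \<delta>_form ab wv]
      sl[OF rM rB \<Delta>_form ab wv] so[OF rM rB \<Delta>_form ab wv]
    show "peval (\<lambda>X. X (E x w) (E y v)) t ?L = peval (\<lambda>X. X (E x w) (E y v)) t ?R"
      unfolding pa E
      using leibniz_left[OF a b wv(2,1), of "- t" "x + y + t" "- y"]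
        leibniz_left[OF a b wv(1,2), of "- t" "x + y + t" "- x"]
        BM_leibniz[OF a b wv(1,2), of "- t" "x + y + t" "- x"]
        BM_leibniz[OF b a wv(1,2), of "x + y + t" "- t" "- x"]
        B_skew_left[OF a b wv(1,2), of "x + y" "- x" "- t" "x + y + t"]
        cross[OF rM rB a b wv, of "x + y + t" "- x - t" "- t" "x + t"]
        cross[OF rM rB b a wv, of "- t" "y + t" "x + y + t" "- y - t"]
      unfolding arith by algebra
  qed (auto intro!: in2)
  show "map_poly \<Delta> (brk Q a b) =
      fst_lam Q (brk Q a) (\<Delta> b) + snd_lam Q (brk Q a) (\<Delta> b)
      - snd_opp Q (mul Q b) (\<delta> a) + fst_opp Q (mul Q b) (\<delta> a)" (is "?L = ?R")
  proof (rule poly_Tens2_eqI)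
    fix x w y v t assume wv: "w \<in> V" "v \<in> V"
    note a = ev_in[OF ab(1), of "- t"] and b = ev_in[OF ab(2), of "x + y + t"]
    note E = mapE[OF rM rB \<Delta>_form ab wv] fl[OF rM rB \<Delta>_form ab wv] sl[OF rM rB \<Delta>_form ab wv]
      so[OF rB rM \<delta>_form ab wv] fo[OF rB rM \<delta>_form ab wv]
    show "peval (\<lambda>X. X (E x w) (E y v)) t ?L = peval (\<lambda>X. X (E x w) (E y v)) t ?R"
      unfolding pa E
      using BM_leibniz[OF a b wv(2,1), of "- t" "x + y + t" "- y"]
        BM_leibniz[OF a b wv(1,2), of "- t" "x + y + t" "- x"]
        cross[OF rB rM a b wv, of "x + y + t" "- x - t" "- t" "x + t"]
        cross[OF rM rB b a wv, of "- t" "y + t" "x + y + t" "- y - t"]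
      unfolding arith by algebra
  qed (auto intro!: in2)
qed (use poisson_conformal coalgebra in auto)

end

section \<open>The Yang--Baxter equation from the cocycle identities\<close>

context momentum_space
begin

lemma lsubst_der3:
  assumes f: "represents f F" and a: "a \<in> car Q" "a' \<in> car Q" and bc: "b \<in> car Q" "c \<in> car Q"
    and wvu: "w \<in> V" "v \<in> V" "u \<in> V"
    and S: "\<And>X. X \<in> Tens3 Q \<Longrightarrow> S X \<in> Tens3 Q"
      "\<And>X. X \<in> Tens3 Q \<Longrightarrow> S X (E x w) (E y v) (E z u) = t * X (E x w) (E y v) (E z u)"
  shows "lsubst S (\<lambda>q. tens3 Q q b c) (f a a') (E x w) (E y v) (E z u) =
      peval (E x w) t (f a a') * E y v b * E z u c" (is ?A)
    and "lsubst S (\<lambda>q. tens3 Q b q c) (f a a') (E x w) (E y v) (E z u) =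
      E x w b * peval (E y v) t (f a a') * E z u c" (is ?B)
    and "lsubst S (\<lambda>q. tens3 Q b c q) (f a a') (E x w) (E y v) (E z u) =
      E x w b * E y v c * peval (E z u) t (f a a')" (is ?C)
proof -
  note e = lsubst_eigen[where \<Phi> = "\<lambda>X. X (E x w) (E y v) (E z u)" and M = "Tens3 Q" and T = S, OF additive_ev3 S]
  note t3 = Tens3_tens3 represents_in[OF f a] bc
  show ?A
    by (subst e) (simp_all add: t3 tens3_E wvu mult_ac flip: peval_scale)
  show ?B
    by (subst e) (simp_all add: t3 tens3_E wvu mult_ac flip: peval_scale)
  show ?C
    by (subst e) (simp_all add: t3 tens3_E wvu mult_ac flip: peval_scale)
qed

lemma lsubst_der3_in:
  assumes f: "represents f F" and a: "a \<in> car Q" "a' \<in> car Q" and bc: "b \<in> car Q" "c \<in> car Q"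
    and S: "\<And>X. X \<in> Tens3 Q \<Longrightarrow> S X \<in> Tens3 Q"
  shows "lsubst S (\<lambda>q. tens3 Q q b c) (f a a') \<in> Tens3 Q"
    "lsubst S (\<lambda>q. tens3 Q b q c) (f a a') \<in> Tens3 Q"
    "lsubst S (\<lambda>q. tens3 Q b c q) (f a a') \<in> Tens3 Q"
  by (intro lsubst_closed Tens3_zero Tens3_add S Tens3_tens3 represents_in[OF f] a bc; assumption)+

end

text \<open>\<open>cst\<close> lifts a vector of the fibre to the element with this value at all momenta.  The affine
  dependence on the momenta is expressed by the values of \<open>B\<close> at \<open>(0, 0)\<close>, \<open>(1, 0)\<close> and \<open>(0, 1)\<close>.\<close>

locale affine_symplectic_poisson = symplectic_poisson Q V ev \<omega> B M \<rho>
  for Q :: "('k::field_char_0, 'q::ab_group_add) pc_alg"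
    and V :: "'v::ab_group_add set" and ev \<omega> B M \<rho> +
  fixes cst :: "'v \<Rightarrow> 'q"
  assumes cst_in: "v \<in> V \<Longrightarrow> cst v \<in> car Q" and ev_cst: "v \<in> V \<Longrightarrow> ev x (cst v) = v"
    and B_affine: "a \<in> V \<Longrightarrow> b \<in> V \<Longrightarrow> w \<in> V \<Longrightarrow>
      \<omega> w (B p q a b) = \<omega> w (B 0 0 a b) + p * (\<omega> w (B 1 0 a b) - \<omega> w (B 0 0 a b))
        + q * (\<omega> w (B 0 1 a b) - \<omega> w (B 0 0 a b))"
    and M_const: "a \<in> V \<Longrightarrow> b \<in> V \<Longrightarrow> w \<in> V \<Longrightarrow> \<omega> w (M p q a b) = \<omega> w (M 0 0 a b)"
begin

lemma skew_symmetric: "skew_symmetric_tensor Q \<rho>"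
  unfolding skew_symmetric_tensor_def
proof
  show "flip2 Q \<rho> = - \<rho>"
  proof (rule Tens2_eqI)
    fix x w y v assume wv: "w \<in> V" "v \<in> V"
    then show "flip2 Q \<rho> (E x w) (E y v) = (- \<rho>) (E x w) (E y v)"
      using \<omega>_skew[OF wv] by (simp add: flip2_E \<rho>_in \<rho>_E)
  qed (auto simp: flip2_in \<rho>_in Tens2_minus[OF kd])
qed (rule \<rho>_in)

text \<open>The two copies of \<open>\<rho>\<close> are contracted one after the other: once the legs \<open>a\<close>, \<open>b\<close> of the outer copy are fixed,
  the integrand is additive in the inner one, and its value is again additive in the outer one.\<close>

lemma double_lift:
  assumes wvu: "w \<in> V" "v \<in> V" "u \<in> V"
    and in1: "\<And>a b. a \<in> car Q \<Longrightarrow> b \<in> car Q \<Longrightarrow> additive (\<Psi> a b)"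
    and eq1: "\<And>a b c d. a \<in> car Q \<Longrightarrow> b \<in> car Q \<Longrightarrow> c \<in> car Q \<Longrightarrow> d \<in> car Q \<Longrightarrow>
      \<beta> a b c d (E x w) (E y v) (E z u) = \<Psi> a b (tens2 Q c d)"
    and in2: "additive \<Theta>"
    and eq2: "\<And>a b. a \<in> car Q \<Longrightarrow> b \<in> car Q \<Longrightarrow> \<Psi> a b \<rho> = \<Theta> (tens2 Q a b)"
  shows "lift2 Q (\<lambda>a b. lift2 Q (\<lambda>c d. \<beta> a b c d) \<rho>) \<rho> (E x w) (E y v) (E z u) = \<Theta> \<rho>"
proof (rule lift2_eval[where \<Phi> = "\<lambda>X. X (E x w) (E y v) (E z u)", OF \<rho>_in additive_ev3 in2])
  fix a b assume ab: "a \<in> car Q" "b \<in> car Q"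
  have "lift2 Q (\<lambda>c d. \<beta> a b c d) \<rho> (E x w) (E y v) (E z u) = \<Psi> a b \<rho>"
    by (rule lift2_eval[where \<Phi> = "\<lambda>X. X (E x w) (E y v) (E z u)", OF \<rho>_in additive_ev3 in1[OF ab]])
       (rule eq1[OF ab])
  then show "lift2 Q (\<lambda>c d. \<beta> a b c d) \<rho> (E x w) (E y v) (E z u) = \<Theta> (tens2 Q a b)"
    using eq2[OF ab] by simp
qed

lemma cybe_in: "cybe_brk Q \<rho> \<in> Tens3 Q"
  unfolding cybe_brk_def
  by (intro lift2_closed[OF \<rho>_in] Tens3_zero Tens3_add Tens3_diff[OF kd] lsubst_der3_in[OF rB]
      der3_in; assumption)

lemma aybe_in: "aybe_mul Q \<rho> \<in> Tens3 Q"
  unfolding aybe_mul_def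
  by (intro lift2_closed[OF \<rho>_in] Tens3_zero Tens3_add Tens3_diff[OF kd] Tens3_minus[OF kd]
      lsubst_der3_in[OF rM] der3_in; assumption)

lemmas additive_intros = additive_plus additive_diff additive_cmult additive_ev2

text \<open>Each contraction of a leg of \<open>\<rho>\<close> with a functional \<open>E\<close> replaces the other leg by the corresponding
  vector.  On the plane \<open>x + y + z = 0\<close> this is the cyclic sum of \<open>B_cocycle\<close> for momenta \<open>-x\<close>, \<open>-y\<close>, \<open>-z\<close>.\<close>

lemma cybe_E:
  assumes wvu: "w \<in> V" "v \<in> V" "u \<in> V"
  shows "cybe_brk Q \<rho> (E x w) (E y v) (E z u) =
    \<omega> w (B (- y) (x + y) v u) + \<omega> v (B (- z) (y + z) u w) - \<omega> u (B (- y) (y + z) v w)"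
proof -
  note l3 = lsubst_der3[where S = "der3_2 Q" and t = y and x = x and y = y and z = z, OF rB _ _ _ _ wvu der3_in(2) der3_E(2)[OF _ wvu]]
    lsubst_der3[where S = "der3_3 Q" and t = z and x = x and y = y and z = z, OF rB _ _ _ _ wvu der3_in(3) der3_E(3)[OF _ wvu]]
  let ?\<Psi> = "\<lambda>a b X. E y v b * X (E (x + y) (adj B (- y) (x + y) (ev (- y) a) w)) (E z u)
      - E x w a * X (E (- z) (adjl B (- z) (y + z) (ev (y + z) b) v)) (E z u)
      - E x w a * X (E y v) (E (- y) (adjl B (- y) (y + z) (ev (y + z) b) u))"
  let ?\<Theta> = "\<lambda>X. X (E (- y) (adjl B (- y) (x + y) u w)) (E y v)
     - X (E x w) (E (y + z) (adj B (- z) (y + z) u v))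
     + X (E x w) (E (y + z) (adj B (- y) (y + z) v u))"
  have "cybe_brk Q \<rho> (E x w) (E y v) (E z u) = ?\<Theta> \<rho>"
    unfolding cybe_brk_def
  proof (rule double_lift[where \<Psi> = ?\<Psi> and \<Theta> = ?\<Theta>, OF wvu])
    fix a b assume ab: "a \<in> car Q" "b \<in> car Q"
    show "additive (?\<Psi> a b)" by (intro additive_intros)
    show "?\<Psi> a b \<rho> = ?\<Theta> (tens2 Q a b)"
      using wvu ab \<omega>_skew[of v "adjl B (- y) (y + z) (ev (y + z) b) u"]
      by (simp add: \<rho>_E tens2_E adj_in[OF rB] adjl_in[OF rB] \<omega>_adj[OF rB] \<omega>_adjl[OF rB] ev_in E_apply)
    fix c d assume cd: "c \<in> car Q" "d \<in> car Q"
    show "(lsubst (der3_2 Q) (\<lambda>q. tens3 Q q b d) (brk Q a c)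
         - lsubst (der3_3 Q) (\<lambda>q. tens3 Q a q d) (brk Q c b)
         - lsubst (der3_2 Q) (\<lambda>q. tens3 Q a c q) (brk Q d b)) (E x w) (E y v) (E z u) =
        ?\<Psi> a b (tens2 Q c d)"
      using wvu ab cd
      by (simp add: l3 tens2_E adj_in[OF rB] adjl_in[OF rB] ev_in peval_right[OF rB, of a c w x y]
          peval_left[OF rB, of c b v y z] peval_left[OF rB, of d b u z y] add.commute)
  qed (intro additive_intros)
  then show ?thesis
    using wvu \<omega>_skew[of w "adj B (- z) (y + z) u v"] \<omega>_skew[of w "adj B (- y) (y + z) v u"]
    by (simp add: \<rho>_E adj_in[OF rB] adjl_in[OF rB] \<omega>_adj[OF rB] \<omega>_adjl[OF rB])
qed

lemma aybe_E:
  assumes wvu: "w \<in> V" "v \<in> V" "u \<in> V"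
  shows "aybe_mul Q \<rho> (E x w) (E y v) (E z u) = 
    \<omega> u (M (- x) (z + x) w v) + \<omega> v (M (x + y) (- x) u w) + \<omega> w (M (- y) (x + y) v u)"
proof -
  let ?S = "\<lambda>X. - (der3_1 Q X + der3_2 Q X)"
  have S: "?S X \<in> Tens3 Q" "?S X (E x w) (E y v) (E z u) = (- (x + y)) * X (E x w) (E y v) (E z u)"
    if "X \<in> Tens3 Q" for X
    using that wvu by (auto intro!: Tens3_minus[OF kd] Tens3_diff[OF kd] der3_in simp: der3_E algebra_simps)
  note l3 = lsubst_der3[where S = "der3_1 Q" and t = x and x = x and y = y and z = z, OF rM _ _ _ _ wvu der3_in(1) der3_E(1)[OF _ wvu]]
    lsubst_der3[where S = "der3_2 Q" and t = y and x = x and y = y and z = z, OF rM _ _ _ _ wvu der3_in(2) der3_E(2)[OF _ wvu]]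
    lsubst_der3[where S = ?S and t = "- (x + y)" and x = x and y = y and z = z, OF rM _ _ _ _ wvu S]
  have ar: "y + - (x + y) = - x" "- (- (x + y)) = x + y" by simp_all
  let ?\<Psi> = "\<lambda>a b X. E x w a * X (E y v) (E (z + x) (adj M (- x) (z + x) (ev (- x) b) u))
      - E x w a * X (E (x + y) (adjl M (x + y) (- x) (ev (- x) b) v)) (E z u)
      + E y v b * X (E (x + y) (adj M (- y) (x + y) (ev (- y) a) w)) (E z u)"
  let ?\<Theta> = "\<lambda>X. - X (E x w) (E (- x) (adjl M (- x) (z + x) v u))
     - X (E x w) (E (- x) (adj M (x + y) (- x) u v))
     + X (E (- y) (adjl M (- y) (x + y) u w)) (E y v)"
  have "aybe_mul Q \<rho> (E x w) (E y v) (E z u) = ?\<Theta> \<rho>"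
    unfolding aybe_mul_def
  proof (rule double_lift[where \<Psi> = ?\<Psi> and \<Theta> = ?\<Theta>, OF wvu])
    fix a b assume ab: "a \<in> car Q" "b \<in> car Q"
    show "additive (?\<Psi> a b)" by (intro additive_intros)
    show "?\<Psi> a b \<rho> = ?\<Theta> (tens2 Q a b)"
      using wvu ab \<omega>_skew[of v "adj M (- x) (z + x) (ev (- x) b) u"]
      by (simp add: \<rho>_E tens2_E adj_in[OF rM] adjl_in[OF rM] \<omega>_adj[OF rM] \<omega>_adjl[OF rM] ev_in E_apply)
    fix c d assume cd: "c \<in> car Q" "d \<in> car Q"
    note second = peval_left[OF rM cd(1) ab(2) wvu(2), where x = y and t = "- (x + y)", unfolded ar]
    show "(lsubst (der3_1 Q) (\<lambda>q. tens3 Q a c q) (mul Q b d)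
         - lsubst ?S (\<lambda>q. tens3 Q a q d) (mul Q c b)
         + lsubst (der3_2 Q) (\<lambda>q. tens3 Q q b d) (mul Q a c)) (E x w) (E y v) (E z u) =
        ?\<Psi> a b (tens2 Q c d)"
      using wvu ab cd
      by (simp add: l3 second tens2_E adj_in[OF rM] adjl_in[OF rM] ev_in peval_right[OF rM, of b d u z x]
          peval_right[OF rM, of a c w x y] del: minus_add_distrib)
  qed (intro additive_intros additive_uminus)
  then show ?thesis
    using wvu \<omega>_skew[of w "adjl M (- x) (z + x) v u"] \<omega>_skew[of w "adj M (x + y) (- x) u v"]
    by (simp add: \<rho>_E adj_in[OF rM] adjl_in[OF rM] \<omega>_adj[OF rM] \<omega>_adjl[OF rM])
qed

text \<open>The value of \<open>cybe_brk\<close> is affine in \<open>(x, y, z)\<close> and vanishes for \<open>x + y + z = 0\<close>, so it is \<open>x + y + z\<close>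
  times its value at \<open>(0, 0, 1)\<close>.\<close>

theorem PCYBE: "PCYBE_solution Q \<rho>"
  unfolding PCYBE_solution_def
proof (intro conjI)
  have "aybe_mul Q \<rho> = der3 Q 0"
  proof (rule Tens3_eqI)
    fix x w y v z u assume wvu: "w \<in> V" "v \<in> V" "u \<in> V"
    show "aybe_mul Q \<rho> (E x w) (E y v) (E z u) = der3 Q 0 (E x w) (E y v) (E z u)"
      using M_cocycle[OF wvu, of 0 0 0] wvu
        M_const[OF wvu(1,2,3), of "- x" "z + x"] M_const[OF wvu(3,1,2), of "x + y" "- x"]
        M_const[OF wvu(2,3,1), of "- y" "x + y"]
      by (simp add: aybe_E der3_total_E) (simp add: algebra_simps)
  qed (auto simp: aybe_in der3_total_in)
  then show "aybe_mul Q \<rho> \<in> der3 Q ` Tens3 Q" by auto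
  \<comment> \<open>A preimage under \<open>\<partial>\<^bsup>\<otimes>3\<^esup>\<close>: the tensor whose value at all momenta is the one at \<open>(0, 0, 1)\<close>.\<close>
  define Y where "Y = lift3 Q (\<lambda>a b c. tens3 Q (cst (ev 0 a)) (cst (ev 0 b)) (cst (ev 1 c))) (cybe_brk Q \<rho>)"
  have Y_in: "Y \<in> Tens3 Q"
    unfolding Y_def by (rule lift3_closed[OF cybe_in]) (auto intro!: Tens3_add Tens3_tens3 cst_in ev_in)
  have Y_E: "Y (E x w) (E y v) (E z u) = cybe_brk Q \<rho> (E 0 w) (E 0 v) (E 1 u)"
    if wvu: "w \<in> V" "v \<in> V" "u \<in> V" for x w y v z u
    unfolding Y_def
    by (rule lift3_eval[where \<Phi> = "\<lambda>X. X (E x w) (E y v) (E z u)", OF cybe_in additive_ev3 additive_ev3])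
       (use wvu in \<open>simp add: tens3_E E_apply ev_cst ev_in\<close>)
  have "cybe_brk Q \<rho> = der3 Q Y"
  proof (rule Tens3_eqI)
    fix x w y v z u assume wvu: "w \<in> V" "v \<in> V" "u \<in> V"
    have aff: "\<exists>\<alpha> \<beta> \<gamma>. \<forall>p q. \<omega> c (B p q a b) = \<alpha> + p * \<beta> + q * \<gamma>"
      if "a \<in> V" "b \<in> V" "c \<in> V" for a b c
      using B_affine[OF that] by blast
    obtain \<alpha> \<beta> \<gamma> where 1: "\<And>p q. \<omega> w (B p q v u) = \<alpha> + p * \<beta> + q * \<gamma>"
      using aff[OF wvu(2,3,1)] by blast
    obtain \<alpha>' \<beta>' \<gamma>' where 2: "\<And>p q. \<omega> v (B p q u w) = \<alpha>' + p * \<beta>' + q * \<gamma>'"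
      using aff[OF wvu(3,1,2)] by blast
    obtain \<alpha>'' \<beta>'' \<gamma>'' where 3: "\<And>p q. \<omega> u (B p q v w) = \<alpha>'' + p * \<beta>'' + q * \<gamma>''"
      using aff[OF wvu(2,1,3)] by blast
    have cocycle: "\<omega> w (B q r v u) + \<omega> v (B r p u w) - \<omega> u (B q p v w) = 0" if "p + q + r = 0" for p q r
      using B_cocycle[OF wvu that] B_skew[OF wvu, of p q] by simp
    show "cybe_brk Q \<rho> (E x w) (E y v) (E z u) = der3 Q Y (E x w) (E y v) (E z u)"
      unfolding der3_total_E[OF Y_in wvu] Y_E[OF wvu] cybe_E[OF wvu]
      using cocycle[of 0 0 0] cocycle[of "- x" "- y" "x + y"]
      unfolding 1 2 3 by algebra
  qed (auto simp: cybe_in der3_total_in Y_in)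
  then show "cybe_brk Q \<rho> \<in> der3 Q ` Tens3 Q" using Y_in by auto
qed (rule \<rho>_in)

end

section \<open>Pre-PGD-algebras in momentum space\<close>

locale pre_PGD_algebra = vector_space s
  for s :: "'k::field_char_0 \<Rightarrow> 'a::ab_group_add \<Rightarrow> 'a" +
  fixes l r z d :: "'a \<Rightarrow> 'a \<Rightarrow> 'a"
  assumes pgd: "pre_PGD s l r z d"
begin

abbreviation "lin \<phi> \<equiv> Vector_Spaces.linear s ((*) :: 'k \<Rightarrow> 'k \<Rightarrow> 'k) \<phi>"

lemma lin_simps:
  assumes "lin \<phi>"
  shows "\<phi> (a + b) = \<phi> a + \<phi> b" "\<phi> (s c a) = c * \<phi> a" "\<phi> (a - b) = \<phi> a - \<phi> b" "\<phi> (- a) = - \<phi> a"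
    "\<phi> 0 = 0"
proof -
  interpret Vector_Spaces.linear s "(*) :: 'k \<Rightarrow> 'k \<Rightarrow> 'k" \<phi> by fact
  show "\<phi> (a + b) = \<phi> a + \<phi> b" "\<phi> (s c a) = c * \<phi> a" "\<phi> (a - b) = \<phi> a - \<phi> b"
    "\<phi> (- a) = - \<phi> a" "\<phi> 0 = 0"
    by (rule add scale diff neg zero)+
qed

lemma vs_mult: "vector_space ((*) :: 'k \<Rightarrow> 'k \<Rightarrow> 'k)"
  by unfold_locales (simp_all add: algebra_simps)

lemma linI:
  assumes "\<And>a b. \<phi> (a + b) = \<phi> a + \<phi> b" "\<And>c a. \<phi> (s c a) = c * \<phi> a"
  shows "lin \<phi>"
  by (intro Vector_Spaces.linear.intro vs_mult vector_space_axioms module_hom.intro module_axioms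
      module_hom_axioms.intro assms) (unfold_locales; simp add: algebra_simps)

lemma bilinear_op_simps:
  assumes "bilinear_op s m"
  shows "m (a + b) c = m a c + m b c" "m c (a + b) = m c a + m c b"
    "m (s k a) c = s k (m a c)" "m c (s k a) = s k (m c a)"
    "m (a - b) c = m a c - m b c" "m c (a - b) = m c a - m c b"
    "m (- a) c = - m a c" "m c (- a) = - m c a" "m 0 c = 0" "m c 0 = 0"
proof -
  interpret L: Vector_Spaces.linear s s "\<lambda>a. m a c" using assms by (simp add: bilinear_op_def)
  interpret R: Vector_Spaces.linear s s "\<lambda>a. m c a" using assms by (simp add: bilinear_op_def)
  show "m (a + b) c = m a c + m b c" "m (s k a) c = s k (m a c)" "m (a - b) c = m a c - m b c"
    "m (- a) c = - m a c" "m 0 c = 0"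
    by (rule L.add L.scale L.diff L.neg L.zero)+
  show "m c (a + b) = m c a + m c b" "m c (s k a) = s k (m c a)" "m c (a - b) = m c a - m c b"
    "m c (- a) = - m c a" "m c 0 = 0"
    by (rule R.add R.scale R.diff R.neg R.zero)+
qed

lemma bil: "bilinear_op s l" "bilinear_op s r" "bilinear_op s z" "bilinear_op s d"
  using pgd unfolding pre_PGD_def pre_GD_def pre_diff_novikov_poisson_def pre_novikov_def
    left_symmetric_def zinbiel_def by auto

lemmas op_simps = bil[THEN bilinear_op_simps(1)] bil[THEN bilinear_op_simps(2)]
  bil[THEN bilinear_op_simps(3)] bil[THEN bilinear_op_simps(4)]
  bil[THEN bilinear_op_simps(5)] bil[THEN bilinear_op_simps(6)]
  bil[THEN bilinear_op_simps(7)] bil[THEN bilinear_op_simps(8)]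
  bil[THEN bilinear_op_simps(9)] bil[THEN bilinear_op_simps(10)]

lemma novikov:
  "r a (r b c) = r (r a b + l a b) c + r b (r a c) - r (r b a + l b a) c"
  "r a (l b c) = l (r a b) c + l b (l a c + r a c) - l (l b a) c"
  "r (l a b + r a b) c = l (r a c) b"
  "l (l a b) c = l (l a c) b"
  using pgd unfolding pre_PGD_def pre_GD_def pre_novikov_def by blast+

lemma gd:
  "l c (d a b - d b a) - d a (l c b) - l (d b c) a = - d b (l c a) - l (d a c) b"
  "r (d a b - d b a) c + d (l a b + r a b) c = r a (d b c) - d b (r a c) + l (d a c) b"
  "d (d a b) c - d a (d b c) = d (d b a) c - d b (d a c)"
  using pgd unfolding pre_PGD_def pre_GD_def left_symmetric_def by blast+

lemma poisson:
  "z a (z b c) = z (z b a + z a b) c"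
  "z (d a b - d b a) c = d a (z b c) - z b (d a c)"
  "d (z a b + z b a) c = z a (d b c) + z b (d a c)"
  using pgd unfolding pre_PGD_def pre_poisson_def zinbiel_def by blast+

lemma novikov_poisson:
  "r (z a b + z b a) c = z a (r b c)"
  "l (z a c) b = z a (l c b)" "z a (l c b) = z (l a b + r a b) c"
  "r a (z b c) = z (l a b + r a b) c + z b (r a c)"
  "l c (z a b + z b a) = z b (l c a) + z a (l c b)"
  using pgd unfolding pre_PGD_def pre_diff_novikov_poisson_def by blast+

text \<open>The value of \<open>a \<circ>\<^sub>\<lambda> b\<close> at \<open>\<lambda> = -p\<close> and \<open>\<partial> = p + q\<close>.\<close>

definition C :: "'k \<Rightarrow> 'k \<Rightarrow> 'a \<Rightarrow> 'a \<Rightarrow> 'a" where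
  "C p q a b = s q (l b a) - s p (r a b) + d a b"

definition lie :: "'k \<Rightarrow> 'k \<Rightarrow> 'a \<Rightarrow> 'a \<Rightarrow> 'a" where
  "lie p q a b = C p q a b - C q p b a"

lemmas scale_simps = scale_right_distrib scale_left_distrib scale_right_diff_distrib
  scale_left_diff_distrib

lemma C_bilinear: "bilinear_op s (C p q)"
proof -
  have "module_hom s s f" if "\<And>a b. f (a + b) = f a + f b" "\<And>c a. f (s c a) = s c (f a)" for f
    by (intro module_hom.intro module_axioms module_hom_axioms.intro that)
  then show ?thesis
    unfolding bilinear_op_def
    by (intro conjI allI Vector_Spaces.linear.intro vector_space_axioms)
       (simp_all add: C_def op_simps algebra_simps)
qed

lemmas C_simps = bilinear_op_simps[OF C_bilinear]

text \<open>Left-symmetry of the graded product, as a representation of its commutator.  The coefficients of the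
  monomials in the momenta vanish by the axioms of a pre-GD-algebra, with \<open>a\<close>, \<open>b\<close>, \<open>c\<close> permuted.\<close>

lemma C_left_symmetric:
  "C (p + q) t (lie p q a b) c = C p (q + t) a (C q t b c) - C q (p + t) b (C p t a c)"
proof -
  have "C (p + q) t (lie p q a b) c - (C p (q + t) a (C q t b c) - C q (p + t) b (C p t a c)) =
      s (t * t) (l (l c a) b - l (l c b) a)
    + s (q * t) (l c (l b a + r b a) - l (l c b) a + l (r b c) a - r b (l c a))
    - s (p * t) (l c (l a b + r a b) - l (l c a) b + l (r a c) b - r a (l c b))
    + s (q * q) (l (r b c) a - r (l b a + r b a) c)
    - s (p * p) (l (r a c) b - r (l a b + r a b) c)
    + s (p * q) (r (r a b + l a b) c + r b (r a c) - r (r b a + l b a) c - r a (r b c))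
    + s t (l c (d a b - d b a) - d a (l c b) - l (d b c) a - (- d b (l c a) - l (d a c) b))
    + s q (r (d b a - d a b) c + d (l b a + r b a) c - (r b (d a c) - d a (r b c) + l (d b c) a))
    - s p (r (d a b - d b a) c + d (l a b + r a b) c - (r a (d b c) - d b (r a c) + l (d a c) b))
    + (d (d a b) c - d a (d b c) - (d (d b a) c - d b (d a c)))"
    unfolding C_def lie_def by (simp add: op_simps algebra_simps)
  also have "\<dots> = 0"
  proof -
    have 1: "l c (l b a + r b a) - l (l c b) a + l (r b c) a - r b (l c a) = 0"
      "l c (l a b + r a b) - l (l c a) b + l (r a c) b - r a (l c b) = 0"
      using novikov(2)[of b c a] novikov(2)[of a c b] by (simp_all add: algebra_simps)
    have 2: "r (r a b + l a b) c + r b (r a c) - r (r b a + l b a) c - r a (r b c) = 0"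
      using novikov(1)[of a b c] by simp
    have 3: "l (r b c) a - r (l b a + r b a) c = 0" "l (r a c) b - r (l a b + r a b) c = 0"
      "l (l c a) b - l (l c b) a = 0"
      using novikov(3,4) by simp_all
    show ?thesis
      unfolding 1 2 3 gd(1)[of c a b] gd(2)[of b a c] gd(2)[of a b c] gd(3)[of a b c] by simp
  qed
  finally show ?thesis by simp
qed

text \<open>The two compatibilities of a pre-Poisson algebra for the graded product; the coefficients of the momenta
  are the axioms that link \<open>\<succ>\<close> to \<open>\<lhd>\<close>, \<open>\<rhd>\<close> and \<open>\<diamond>\<close>.\<close>

lemma C_z_derivation:
  "z (lie p q a b) c = C p (q + t) a (z b c) - z b (C p t a c)"
proof -
  have "z (lie p q a b) c - (C p (q + t) a (z b c) - z b (C p t a c)) =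
      s q (z (l b a + r b a) c - l (z b c) a) + s t (z b (l c a) - l (z b c) a)
    + s p (r a (z b c) - (z (l a b + r a b) c + z b (r a c)))
    + (z (d a b - d b a) c - (d a (z b c) - z b (d a c)))"
    unfolding C_def lie_def by (simp add: op_simps algebra_simps)
  also have "\<dots> = 0"
    unfolding novikov_poisson(4) poisson(2) novikov_poisson(2) novikov_poisson(3)[of b c a] by simp
  finally show ?thesis by simp
qed

lemma C_z_product:
  "C (p + q) t (z a b + z b a) c = z a (C q t b c) + z b (C p t a c)"
proof -
  have "C (p + q) t (z a b + z b a) c - (z a (C q t b c) + z b (C p t a c)) =
      s t (l c (z a b + z b a) - (z b (l c a) + z a (l c b)))
    - s q (r (z a b + z b a) c - z a (r b c)) - s p (r (z b a + z a b) c - z b (r a c))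
    + (d (z a b + z b a) c - (z a (d b c) + z b (d a c)))"
    unfolding C_def by (simp add: op_simps algebra_simps)
  also have "\<dots> = 0"
    unfolding novikov_poisson(1,5) poisson(3) by simp
  finally show ?thesis by simp
qed

lemma lie_jacobi:
  "lie p (q + t) a (lie q t b c) = lie (p + q) t (lie p q a b) c + lie q (p + t) b (lie p t a c)"
proof -
  have "C (q + t) p (lie q t b c) a = C q (p + t) b (C t p c a) - C t (p + q) c (C q p b a)"
    "C (p + q) t (lie p q a b) c = C p (q + t) a (C q t b c) - C q (p + t) b (C p t a c)"
    "C (p + t) q (lie p t a c) b = C p (q + t) a (C t q c b) - C t (p + q) c (C p q a b)"
    using C_left_symmetric[of q t p b c a] C_left_symmetric[of p q t a b c]
      C_left_symmetric[of p t q a c b] by (simp_all only: add.commute)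
  then show ?thesis
    unfolding lie_def[of p "q + t"] lie_def[of "p + q" t] lie_def[of q "p + t"]
    by (simp add: lie_def C_simps)
qed

text \<open>The fibre of \<open>P \<oplus> P\<^sup>*\<close>: pairs of a vector and a covector.\<close>

definition V :: "('a \<times> ('a \<Rightarrow> 'k)) set" where
  "V = {v. lin (snd v)}"

definition \<omega> :: "'a \<times> ('a \<Rightarrow> 'k) \<Rightarrow> 'a \<times> ('a \<Rightarrow> 'k) \<Rightarrow> 'k" where
  "\<omega> w v = snd v (fst w) - snd w (fst v)"

text \<open>In the second components the dual action is minus the transpose of left multiplication.  A covector of
  momentum \<open>q\<close> pairs with vectors of momentum \<open>-q\<close>, so the argument \<open>u\<close> of a covector of momentum
  \<open>p + q\<close> has momentum \<open>-p-q\<close>.  For \<open>\<succ>\<close> the representation carries the opposite sign.\<close>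

definition B :: "'k \<Rightarrow> 'k \<Rightarrow> 'a \<times> ('a \<Rightarrow> 'k) \<Rightarrow> 'a \<times> ('a \<Rightarrow> 'k) \<Rightarrow> 'a \<times> ('a \<Rightarrow> 'k)" where
  "B p q x y = (lie p q (fst x) (fst y),
     \<lambda>u. snd x (C q (- p - q) (fst y) u) - snd y (C p (- p - q) (fst x) u))"

definition M :: "'k \<Rightarrow> 'k \<Rightarrow> 'a \<times> ('a \<Rightarrow> 'k) \<Rightarrow> 'a \<times> ('a \<Rightarrow> 'k) \<Rightarrow> 'a \<times> ('a \<Rightarrow> 'k)" where
  "M p q x y = (z (fst x) (fst y) + z (fst y) (fst x),
     \<lambda>u. snd y (z (fst x) u) + snd x (z (fst y) u))"

lemma V_lin: "v \<in> V \<Longrightarrow> lin (snd v)"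
  by (simp add: V_def)

lemmas V_simps = V_lin[THEN lin_simps(1)] V_lin[THEN lin_simps(2)] V_lin[THEN lin_simps(3)]
  V_lin[THEN lin_simps(4)] V_lin[THEN lin_simps(5)]

lemma B_in: "x \<in> V \<Longrightarrow> y \<in> V \<Longrightarrow> B p q x y \<in> V"
  unfolding B_def V_def mem_Collect_eq snd_conv
  by (rule linI) (simp_all add: lin_simps C_simps algebra_simps)

lemma M_in: "x \<in> V \<Longrightarrow> y \<in> V \<Longrightarrow> M p q x y \<in> V"
  unfolding M_def V_def mem_Collect_eq snd_conv
  by (rule linI) (simp_all add: lin_simps op_simps algebra_simps)

lemma \<omega>_skew: "\<omega> v w = - \<omega> w v"
  by (simp add: \<omega>_def)

lemma lie_skew: "lie p q a b = - lie q p b a"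
  by (simp add: lie_def)

lemma B_skew:
  assumes "w \<in> V"
  shows "\<omega> w (B p q x y) = - \<omega> w (B q p y x)"
proof -
  have N: "- q - p = - p - q" by simp
  show ?thesis
    unfolding \<omega>_def B_def fst_conv snd_conv N lie_skew[of p q] using assms by (simp add: V_simps)
qed

lemma M_comm: "\<omega> w (M p q x y) = \<omega> w (M q p y x)"
  by (simp add: \<omega>_def M_def add.commute)

text \<open>The first components form the commutator algebra of a left-symmetric algebra.  In the second
  components each covector occurs composed with the left-symmetry identity for the other two vectors,
  the third momentum being that of the argument, \<open>N = -p-q-t\<close>.\<close>

lemma B_jacobi:
  assumes V: "x \<in> V" "y \<in> V" "v \<in> V" "w \<in> V"
  shows "\<omega> w (B p (q + t) x (B q t y v)) =
    \<omega> w (B (p + q) t (B p q x y) v) + \<omega> w (B q (p + t) y (B p t x v))"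
proof -
  define N where "N = - p - q - t"
  have N: "- p - (q + t) = N" "- (p + q) - t = N" "- q - (p + t) = N"
    "t + N = - p - q" "q + N = - p - t" "p + N = - q - t"
    by (simp_all add: N_def)
  note ls = C_left_symmetric[of q t N, unfolded N] C_left_symmetric[of p q N, unfolded N]
    C_left_symmetric[of p t N, unfolded N]
  show ?thesis
    unfolding \<omega>_def B_def fst_conv snd_conv N ls
    by (simp add: V_simps V lie_jacobi[of p q t])
qed

lemma M_assoc:
  assumes V: "x \<in> V" "y \<in> V" "v \<in> V" "w \<in> V"
  shows "\<omega> w (M (p + q) t (M p q x y) v) = \<omega> w (M p (q + t) x (M q t y v))"
  unfolding \<omega>_def M_def fst_conv snd_conv
  using V by (simp add: V_simps op_simps poisson(1) algebra_simps)

lemma BM_leibniz: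
  assumes V: "x \<in> V" "y \<in> V" "v \<in> V" "w \<in> V"
  shows "\<omega> w (B p (q + t) x (M q t y v)) =
    \<omega> w (M (p + q) t (B p q x y) v) + \<omega> w (M q (p + t) y (B p t x v))"
proof -
  define N where "N = - p - q - t"
  have N: "- p - (q + t) = N" "- (p + q) - t = N" "- q - (p + t) = N"
    "t + N = - p - q" "q + N = - p - t" "p + N = - q - t"
    by (simp_all add: N_def)
  have 1: "z (lie p q a b) u = C p (- p - t) a (z b u) - z b (C p N a u)"
    "z (lie p t a b) u = C p (- p - q) a (z b u) - z b (C p N a u)" for a b u
    using C_z_derivation[of p q a b u N] C_z_derivation[of p t a b u N] by (simp_all add: N)
  have 2: "C (q + t) N (z b c + z c b) u =
      C q (- p - q) b (z c u) + C t (- p - t) c (z b u)" for b c u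
    using C_z_product[of q t N b c u] C_z_derivation[of q t b c u N]
      C_z_derivation[of t q c b u N] lie_skew[of t q c b] by (simp add: N op_simps) (simp add: algebra_simps)
  have 3: "lie p (q + t) a (z b c + z c b) =
      z (lie p q a b) c + z c (lie p q a b) + (z b (lie p t a c) + z (lie p t a c) b)" for a b c
  proof -
    have "C (q + t) p (z b c + z c b) a = z b (C t p c a) + z c (C q p b a)" by (rule C_z_product)
    then show ?thesis
      using C_z_derivation[of p q a b c t] C_z_derivation[of p t a c b q]
      by (simp add: lie_def[of p "q + t"] C_simps add.commute) (simp add: lie_def op_simps)
  qed
  show ?thesis
    unfolding \<omega>_def B_def M_def fst_conv snd_conv N 1 2 3
    by (simp add: V_simps V op_simps)
qed

text \<open>Each of the three covectors occurs twice with each sign, at equal momenta as these add up to zero.\<close>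

lemma B_cocycle:
  assumes V: "x \<in> V" "y \<in> V" "v \<in> V" and 0: "p + q + t = 0"
  shows "\<omega> x (B q t y v) + \<omega> y (B t p v x) + \<omega> v (B p q x y) = 0"
proof -
  have N: "- q - t = p" "- t - p = q" "- p - q = t"
    using 0 by algebra+
  show ?thesis
    unfolding \<omega>_def B_def fst_conv snd_conv N lie_def by (simp add: V_simps V)
qed

lemma M_cocycle:
  assumes V: "x \<in> V" "y \<in> V" "v \<in> V"
  shows "\<omega> x (M q t y v) + \<omega> y (M t p v x) + \<omega> v (M p q x y) = 0"
  unfolding \<omega>_def M_def fst_conv snd_conv by (simp add: V_simps V)

text \<open>The vector \<open>w'\<close> is read off from \<open>\<omega> w (B p q x u)\<close> as a linear form in the two components of \<open>u\<close>.\<close>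

lemma B_adjoint:
  assumes V: "x \<in> V" "w \<in> V"
  shows "\<exists>w'\<in>V. \<forall>u\<in>V. \<omega> w (B p q x u) = \<omega> w' u"
proof
  let ?w = "(- C p (- p - q) (fst x) (fst w),
    \<lambda>b. snd w (lie p q (fst x) b) - snd x (C q (- p - q) b (fst w)))"
  show "?w \<in> V"
    unfolding V_def mem_Collect_eq snd_conv
    by (rule linI) (use V in \<open>simp_all add: V_simps lie_def C_simps algebra_simps\<close>)
  show "\<forall>u\<in>V. \<omega> w (B p q x u) = \<omega> ?w u"
    unfolding \<omega>_def B_def by (simp add: V_simps)
qed

lemma M_adjoint:
  assumes V: "x \<in> V" "w \<in> V"
  shows "\<exists>w'\<in>V. \<forall>u\<in>V. \<omega> w (M p q x u) = \<omega> w' u"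
proof
  let ?w = "(z (fst x) (fst w), \<lambda>b. snd w (z (fst x) b + z b (fst x)) - snd x (z b (fst w)))"
  show "?w \<in> V"
    unfolding V_def mem_Collect_eq snd_conv
    by (rule linI) (use V in \<open>simp_all add: V_simps op_simps algebra_simps\<close>)
  show "\<forall>u\<in>V. \<omega> w (M p q x u) = \<omega> ?w u"
    unfolding \<omega>_def M_def by simp
qed

lemma B_adjoint_left:
  assumes V: "x \<in> V" "w \<in> V"
  shows "\<exists>w'\<in>V. \<forall>u\<in>V. \<omega> w (B p q u x) = \<omega> w' u"
proof -
  obtain w' where w': "w' \<in> V" "\<forall>u\<in>V. \<omega> w (B q p x u) = \<omega> w' u"
    using B_adjoint[OF V] by blast
  have "- w' \<in> V"
    unfolding V_def mem_Collect_eq by (rule linI) (use w' in \<open>simp_all add: V_simps\<close>)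
  moreover have "\<omega> w (B p q u x) = \<omega> (- w') u" if "u \<in> V" for u
    using that V w' B_skew[OF V(2), of p q u x] by (simp add: \<omega>_def V_simps)
  ultimately show ?thesis by blast
qed

lemma M_adjoint_left:
  assumes V: "x \<in> V" "w \<in> V"
  shows "\<exists>w'\<in>V. \<forall>u\<in>V. \<omega> w (M p q u x) = \<omega> w' u"
  using M_adjoint[OF V, of q p] by (subst M_comm)

lemma B_affine:
  assumes V: "x \<in> V" "y \<in> V" "w \<in> V"
  shows "\<omega> w (B p q x y) = \<omega> w (B 0 0 x y) + p * (\<omega> w (B 1 0 x y) - \<omega> w (B 0 0 x y))
        + q * (\<omega> w (B 0 1 x y) - \<omega> w (B 0 0 x y))"
  using V by (simp add: \<omega>_def B_def lie_def C_def V_simps algebra_simps)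

lemma M_const: "\<omega> w (M p q x y) = \<omega> w (M 0 0 x y)"
  by (simp add: M_def)

end

section \<open>The semi-direct product in momentum space\<close>

lemma peval_coeff_cong:
  assumes "f 0 = 0" "g 0 = 0" "\<And>k. f (coeff p k) = g (coeff q k)"
  shows "peval f t p = peval g t q"
  using assms
  by (simp add: peval_bound[where f = f and n = "max (degree p) (degree q)"]
      peval_bound[where f = g and n = "max (degree p) (degree q)"])

lemma additive_id: "additive (\<lambda>x. x)"
  by unfold_locales (rule refl)

lemma poly_poly_eqI:
  fixes P R :: "'k::field_char_0 poly poly"
  assumes "\<And>m l. peval (peval (\<lambda>x. x) m) l P = peval (peval (\<lambda>x. x) m) l R"
  shows "P = R"
proof -
  have "coeff (coeff (P - R) k) j = 0" for k j
  proof (rule peval_zero_imp[where f = "\<lambda>x. x"])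
    fix m
    show "peval (\<lambda>x. x) m (coeff (P - R) k) = 0"
      by (rule peval_zero_imp)
         (use assms in \<open>auto simp: peval_diff[OF additive_peval[OF additive_id]]\<close>)
  qed simp
  then show ?thesis by (simp add: poly_eq_iff)
qed

lemma additive_poly_at: "additive (\<lambda>f :: 'b \<Rightarrow> 'k::comm_ring_1 poly. poly (f u) y)"
  by unfold_locales simp

text \<open>In \<open>k[\<lambda>, \<mu>]\<close> at \<open>\<lambda> = l\<close>, \<open>\<mu> = m\<close>, the parameter \<open>\<mu> - \<lambda>\<close> of \<open>f\<close> takes the value \<open>m - l\<close>.\<close>

lemma lsubst_dual_shift:
  "peval (peval (\<lambda>x. x) m) l (dual_shift f p) = peval (\<lambda>w. peval (\<lambda>x. x) (m - l) (f w)) l p"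
proof -
  note ad = additive_peval2[OF additive_id]
  have "peval (peval (\<lambda>x. x) m) l (lsubst (\<lambda>x. mu_op x - lam_op x) (\<lambda>c. [:[:c:]:]) h) =
      peval (\<lambda>x. x) (m - l) h" for h
    by (subst lsubst_eigen[where M = UNIV and t = "m - l", OF ad])
       (simp_all add: additive.diff[OF ad] lam_op_eigen mu_op_eigen additive_id ring_distribs)
  then show ?thesis
    unfolding dual_shift_def
    by (subst lsubst_eigen[where M = UNIV and t = l, OF ad]) (simp_all add: lam_op_eigen additive_id)
qed

locale pre_PGD_basis = pre_PGD_algebra s l r z d
  for s :: "'k::field_char_0 \<Rightarrow> 'a::ab_group_add \<Rightarrow> 'a" and l r z d +
  fixes n :: nat and e :: "nat \<Rightarrow> 'a" and es :: "nat \<Rightarrow> 'a \<Rightarrow> 'k"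
  assumes span_e: "span (e ` {1..n}) = UNIV"
    and lin_es: "i \<in> {1..n} \<Longrightarrow> lin (es i)"
    and es_e: "i \<in> {1..n} \<Longrightarrow> j \<in> {1..n} \<Longrightarrow> es i (e j) = (if i = j then 1 else 0)"
begin

lemma basis_induct:
  assumes "S 0" "\<And>a b. S a \<Longrightarrow> S b \<Longrightarrow> S (a + b)" "\<And>c a. S a \<Longrightarrow> S (s c a)"
    and "\<And>i. i \<in> {1..n} \<Longrightarrow> S (e i)"
  shows "S a"
proof -
  have "a \<in> span (e ` {1..n})" using span_e by simp
  then show ?thesis by (induction rule: span_induct_alt) (use assms in auto)
qed

lemma coordinates:
  assumes "lin \<phi>"
  shows "\<phi> a = (\<Sum>i=1..n. es i a * \<phi> (e i))"
proof (induction a rule: basis_induct)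
  case (4 j)
  have "(\<Sum>i=1..n. es i (e j) * \<phi> (e i)) = (\<Sum>i=1..n. if i = j then \<phi> (e i) else 0)"
    by (rule sum.cong) (use 4 es_e in auto)
  then show ?case using 4 by simp
qed (use assms lin_es in \<open>simp_all add: lin_simps ring_distribs sum.distrib sum_distrib_left mult.assoc\<close>)

lemma lin_separate:
  assumes "\<And>\<phi>. lin \<phi> \<Longrightarrow> \<phi> a = 0"
  shows "a = 0"
proof -
  have "a = (\<Sum>i=1..n. s (es i a) (e i))"
  proof (induction a rule: basis_induct)
    case (4 j)
    have "(\<Sum>i=1..n. s (es i (e j)) (e i)) = (\<Sum>i=1..n. if i = j then e i else 0)"
      by (rule sum.cong) (use 4 es_e in auto)
    then show ?case using 4 by simp
  next
    case (3 c a)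
    have "(\<Sum>i=1..n. s (es i (s c a)) (e i)) = s c (\<Sum>i=1..n. s (es i a) (e i))"
      using lin_es by (simp add: lin_simps scale_sum_right)
    then show ?case using 3 by simp
  qed (use lin_es in \<open>simp_all add: lin_simps scale_left_distrib sum.distrib scale_sum_right\<close>)
  also have "\<dots> = 0" using assms[OF lin_es] by (intro sum.neutral) simp
  finally show ?thesis .
qed

text \<open>Setting \<open>\<partial> = x\<close> in an element of \<open>P = k[\<partial>] \<otimes> A\<close>.\<close>

definition peval_vec :: "'k \<Rightarrow> 'a poly \<Rightarrow> 'a" where
  "peval_vec x p = (\<Sum>k\<le>degree p. s (x ^ k) (coeff p k))"

lemma additive_lin: "lin \<phi> \<Longrightarrow> additive \<phi>"
  by unfold_locales (simp add: lin_simps)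

lemma lin_peval_vec: "lin \<phi> \<Longrightarrow> \<phi> (peval_vec x p) = peval \<phi> x p"
  by (simp add: peval_vec_def peval_def additive.sum[OF additive_lin] lin_simps mult.commute)

lemma peval_vec_const [simp]: "peval_vec x [:a:] = a"
  by (simp add: peval_vec_def)

lemma lin_eqI: "(\<And>\<phi>. lin \<phi> \<Longrightarrow> \<phi> a = \<phi> b) \<Longrightarrow> a = b"
  using lin_separate[of "a - b"] by (simp add: lin_simps)

lemma peval_vec_pCons: "peval_vec x (pCons a p) = a + s x (peval_vec x p)"
  by (rule lin_eqI) (simp add: lin_peval_vec lin_simps peval_pCons)

lemma peval_vec_add: "peval_vec x (p + p') = peval_vec x p + peval_vec x p'"
  by (rule lin_eqI) (simp add: lin_peval_vec lin_simps peval_add additive_lin)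

lemma peval_vec_scale: "peval_vec x (map_poly (s c) p) = s c (peval_vec x p)"
  by (rule lin_eqI) (simp add: lin_peval_vec lin_simps peval_map_poly peval_scale)

lemma lin_comp:
  assumes "bilinear_op s m" "lin \<phi>"
  shows "lin (\<lambda>b. \<phi> (m a b))" "lin (\<lambda>a. \<phi> (m a b))"
  by (rule linI; simp add: lin_simps[OF assms(2)] bilinear_op_simps[OF assms(1)])+

text \<open>In \<open>P[\<lambda>]\<close> at \<open>\<lambda> = t\<close>, \<open>\<partial> = x\<close> the operators \<open>-\<lambda>\<close> and \<open>\<partial> + \<lambda>\<close> that extend the product from \<open>A\<close> to \<open>P\<close> are the scalars
  \<open>-t\<close> and \<open>x + t\<close>, and their powers recombine to the values of the arguments at these momenta.\<close>

lemma peval2_sesq_ext: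
  assumes \<phi>: "lin \<phi>" and N: "bilinear_op s N"
    and m: "\<And>a b. peval (peval \<phi> x) t (m a b) = \<phi> (N a b)"
  shows "peval (peval \<phi> x) t (sesq_ext m p q) = \<phi> (N (peval_vec (- t) p) (peval_vec (x + t) q))"
proof -
  note ad = additive_peval2[OF additive_lin[OF \<phi>]]
  define \<Phi> where "\<Phi> = peval (peval \<phi> x) t"
  have ad': "additive \<Phi>" using ad by (simp add: \<Phi>_def)
  have 1: "\<Phi> (- pCons 0 y) = (- t) * \<Phi> y" for y
    by (simp add: \<Phi>_def additive.minus[OF ad] peval_pCons lin_simps[OF \<phi>] del: minus_pCons)
  have 2: "\<Phi> (map_poly (pCons 0) y + pCons 0 y) = (x + t) * \<Phi> y" for y
    using mu_op_eigen[OF additive_lin[OF \<phi>], of x t y] lin_simps[OF \<phi>]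
    by (simp add: \<Phi>_def additive.add[OF ad] peval_pCons mu_op_def ring_distribs)
  have pow: "\<Phi> ((T ^^ k) y) = c ^ k * \<Phi> y" if "\<And>y. \<Phi> (T y) = c * \<Phi> y" for T c k y
    by (induction k) (use that in auto)
  have "\<Phi> (sesq_ext m p q) = (\<Sum>i\<le>degree p. \<Sum>j\<le>degree q.
      (- t) ^ i * ((x + t) ^ j * \<phi> (N (coeff p i) (coeff q j))))"
    unfolding sesq_ext_def
    by (simp add: additive.sum[OF ad'] pow[OF 1] pow[OF 2] m[folded \<Phi>_def] del: minus_pCons)
  also have "\<dots> = (\<Sum>i\<le>degree p. (- t) ^ i * peval (\<lambda>b. \<phi> (N (coeff p i) b)) (x + t) q)"
    by (simp add: peval_def sum_distrib_left mult_ac)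
  also have "\<dots> = peval (\<lambda>a. \<phi> (N a (peval_vec (x + t) q))) (- t) p"
    by (simp add: peval_def[of _ "- t"] lin_peval_vec[OF lin_comp(1)[OF N \<phi>], symmetric] mult_ac)
  also have "\<dots> = \<phi> (N (peval_vec (- t) p) (peval_vec (x + t) q))"
    by (rule lin_peval_vec[OF lin_comp(2)[OF N \<phi>], symmetric])
  finally show ?thesis by (simp add: \<Phi>_def)
qed

text \<open>The analogue for products on \<open>P\<close> of \<open>represents\<close>, with linear forms on \<open>A\<close> in place of \<open>\<omega>\<close>.\<close>

definition has_symbol :: "('a poly \<Rightarrow> 'a poly \<Rightarrow> 'a poly poly) \<Rightarrow> ('k \<Rightarrow> 'k \<Rightarrow> 'a \<Rightarrow> 'a \<Rightarrow> 'a) \<Rightarrow> bool" where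
  "has_symbol m N \<longleftrightarrow> (\<forall>p q. bilinear_op s (N p q)) \<and>
     (\<forall>\<phi> x t p q. lin \<phi> \<longrightarrow>
        peval (peval \<phi> x) t (m p q) = \<phi> (N (- t) (x + t) (peval_vec (- t) p) (peval_vec (x + t) q)))"

lemma circ_symbol: "has_symbol (circ_lam l r d) C"
  unfolding has_symbol_def circ_lam_def
  by (intro conjI allI impI C_bilinear peval2_sesq_ext)
     (auto simp: peval_pCons lin_simps C_def algebra_simps)

lemma succ_symbol: "has_symbol (succ_lam z) (\<lambda>p q. z)"
  unfolding has_symbol_def succ_lam_def
  by (intro conjI allI impI bil peval2_sesq_ext) auto

lemma has_symbolD:
  assumes "has_symbol m N"
  shows "bilinear_op s (N p q)"
    and "lin \<phi> \<Longrightarrow> peval (peval \<phi> x) t (m a b) =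
      \<phi> (N (- t) (x + t) (peval_vec (- t) a) (peval_vec (x + t) b))"
  using assms unfolding has_symbol_def by auto

lemma peval2_opposite:
  assumes "has_symbol m N" "lin \<phi>"
  shows "peval (peval \<phi> x) t (skew_subst (pCons 0) (m b a)) =
    \<phi> (N (x + t) (- t) (peval_vec (x + t) b) (peval_vec (- t) a))"
proof -
  have "peval (peval \<phi> x) t (skew_subst (pCons 0) (m b a)) = peval (peval \<phi> x) (- t - x) (m b a)"
    by (rule peval_skew_subst[where M = UNIV, OF additive_peval[OF additive_lin[OF assms(2)]]])
       (use assms(2) in \<open>auto simp: peval_pCons lin_simps\<close>)
  then show ?thesis by (simp add: has_symbolD[OF assms(1)] assms(2) algebra_simps)
qed

lemma conf_dual_simps:
  assumes "f \<in> conf_dual s"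
  shows "f (u + v) = f u + f v" "f (map_poly (s c) u) = smult c (f u)" "f (pCons 0 u) = pCons 0 (f u)"
  using assms by (auto simp: conf_dual_def)

lemma conf_dual_lin: "f \<in> conf_dual s \<Longrightarrow> lin (\<lambda>a. poly (f [:a:]) y)"
  using conf_dual_simps(1)[of f "[:a:]" "[:b:]" for a b] conf_dual_simps(2)[of f _ "[:a:]" for a]
  by (intro linI) (simp_all add: map_poly_pCons)

text \<open>An element of the conformal dual is determined by its restriction to \<open>A\<close>, since \<open>\<partial>\<close> acts on its argument as
  multiplication by the parameter.\<close>

lemma conf_dual_eval:
  assumes f: "f \<in> conf_dual s"
  shows "poly (f w) y = poly (f [:peval_vec y w:]) y"
proof (induction w)
  case 0
  have "f 0 = 0" using conf_dual_simps(1)[OF f, of 0 0] by simp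
  then show ?case using lin_simps(5)[OF conf_dual_lin[OF f, of y]] by (simp add: peval_vec_def)
next
  case (pCons a w)
  have "f (pCons a w) = f [:a:] + pCons 0 (f w)"
    using conf_dual_simps(1)[OF f, of "[:a:]" "pCons 0 w"] conf_dual_simps(3)[OF f, of w] by simp
  then show ?case
    using pCons lin_simps[OF conf_dual_lin[OF f, of y]] by (simp add: peval_vec_pCons)
qed

lemma peval_id: "peval (\<lambda>x. x) y p = poly p y"
  by (simp add: peval_eq_poly)

lemma dual_shift_eval:
  assumes g: "g \<in> conf_dual s" and m: "has_symbol m N"
  shows "peval (peval (\<lambda>x. x) y) t (dual_shift g (m a u)) =
    poly (g [:N (- t) y (peval_vec (- t) a) (peval_vec y u):]) (y - t)"
proof -
  have "peval (peval (\<lambda>x. x) y) t (dual_shift g (m a u)) = peval (\<lambda>w. poly (g w) (y - t)) t (m a u)"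
    by (simp add: lsubst_dual_shift peval_id)
  also have "\<dots> = peval (\<lambda>w. poly (g [:peval_vec (y - t) w:]) (y - t)) t (m a u)"
    by (rule peval_cong) (rule conf_dual_eval[OF g])
  also have "\<dots> = peval (peval (\<lambda>a. poly (g [:a:]) (y - t)) (y - t)) t (m a u)"
    by (simp add: lin_peval_vec[OF conf_dual_lin[OF g]])
  finally show ?thesis by (simp add: has_symbolD(2)[OF m conf_dual_lin[OF g]])
qed

context
  fixes g :: "'a poly \<Rightarrow> 'k poly" and m :: "'a poly \<Rightarrow> 'a poly \<Rightarrow> 'a poly poly" and N
    and a :: "'a poly"
  assumes g: "g \<in> conf_dual s" and m: "has_symbol m N"
begin

private abbreviation "D u \<equiv> dual_shift g (m a u)"

private lemmas D_eval = dual_shift_eval[OF g m, where a = a]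

private lemmas N_simps = bilinear_op_simps[OF has_symbolD(1)[OF m]]

lemma dual_shift_add: "D (u + v) = D u + D v"
  by (rule poly_poly_eqI)
     (simp add: D_eval peval_add additive_peval[OF additive_id] peval_vec_add N_simps
       lin_simps[OF conf_dual_lin[OF g]])

lemma dual_shift_scale: "D (map_poly (s c) u) = map_poly (smult c) (D u)"
proof (rule poly_poly_eqI)
  fix y t
  have "peval (\<lambda>x. x) y (smult c p) = c * peval (\<lambda>x. x) y p" for p by (simp add: peval_id)
  then show "peval (peval (\<lambda>x. x) y) t (D (map_poly (s c) u)) =
      peval (peval (\<lambda>x. x) y) t (map_poly (smult c) (D u))"
    by (simp add: D_eval peval_vec_scale N_simps lin_simps[OF conf_dual_lin[OF g]] peval_map_poly peval_scale)
qed

lemma dual_shift_der: "D (pCons 0 u) = mu_op (D u)"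
  by (rule poly_poly_eqI)
     (simp add: D_eval mu_op_eigen additive_id peval_vec_pCons N_simps
       lin_simps[OF conf_dual_lin[OF g]])

text \<open>Replacing \<open>u\<close> by \<open>\<partial>u\<close> multiplies by the inner variable \<open>\<mu>\<close> (\<open>dual_shift_der\<close>) and so keeps the degree in
  \<open>\<lambda>\<close>; on \<open>A\<close> the degree is bounded by its values on a basis.  Hence the sequence to which \<open>Abs_poly\<close> is
  applied in \<open>dual_act\<close> has finite support.\<close>

lemma dual_shift_degree: "\<exists>k. \<forall>u. degree (D u) \<le> k"
proof -
  define k where "k = (\<Sum>i=1..n. degree (D [:e i:]))"
  have D0: "D 0 = 0" using dual_shift_add[of 0 0] by simp
  have const: "degree (D [:b:]) \<le> k" for b
  proof (induction b rule: basis_induct)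
    case (2 a b)
    have "D [:a + b:] = D [:a:] + D [:b:]" using dual_shift_add[of "[:a:]" "[:b:]"] by simp
    then show ?case using 2 by (simp add: degree_add_le)
  next
    case (3 c b)
    have "D [:s c b:] = map_poly (smult c) (D [:b:])"
      using dual_shift_scale[of c "[:b:]"] by (simp add: map_poly_pCons)
    then show ?case using 3 map_poly_degree_leq[of "smult c" "D [:b:]"] by simp
  next
    case (4 i)
    then show ?case unfolding k_def by (intro member_le_sum) auto
  qed (simp add: D0)
  have "degree (D u) \<le> k" for u
  proof (induction u)
    case (pCons b u)
    have "D (pCons b u) = D [:b:] + mu_op (D u)"
      using dual_shift_add[of "[:b:]" "pCons 0 u"] dual_shift_der[of u] by simp
    moreover have "degree (mu_op (D u)) \<le> k"
      using pCons(2) map_poly_degree_leq[of "pCons 0" "D u"] by (simp add: mu_op_def)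
    ultimately show ?case using const by (simp add: degree_add_le)
  qed (simp add: D0)
  then show ?thesis by blast
qed

lemma coeff_dual_act: "coeff (dual_act m a g) j u = - coeff (D u) j"
proof -
  obtain k where k: "\<And>u. degree (D u) \<le> k" using dual_shift_degree by blast
  have "(\<lambda>j u. - coeff (D u) j) \<in> {f. \<forall>\<^sub>\<infinity>j. f j = 0}"
    unfolding mem_Collect_eq MOST_nat
  proof (intro exI[of _ k] allI impI ext)
    fix j u assume "k < j"
    then have "degree (D u) < j" using k[of u] by simp
    then show "- coeff (D u) j = 0 u" by (simp add: coeff_eq_0)
  qed
  then show ?thesis by (simp add: dual_act_def Abs_poly_inverse)
qed

lemma dual_act_in: "coeff (dual_act m a g) j \<in> conf_dual s"
  unfolding conf_dual_def
  by (auto simp: coeff_dual_act dual_shift_add dual_shift_scale dual_shift_der coeff_map_poly mu_op_def)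

lemma dual_act_eval:
  "peval (\<lambda>f. poly (f [:c:]) y) t (dual_act m a g) = - poly (g [:N (- t) y (peval_vec (- t) a) c:]) (y - t)"
proof -
  have "peval (\<lambda>f. poly (f [:c:]) y) t (dual_act m a g) = peval (\<lambda>p. - peval (\<lambda>x. x) y p) t (D [:c:])"
    by (rule peval_coeff_cong) (simp_all add: coeff_dual_act peval_id)
  then show ?thesis by (simp add: peval_uminus D_eval)
qed

end

lemma conf_dual_closed:
  "0 \<in> conf_dual s" "f \<in> conf_dual s \<Longrightarrow> g \<in> conf_dual s \<Longrightarrow> f + g \<in> conf_dual s"
  "f \<in> conf_dual s \<Longrightarrow> - f \<in> conf_dual s" "f \<in> conf_dual s \<Longrightarrow> der_dual f \<in> conf_dual s"
  "f \<in> conf_dual s \<Longrightarrow> (\<lambda>u. smult c (f u)) \<in> conf_dual s"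
  by (auto simp: conf_dual_def der_dual_def smult_add_right mult.commute)

lemma conf_dual_diff: "f \<in> conf_dual s \<Longrightarrow> g \<in> conf_dual s \<Longrightarrow> f - g \<in> conf_dual s"
  using conf_dual_closed(2)[of f "- g"] conf_dual_closed(3) by simp

lemma der_dual_zero: "der_dual 0 = 0"
  by (auto simp: der_dual_def)

text \<open>The term \<open>L\<^sup>*(b)\<^bsub>-\<lambda>-\<partial>\<^esub> f\<close> of the semi-direct product.\<close>

lemma opposite_in:
  assumes "g \<in> conf_dual s" "has_symbol m N"
  shows "coeff (skew_subst der_dual (dual_act m a g)) j \<in> conf_dual s"
  by (rule skew_subst_closed) (simp_all add: conf_dual_closed dual_act_in[OF assms] der_dual_zero)

lemma opposite_eval:
  assumes "g \<in> conf_dual s" "has_symbol m N"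
  shows "peval (\<lambda>f. poly (f [:c:]) (- x)) t (skew_subst der_dual (dual_act m a g)) =
    - poly (g [:N (x + t) (- x) (peval_vec (x + t) a) c:]) t"
proof -
  have "peval (\<lambda>f. poly (f [:c:]) (- x)) t (skew_subst der_dual (dual_act m a g)) =
    peval (\<lambda>f. poly (f [:c:]) (- x)) (- t - x) (dual_act m a g)"
    by (rule peval_skew_subst[where M = UNIV, OF additive_poly_at])
       (auto simp: der_dual_zero, simp add: der_dual_def)
  then show ?thesis by (simp add: dual_act_eval[OF assms] add.commute)
qed

abbreviation Q where "Q \<equiv> semidirect s l r z d"

text \<open>As \<open>\<partial>\<close> acts on the conformal dual by \<open>-\<lambda>\<close>, setting \<open>\<partial> = x\<close> there amounts to evaluating at the parameter \<open>-x\<close>.\<close>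

definition ev :: "'k \<Rightarrow> 'a poly \<times> ('a poly \<Rightarrow> 'k poly) \<Rightarrow> 'a \<times> ('a \<Rightarrow> 'k)" where
  "ev x q = (peval_vec x (fst q), \<lambda>u. poly (snd q [:u:]) (- x))"

lemma car_Q: "car Q = UNIV \<times> conf_dual s" and scl_Q: "scl Q c q = (map_poly (s c) (fst q), \<lambda>u. smult c (snd q u))"
  and der_Q: "der Q q = (pCons 0 (fst q), der_dual (snd q))"
  by (auto simp: semidirect_def split: prod.split)

lemma kd_module_Q: "kd_module Q"
  unfolding kd_module_def
proof (intro conjI ballI allI)
  show vs: "vector_space (scl Q)"
    by unfold_locales
      (auto simp: scl_Q poly_eq_iff coeff_map_poly scale_simps fun_eq_iff smult_add_right smult_add_left)
  interpret vs: vector_space "scl Q" by (rule vs)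
  show "vs.subspace (car Q)"
    unfolding vs.subspace_def by (auto simp: car_Q scl_Q conf_dual_closed zero_prod_def)
  show "der Q x \<in> car Q" if "x \<in> car Q" for x
    using that by (auto simp: car_Q der_Q conf_dual_closed)
qed (auto simp: der_Q scl_Q map_poly_pCons der_dual_def fun_eq_iff)

lemma \<omega>_ev: "v \<in> V \<Longrightarrow> \<omega> v (ev x q) = poly (snd q [:fst v:]) (- x) - peval (snd v) x (fst q)"
  by (simp add: \<omega>_def ev_def lin_peval_vec V_lin)

lemma ev_in: "q \<in> car Q \<Longrightarrow> ev x q \<in> V"
  by (auto simp: car_Q V_def ev_def intro!: conf_dual_lin)

sublocale momentum_space Q V ev \<omega>
proof (rule momentum_space.intro)
  show "kd_module Q" by (rule kd_module_Q)
  show "ev x q \<in> V" if "q \<in> car Q" for x q by (rule ev_in[OF that])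
  fix w assume w: "w \<in> V"
  note w' = V_lin[OF w] additive_lin[OF V_lin[OF w]]
  show "additive (\<lambda>q. \<omega> w (ev x q))" for x
    by (rule additive.intro) (simp add: \<omega>_ev w peval_add w')
  show "\<omega> w (ev x (scl Q c q)) = c * \<omega> w (ev x q)" for x c q
    by (simp add: \<omega>_ev w scl_Q peval_map_poly lin_simps[OF w'(1)] peval_scale right_diff_distrib)
  show "\<omega> w (ev x (der Q q)) = x * \<omega> w (ev x q)" for x q
    by (simp add: \<omega>_ev w der_Q der_dual_def peval_pCons lin_simps[OF w'(1)] right_diff_distrib)
  show "\<omega> v w = - \<omega> w v" for v by (rule \<omega>_skew)
next
  fix q assume q: "q \<in> car Q" and 0: "\<And>x w. w \<in> V \<Longrightarrow> \<omega> w (ev x q) = 0"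
  obtain p f where [simp]: "q = (p, f)" by (cases q)
  have f: "f \<in> conf_dual s" using q by (simp add: car_Q)
  have lin0: "lin (\<lambda>_. 0)" by (rule linI) simp_all
  have "coeff p k = 0" for k
  proof (rule lin_separate)
    fix \<phi> assume \<phi>: "lin \<phi>"
    have "(0, \<phi>) \<in> V" using \<phi> by (simp add: V_def)
    then have "peval \<phi> x p = 0" for x
      using 0[of "(0, \<phi>)" x] lin_simps(5)[OF conf_dual_lin[OF f]] by (simp add: \<omega>_ev)
    then show "\<phi> (coeff p k) = 0"
      by (rule peval_zero_imp[where f = \<phi>, OF lin_simps(5)[OF \<phi>]])
  qed
  then have "p = 0" by (simp add: poly_eq_iff)
  moreover have "f u = 0" for u
  proof -
    have "poly (f [:a:]) y = 0" for a y
    proof -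
      have "(a, \<lambda>_. 0) \<in> V" using lin0 by (simp add: V_def)
      then show ?thesis using 0[of "(a, \<lambda>_. 0)" "- y"] by (simp add: \<omega>_ev peval_zero_fun)
    qed
    then have "\<forall>y. poly (f u) y = 0" using conf_dual_eval[OF f, of u] by simp
    then show ?thesis by (simp only: poly_all_0_iff_0)
  qed
  ultimately show "q = 0" by (simp add: zero_prod_def fun_eq_iff)
qed

lemma coeff_pair_poly: "coeff (pair_poly p h) k = (coeff p k, coeff h k)"
  by (simp add: pair_poly_def coeff_map_poly zero_prod_def)

lemma peval_pair_poly:
  assumes "w \<in> V"
  shows "peval (\<lambda>q. \<omega> w (ev x q)) t (pair_poly p h) =
    peval (\<lambda>f. poly (f [:fst w:]) (- x)) t h - peval (peval (snd w) x) t p"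
proof -
  note w' = V_lin[OF assms] additive_lin[OF V_lin[OF assms]]
  have 1: "peval (\<lambda>q. poly (snd q [:fst w:]) (- x)) t (pair_poly p h) =
      peval (\<lambda>f. poly (f [:fst w:]) (- x)) t h"
    by (rule peval_coeff_cong) (simp_all add: coeff_pair_poly)
  have 2: "peval (\<lambda>q. peval (snd w) x (fst q)) t (pair_poly p h) = peval (peval (snd w) x) t p"
    by (rule peval_coeff_cong) (simp_all add: coeff_pair_poly lin_simps[OF w'(1)])
  show ?thesis
    by (simp add: \<omega>_ev assms peval_diff_fun 1 2)
qed

text \<open>The second component of \<open>B\<close> was defined so as to be the value of \<open>L\<^sup>*(a)\<^sub>\<lambda> g - L\<^sup>*(b)\<^bsub>-\<lambda>-\<partial>\<^esub> f\<close> at \<open>\<lambda> = t\<close>, \<open>\<partial> = x\<close>.\<close>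

lemma brk_represented: "represents (brk Q) B"
  unfolding represents_def E_def
proof (intro conjI ballI allI)
  fix q q' assume q: "q \<in> car Q" "q' \<in> car Q"
  obtain a f b g where [simp]: "q = (a, f)" "q' = (b, g)" by (cases q, cases q')
  have fg: "f \<in> conf_dual s" "g \<in> conf_dual s" using q by (auto simp: car_Q)
  have br: "brk Q q q' = pair_poly (brk_P l r d a b) (dual_act (circ_lam l r d) a g
               - skew_subst der_dual (dual_act (circ_lam l r d) b f))"
    by (simp add: semidirect_def)
  show "coeff (brk Q q q') k \<in> car Q" for k
    unfolding br by (simp add: car_Q coeff_pair_poly conf_dual_diff dual_act_in[OF _ circ_symbol]
        opposite_in[OF _ circ_symbol] fg)
  fix x t w assume w: "w \<in> V"
  note w' = V_lin[OF w] additive_lin[OF V_lin[OF w]]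
  show "peval (\<lambda>q. \<omega> w (ev x q)) t (brk Q q q') = \<omega> w (B (- t) (x + t) (ev (- t) q) (ev (x + t) q'))"
    unfolding br by (simp add: peval_pair_poly w peval_diff[OF additive_poly_at] dual_act_eval[OF _ circ_symbol]
        opposite_eval[OF _ circ_symbol] fg brk_P_def peval_diff[OF additive_peval[OF w'(2)]]
        has_symbolD(2)[OF circ_symbol] peval2_opposite[OF circ_symbol] w')
      (simp add: \<omega>_def B_def lie_def ev_def lin_simps[OF w'(1)])
qed (simp_all add: B_in B_adjoint B_adjoint_left)

lemma mul_represented: "represents (mul Q) M"
  unfolding represents_def E_def
proof (intro conjI ballI allI)
  fix q q' assume q: "q \<in> car Q" "q' \<in> car Q"
  obtain a f b g where [simp]: "q = (a, f)" "q' = (b, g)" by (cases q, cases q')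
  have fg: "f \<in> conf_dual s" "g \<in> conf_dual s" using q by (auto simp: car_Q)
  have br: "mul Q q q' = pair_poly (mul_P z a b) (- dual_act (succ_lam z) a g
               - skew_subst der_dual (dual_act (succ_lam z) b f))"
    by (simp add: semidirect_def)
  show "coeff (mul Q q q') k \<in> car Q" for k
    unfolding br by (simp add: car_Q coeff_pair_poly conf_dual_diff conf_dual_closed dual_act_in[OF _ succ_symbol]
        opposite_in[OF _ succ_symbol] fg)
  fix x t w assume w: "w \<in> V"
  note w' = V_lin[OF w] additive_lin[OF V_lin[OF w]]
  show "peval (\<lambda>q. \<omega> w (ev x q)) t (mul Q q q') = \<omega> w (M (- t) (x + t) (ev (- t) q) (ev (x + t) q'))"
    unfolding br by (simp add: peval_pair_poly w peval_diff[OF additive_poly_at] peval_minus[OF additive_poly_at]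
        dual_act_eval[OF _ succ_symbol]
        opposite_eval[OF _ succ_symbol] fg mul_P_def peval_add[OF additive_peval[OF w'(2)]]
        has_symbolD(2)[OF succ_symbol] peval2_opposite[OF succ_symbol] w')
      (simp add: \<omega>_def M_def ev_def lin_simps[OF w'(1)])
qed (simp_all add: M_in M_adjoint M_adjoint_left)

abbreviation \<rho> where "\<rho> \<equiv> canonical_r Q n e es"

lemma dual_embed_in: "lin \<phi> \<Longrightarrow> dual_embed \<phi> \<in> conf_dual s"
  by (auto simp: conf_dual_def dual_embed_def poly_eq_iff coeff_map_poly lin_simps map_poly_pCons)

lemma dual_embed_const: "lin \<phi> \<Longrightarrow> poly (dual_embed \<phi> [:u:]) y = \<phi> u"
  by (simp add: dual_embed_def map_poly_pCons lin_simps)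

lemma legs_in: "([:a:], 0) \<in> car Q" "lin \<phi> \<Longrightarrow> (0, dual_embed \<phi>) \<in> car Q"
  by (auto simp: car_Q conf_dual_closed dual_embed_in)

lemma canonical_r_in: "\<rho> \<in> Tens2 Q"
proof -
  have "(\<Sum>i\<in>I. tens2 Q ([:e i:], 0) (0, dual_embed (es i)) - tens2 Q (0, dual_embed (es i)) ([:e i:], 0))
      \<in> Tens2 Q" if "I \<subseteq> {1..n}" for I
    using that by (induction I rule: infinite_finite_induct)
      (auto intro!: Tens2_add Tens2_diff[OF kd_module_Q] Tens2_tens2 legs_in lin_es)
  then show ?thesis unfolding canonical_r_def by blast
qed

text \<open>Both sums over the dual bases are expansions of a covector in these bases, and the two together are \<open>\<omega>\<close>.\<close>

lemma canonical_r_E: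
  assumes wv: "w \<in> V" "v \<in> V"
  shows "\<rho> (E x w) (E y v) = \<omega> w v"
proof -
  have "\<rho> (E x w) (E y v) = (\<Sum>i=1..n. es i (fst w) * snd v (e i) - es i (fst v) * snd w (e i))"
    unfolding canonical_r_def sum_fun2
    by (rule sum.cong) (use wv lin_es in \<open>simp_all add: tens2_E E_apply \<omega>_ev dual_embed_const V_lin lin_simps\<close>)
  also have "\<dots> = \<omega> w v"
    using coordinates[OF V_lin[OF wv(2)], of "fst w"] coordinates[OF V_lin[OF wv(1)], of "fst v"]
    by (simp add: sum_subtractf \<omega>_def)
  finally show ?thesis .
qed

sublocale canonical: affine_symplectic_poisson Q V ev \<omega> B M \<rho>
  "\<lambda>v. ([:fst v:], dual_embed (snd v))"
proof (intro affine_symplectic_poisson.intro symplectic_poisson.intro graded_poisson.intro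
    momentum_space_axioms graded_poisson_axioms.intro symplectic_poisson_axioms.intro
    affine_symplectic_poisson_axioms.intro)
  show "represents (brk Q) B" by (rule brk_represented)
  show "represents (mul Q) M" by (rule mul_represented)
  show "\<rho> \<in> Tens2 Q" by (rule canonical_r_in)
  show "\<rho> (E x w) (E y v) = \<omega> w v" if "w \<in> V" "v \<in> V" for x w y v
    by (rule canonical_r_E[OF that])
  show "([:fst v:], dual_embed (snd v)) \<in> car Q" if "v \<in> V" for v
    using that by (simp add: car_Q dual_embed_in V_lin)
  show "ev x ([:fst v:], dual_embed (snd v)) = v" if "v \<in> V" for x v
    using that by (simp add: ev_def dual_embed_const V_lin)
qed (erule (3) B_jacobi M_assoc BM_leibniz | erule (2) B_cocycle B_affine M_cocycle | assumption
    | rule B_skew M_comm M_const)+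

end

theorem theorem5p21:
  fixes s :: "'k::field_char_0 \<Rightarrow> 'a::ab_group_add \<Rightarrow> 'a"
    and l r z d :: "'a \<Rightarrow> 'a \<Rightarrow> 'a"
    and n :: nat and e :: "nat \<Rightarrow> 'a" and es :: "nat \<Rightarrow> 'a \<Rightarrow> 'k"
  assumes "vector_space s"
    and "pre_PGD s l r z d"
    and "inj_on e {1..n}" and "\<not> module.dependent s (e ` {1..n})"
    and "module.span s (e ` {1..n}) = UNIV"
    and "\<forall>i\<in>{1..n}. Vector_Spaces.linear s (*) (es i)"
    and "\<forall>i\<in>{1..n}. \<forall>j\<in>{1..n}. es i (e j) = (if i = j then 1 else 0)"
  shows "let Q = semidirect s l r z d; \<rho> = canonical_r Q n e es in
           skew_symmetric_tensor Q \<rho> \<and> PCYBE_solution Q \<rho> \<and>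
           poisson_conformal_bialgebra Q (delta_of Q \<rho>) (Delta_of Q \<rho>)"
proof -
  interpret vector_space s by fact
  interpret pre_PGD_basis s l r z d n e es
    by (intro pre_PGD_basis.intro pre_PGD_algebra.intro pre_PGD_algebra_axioms.intro
        pre_PGD_basis_axioms.intro) (use assms in blast)+
  show ?thesis using canonical.skew_symmetric canonical.PCYBE canonical.bialgebra by (simp add: Let_def)
qed

end
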